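(* Let $k,\ell\ge 2$ be natural numbers. (a) For every $\omega$-automatic presentation $(L,h)$ of a $(k,\ell)$-partition $G=(V,E_1,\dots,E_\ell)$ with $|V|=\aleph_0$, there exists a regular $\omega$-language $H\subseteq L$ such that $h(H)$ is homogeneous in $G$ and $|h(H)|=\aleph_0$. (b) For every injective $\omega$-automatic presentation $(L,h)$ of a $(k,\ell)$-partition $G=(V,E_1,\dots,E_\ell)$ with $|V|=2^{\aleph_0}$, there exists a regular $\omega$-language $H\subseteq L$ such that $h(H)$ is homogeneous in $G$ and $|h(H)|=\aleph_0$. (c) There exists a $(k,\ell)$-partition $G=(V,E_1,\dots,E_\ell)$ with $|V|=2^{\aleph_0}$ and an $\omega$-automatic presentation $(L,h)$ of $G$ such that there is no $H\subseteq L$ with $H\in\mathrm{LANG}^*$ for which $h(H)$ is homogeneous in $G$ and $|h(H)|=\aleph_0$. In particular, no such $H$ exists that is a context-free $\omega$-language, nor one that is a regular $\omega$-language.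
   Context: For a set $V$ and $k\ge1$, $[V]^k$ is the set of $k$-element subsets of $V$. A $(k,\ell)$-partition is a tuple $G=(V,E_1,\dots,E_\ell)$ where $(E_1,\dots,E_\ell)$ is a partition of $[V]^k$ into possibly empty sets; its size is $|V|$. A set $W\subseteq V$ is homogeneous if $[W]^k\subseteq E_i$ for some $1\le i\le\ell$. For $\omega$-words $x_j=a_j^0a_j^1a_j^2\cdots$ over a finite alphabet $\Gamma$, the convolution $(x_1,\dots,x_n)^\otimes$ is the $\omega$-word $(a_1^0,\dots,a_n^0)(a_1^1,\dots,a_n^1)\cdots$ over $\Gamma^n$. A relation $R\subseteq(\Gamma^\omega)^n$ is $\omega$-automatic if $\{(x_1,\dots,x_n)^\otimes\mid (x_1,\dots,x_n)\in R\}$ is a regular (Büchi-recognizable) $\omega$-language. An $\omega$-automatic presentation of a $(k,\ell)$-partition $(V,E_1,\dots,E_\ell)$ is a pair $(L,h)$ with $L$ a regular $\omega$-language over some finite alphabet and $h:L\to V$ a surjection such that the relations $\{(x_1,\dots,x_k)\in L^k\mid \{h(x_1),\dots,h(x_k)\}\in E_i\}$ (for $1\le i\le\ell$) and $\{(x_1,x_2)\in L^2\mid h(x_1)=h(x_2)\}$ are $\omega$-automatic. It is injective if $h$ is a bijection. $\mathrm{LANG}^*$ is the class of $\omega$-languages of the form $\bigcup_{1\le i\le n}U_iV_i^\omega$ where $U_i,V_i$ are arbitrary languages of finite words (for $V\subseteq\Gamma^+$, $V^\omega$ is the set of $\omega$-words $v_0v_1v_2\cdots$ with $v_i\in V$).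 A context-free $\omega$-language is one accepted by a pushdown automaton with Büchi acceptance on states. *)

theory Defs
  imports
    "HOL-Library.Omega_Words_Fun"
    "HOL-Library.Ramsey"
    "HOL-Library.Disjoint_Sets"
begin

text \<open>
  All \<open>\<omega>\<close>-words are of type \<^typ>\<open>'a word\<close>, where the type \<^typ>\<open>'a\<close> need not be finite. The
  finiteness of the alphabet is part of each of the language classes below: each automaton (or
  expression) carries a finite alphabet \<open>\<Sigma> \<subseteq> 'a\<close>, and all words it describes are over \<open>\<Sigma>\<close>.
\<close>

section \<open>Regular \<open>\<omega>\<close>-languages\<close>

record ('q, 'a) buchi =
  ba_alphabet :: "'a set"
  ba_states :: "'q set"
  ba_initial :: "'q set"
  ba_trans :: "('q \<times> 'a \<times> 'q) set"
  ba_accepting :: "'q set"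

definition buchi_automaton :: "('q, 'a) buchi \<Rightarrow> bool" where
  "buchi_automaton A \<longleftrightarrow>
     finite (ba_alphabet A) \<and> finite (ba_states A) \<and>
     ba_initial A \<subseteq> ba_states A \<and> ba_accepting A \<subseteq> ba_states A \<and>
     ba_trans A \<subseteq> ba_states A \<times> ba_alphabet A \<times> ba_states A"

definition buchi_language :: "('q, 'a) buchi \<Rightarrow> 'a word set" where
  "buchi_language A = {w. \<exists>r :: nat \<Rightarrow> 'q.
     r 0 \<in> ba_initial A \<and> (\<forall>i. (r i, w i, r (Suc i)) \<in> ba_trans A) \<and>
     (\<exists>\<^sub>\<infinity>i. r i \<in> ba_accepting A)}"

text \<open>The states are natural numbers without loss of generality, since there are finitely many.\<close>

definition omega_regular :: "'a word set \<Rightarrow> bool" where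
  "omega_regular L \<longleftrightarrow> (\<exists>A :: (nat, 'a) buchi. buchi_automaton A \<and> L = buchi_language A)"

section \<open>Automatic relations\<close>

text \<open>
  Tuples are lists, so an \<open>n\<close>-ary relation on \<open>\<omega>\<close>-words is a set of lists of length \<open>n\<close>, and the
  letters in \<open>\<Gamma>\<^sup>n\<close> of a convolution are lists of length \<open>n\<close>.
\<close>

definition convolution :: "'a word list \<Rightarrow> 'a list word" where
  "convolution xs = (\<lambda>i. map (\<lambda>x. x i) xs)"

definition omega_automatic :: "nat \<Rightarrow> 'a word list set \<Rightarrow> bool" where
  "omega_automatic n R \<longleftrightarrow> (\<forall>xs\<in>R. length xs = n) \<and> omega_regular (convolution ` R)"

section \<open>Partitions of the \<open>k\<close>-subsets and their presentations\<close>

text \<open>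
  The classes are \<open>E 1, \<dots>, E l\<close>; other values of \<open>E\<close> are irrelevant.
  They may be empty, so \<^const>\<open>partition_on\<close> does not apply.
\<close>

definition kl_partition :: "nat \<Rightarrow> nat \<Rightarrow> 'v set \<Rightarrow> (nat \<Rightarrow> 'v set set) \<Rightarrow> bool" where
  "kl_partition k l V E \<longleftrightarrow>
     (\<Union>i\<in>{1..l}. E i) = [V]\<^bsup>k\<^esup> \<and> disjoint_family_on E {1..l}"

definition homogeneous :: "nat \<Rightarrow> nat \<Rightarrow> 'v set \<Rightarrow> (nat \<Rightarrow> 'v set set) \<Rightarrow> 'v set \<Rightarrow> bool" where
  "homogeneous k l V E W \<longleftrightarrow> W \<subseteq> V \<and> (\<exists>i\<in>{1..l}. [W]\<^bsup>k\<^esup> \<subseteq> E i)"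

text \<open>Only the values of \<open>h\<close> on \<open>L\<close> matter.\<close>

definition omega_automatic_presentation ::
    "nat \<Rightarrow> nat \<Rightarrow> 'v set \<Rightarrow> (nat \<Rightarrow> 'v set set) \<Rightarrow> 'a word set \<Rightarrow> ('a word \<Rightarrow> 'v) \<Rightarrow> bool" where
  "omega_automatic_presentation k l V E L h \<longleftrightarrow>
     omega_regular L \<and> h ` L = V \<and>
     (\<forall>i\<in>{1..l}. omega_automatic k {xs. length xs = k \<and> set xs \<subseteq> L \<and> h ` set xs \<in> E i}) \<and>
     omega_automatic 2 {[x, y] | x y. x \<in> L \<and> y \<in> L \<and> h x = h y}"

definition injective_omega_automatic_presentation ::
    "nat \<Rightarrow> nat \<Rightarrow> 'v set \<Rightarrow> (nat \<Rightarrow> 'v set set) \<Rightarrow> 'a word set \<Rightarrow> ('a word \<Rightarrow> 'v) \<Rightarrow> bool" where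
  "injective_omega_automatic_presentation k l V E L h \<longleftrightarrow>
     omega_automatic_presentation k l V E L h \<and> bij_betw h L V"

section \<open>The class \<open>LANG\<^sup>*\<close>\<close>

text \<open>
  An \<open>\<omega>\<close>-word \<open>w\<close> equals \<open>v 0 v 1 v 2 \<dots>\<close>, for nonempty words \<open>v i\<close>, iff each of the finite
  products \<open>v 0 \<dots> v (n - 1)\<close> is a prefix of it. To be used for \<open>[] \<notin> V\<close> only.
\<close>

definition omega_power :: "'a list set \<Rightarrow> 'a word set" where
  "omega_power V = {w. \<exists>v :: nat \<Rightarrow> 'a list. (\<forall>i. v i \<in> V) \<and>
     (\<forall>n. prefix (length (concat (map v [0..<n]))) w = concat (map v [0..<n]))}"

definition LANG_star :: "'a word set \<Rightarrow> bool" where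
  "LANG_star L \<longleftrightarrow> (\<exists>\<Sigma> (n :: nat) U V. finite \<Sigma> \<and>
     (\<forall>i\<in>{1..n}. U i \<subseteq> lists \<Sigma> \<and> V i \<subseteq> lists \<Sigma> - {[]}) \<and>
     L = (\<Union>i\<in>{1..n}. {u \<frown> w | u w. u \<in> U i \<and> w \<in> omega_power (V i)}))"

section \<open>Context-free \<open>\<omega>\<close>-languages\<close>

text \<open>
  A transition \<open>(q, x, X, q', \<gamma>)\<close> goes from state \<open>q\<close> to state \<open>q'\<close>, reads the letter \<open>a\<close> if
  \<open>x = Some a\<close> and nothing if \<open>x = None\<close>, and replaces the topmost stack symbol \<open>X\<close> by \<open>\<gamma>\<close>.
\<close>

record ('q, 'a, 's) pda =
  pda_alphabet :: "'a set"
  pda_states :: "'q set"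
  pda_stack :: "'s set"
  pda_initial :: 'q
  pda_bottom :: 's
  pda_trans :: "('q \<times> 'a option \<times> 's \<times> 'q \<times> 's list) set"
  pda_accepting :: "'q set"

definition pushdown_automaton :: "('q, 'a, 's) pda \<Rightarrow> bool" where
  "pushdown_automaton P \<longleftrightarrow>
     finite (pda_alphabet P) \<and> finite (pda_states P) \<and> finite (pda_stack P) \<and>
     finite (pda_trans P) \<and>
     pda_initial P \<in> pda_states P \<and> pda_bottom P \<in> pda_stack P \<and>
     pda_accepting P \<subseteq> pda_states P \<and>
     pda_trans P \<subseteq> pda_states P \<times> ({None} \<union> Some ` pda_alphabet P) \<times> pda_stack P \<times>
       pda_states P \<times> lists (pda_stack P)"

text \<open>
  A configuration on the input \<open>w\<close> consists of the state, the number of letters of \<open>w\<close> read so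
  far, and the stack contents with the topmost symbol first.
\<close>

inductive pda_step ::
    "('q, 'a, 's) pda \<Rightarrow> 'a word \<Rightarrow> 'q \<times> nat \<times> 's list \<Rightarrow> 'q \<times> nat \<times> 's list \<Rightarrow> bool"
  for P w where
  silent: "(q, None, X, q', \<gamma>) \<in> pda_trans P \<Longrightarrow> pda_step P w (q, i, X # \<beta>) (q', i, \<gamma> @ \<beta>)"
| read: "(q, Some (w i), X, q', \<gamma>) \<in> pda_trans P \<Longrightarrow>
    pda_step P w (q, i, X # \<beta>) (q', Suc i, \<gamma> @ \<beta>)"

text \<open>An accepting run has to read the whole input.\<close>

definition pda_language :: "('q, 'a, 's) pda \<Rightarrow> 'a word set" where
  "pda_language P = {w. \<exists>c :: nat \<Rightarrow> 'q \<times> nat \<times> 's list.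
     c 0 = (pda_initial P, 0, [pda_bottom P]) \<and>
     (\<forall>n. pda_step P w (c n) (c (Suc n))) \<and>
     (\<forall>i. \<exists>n. i \<le> fst (snd (c n))) \<and>
     (\<exists>\<^sub>\<infinity>n. fst (c n) \<in> pda_accepting P)}"

definition omega_context_free :: "'a word set \<Rightarrow> bool" where
  "omega_context_free L \<longleftrightarrow>
     (\<exists>P :: (nat, 'a, nat) pda. pushdown_automaton P \<and> L = pda_language P)"

end

theory Submission
  imports Defs "HOL-Analysis.Continuum_Not_Denumerable"
begin

text \<open>
  For (a) and (b), some class of end-equal words meets infinitely many \<open>h\<close>-classes. Otherwise there
  are words \<open>x\<^sub>0, x\<^sub>1, \<dots>\<close> such that no word end-equal to \<open>x\<^sub>j\<close> is equivalent to \<open>x\<^sub>i\<close> for \<open>j < i\<close>. By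
  Ramsey's theorem, two of them can be cut into blocks with the same idempotent transition
  behaviour, so blocks may be exchanged between the two; exchanging along a chain of sets
  of blocks indexed by the reals yields uncountably many classes (or, if \<open>h\<close> is injective,
  infinitely many words in one end class). A compactness and Ramsey argument inside that end class
  gives pairwise inequivalent words \<open>u v\<^sup>m t\<close> in \<open>L\<close>. Powers of \<open>v\<close> are eventually periodic in every
  finite semigroup, so, for suitable \<open>N\<close>, all \<open>k\<close>-subsets of the words with \<open>m\<close> a positive multiple
  of \<open>N\<close> lie in one class of the partition.

  For (c), take the classes of end-equal binary words and put all \<open>k\<close>-sets into one class. In
  \<open>U V\<^sup>\<omega>\<close>, either all words of \<open>V\<close> commute and there are finitely many end classes, or two words do not
  commute and there are uncountably many.
\<close>

section \<open>Positions and blocks\<close>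

text \<open>The kernel of \<open>h\<close> is visible only through the profiles of blocks of pairs
  of words. To exchange blocks between \<open>x\<close> and \<open>y\<close>, the pairs
  \<open>(x, x)\<close> and \<open>(y, y)\<close> must have the same profile \<open>e\<close>;
  \<open>(x, y)\<close> has some profile \<open>d\<close>, but nothing controls
  \<open>(y, x)\<close>. This is why the exchanged words are indexed by a chain of sets: for
  \<open>S \<subseteq> T\<close>, only agreements and \<open>(x, y)\<close> occur. Countably many
  classes force a collision in a chain indexed by the reals, and the collision propagates, because
  equivalence depends only on the sequence of profiles: in the end \<open>x\<close> is equivalent to
  a word that ends like \<open>y\<close>. The cases (a) and (b) differ only in how this
  contradiction is used, so both are treated under the assumption that there are countably many
  classes or that \<open>h\<close> is injective. In (c), context-free languages need no
  combinatorics of their own: cutting an accepting run where the stack never becomes lower again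
  puts them into LANG-star, and no language of that class meets exactly countably infinitely many
  end classes.\<close>

lemma ex_concatenation:
  fixes g :: "nat \<Rightarrow> nat" and \<rho> :: "nat \<Rightarrow> nat \<Rightarrow> 'c"
  assumes g: "strict_mono g" "g 0 = 0"
    and \<rho>: "\<And>i. \<rho> i (g (Suc i) - g i) = \<rho> (Suc i) 0"
  obtains r where "\<And>i j. j \<le> g (Suc i) - g i \<Longrightarrow> r (g i + j) = \<rho> i j"
proof
  \<comment> \<open>\<open>merge\<close> reads position \<open>n\<close> from the sequence whose
    half-open block \<open>g i \<le> n < g (Suc i)\<close> contains it. The right end of block
    \<open>i\<close> is thus supplied by block \<open>i + 1\<close>, which is why the hypothesis
    equates the two values.\<close>
  let ?r = "merge (\<lambda>i n. \<rho> i (n - g i)) g"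
  have idx: "idx_sequence g"
    using g by (simp add: idx_sequence_def strict_monoD)
  fix i j assume j: "j \<le> g (Suc i) - g i"
  have less: "g i < g (Suc i)" "g (Suc i) < g (Suc (Suc i))"
    using g by (simp_all add: strict_monoD)
  show "?r (g i + j) = \<rho> i j"
  proof (cases "j = g (Suc i) - g i")
    case True
    then have "g i + j = g (Suc i)" using less by simp
    then show ?thesis
      using merge[OF idx, of "g (Suc i)" "Suc i" "\<lambda>i n. \<rho> i (n - g i)"] less \<rho>[of i] True by simp
  next
    case False
    then show ?thesis
      using merge[OF idx, of "g i + j" i "\<lambda>i n. \<rho> i (n - g i)"] j by simp
  qed
qed

lemma strict_mono_interval:
  fixes g :: "nat \<Rightarrow> nat"
  assumes "strict_mono g" "g 0 \<le> n"
  obtains i where "g i \<le> n" "n < g (Suc i)"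
proof -
  have "n < g (Suc n)"
    using strict_mono_imp_increasing[OF assms(1), of "Suc n"] by simp
  then obtain j where j: "n < g j" "\<And>i. i < j \<Longrightarrow> \<not> n < g i"
    using exists_least_iff[of "\<lambda>j. n < g j"] by blast
  with assms(2) obtain i where "j = Suc i" by (cases j) auto
  with j(1) j(2)[of i] that[of i] show thesis by simp
qed

lemma strict_mono_interval_unique:
  fixes g :: "nat \<Rightarrow> nat"
  assumes "strict_mono g" "g i \<le> n" "n < g (Suc i)" "g j \<le> n" "n < g (Suc j)"
  shows "i = j"
  using assms by (metis Suc_leI leD le_less_trans linorder_neqE_nat strict_mono_less_eq)

text \<open>The blocks omit their left ends and contain their right ends, as the flag of a profile
  does. They partition the positions beyond \<open>g 0\<close>, and each is finite.\<close>

lemma INFM_blocks: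
  fixes g :: "nat \<Rightarrow> nat"
  assumes g: "strict_mono g"
  shows "(\<exists>\<^sub>\<infinity>n. P n) \<longleftrightarrow> (\<exists>\<^sub>\<infinity>i. \<exists>n. g i < n \<and> n \<le> g (Suc i) \<and> P n)" (is "?l \<longleftrightarrow> ?r")
proof
  assume l: ?l
  show ?r
    unfolding INFM_nat
  proof
    fix m
    obtain n where n: "n > g (Suc m)" "P n" using l unfolding INFM_nat by blast
    have "g 0 \<le> n - 1"
      using n(1) strict_mono_less_eq[OF g, of 0 "Suc m"] by simp
    then obtain i where i: "g i \<le> n - 1" "n - 1 < g (Suc i)"
      using strict_mono_interval[OF g] by blast
    have "\<not> i \<le> m"
    proof
      assume "i \<le> m"
      then have "g (Suc i) \<le> g (Suc m)" using strict_mono_less_eq[OF g] by simp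
      with i n show False by simp
    qed
    with i n show "\<exists>i>m. \<exists>n. g i < n \<and> n \<le> g (Suc i) \<and> P n"
      by (intro exI[of _ i]) (auto intro!: exI[of _ n])
  qed
next
  assume r: ?r
  show ?l
    unfolding INFM_nat
  proof
    fix m
    obtain i n where "i > m" "g i < n" "P n" using r unfolding INFM_nat by blast
    moreover have "i \<le> g i" using g by (rule strict_mono_imp_increasing)
    ultimately show "\<exists>n>m. P n" by (intro exI[of _ n]) simp
  qed
qed

lemma subsequence_split:
  "i \<le> j \<Longrightarrow> j \<le> k \<Longrightarrow> subsequence w i k = subsequence w i j @ subsequence w j k"
  unfolding subsequence_def by (metis le_add_diff_inverse map_append upt_add_eq_append)

lemma subsequence_cong:
  "(\<And>p. i \<le> p \<Longrightarrow> p < j \<Longrightarrow> w p = w' p) \<Longrightarrow> subsequence w i j = subsequence w' i j"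
  unfolding subsequence_def by simp

lemma subsequence_eq_nth: "subsequence w i j = subsequence w' i j \<Longrightarrow> i \<le> p \<Longrightarrow> p < j \<Longrightarrow> w p = w' p"
  unfolding subsequence_def by simp

lemma subsequence_shift_cong:
  assumes "\<And>p. p < m \<Longrightarrow> w (i + p) = w' (j + p)"
  shows "subsequence w i (i + m) = subsequence w' j (j + m)"
  using assms by (intro nth_equalityI) auto

section \<open>Transition profiles of finite words\<close>

text \<open>A triple \<open>(p, b, q)\<close> stands for a run from \<open>p\<close> to
  \<open>q\<close>, with \<open>b\<close> recording a visit to an accepting state. This is the
  product of the finite transition semigroup of a Buchi automaton.\<close>

definition profile_comp :: "('q \<times> bool \<times> 'q) set \<Rightarrow> ('q \<times> bool \<times> 'q) set \<Rightarrow> ('q \<times> bool \<times> 'q) set"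
    (infixr \<open>\<bullet>\<close> 70) where
  "X \<bullet> Y = {(p, b \<or> c, r) | p b c r. \<exists>q. (p, b, q) \<in> X \<and> (q, c, r) \<in> Y}"

text \<open>The flag counts the state reached but not the state of departure, so the flags of
  adjacent factors account for each visit exactly once.\<close>

primrec profile :: "('q, 'a) buchi \<Rightarrow> 'a list \<Rightarrow> ('q \<times> bool \<times> 'q) set" where
  "profile A [] = {(p, False, p) | p. p \<in> ba_states A}"
| "profile A (a # s) =
    {(p, q \<in> ba_accepting A, q) | p q. (p, a, q) \<in> ba_trans A} \<bullet> profile A s"

lemma profile_compI: "(p, b, q) \<in> X \<Longrightarrow> (q, c, r) \<in> Y \<Longrightarrow> (p, b \<or> c, r) \<in> X \<bullet> Y"
  unfolding profile_comp_def by blast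

lemma profile_compE:
  assumes "x \<in> X \<bullet> Y"
  obtains p b q c r where "x = (p, b \<or> c, r)" "(p, b, q) \<in> X" "(q, c, r) \<in> Y"
  using assms unfolding profile_comp_def by blast

lemma profile_comp_assoc: "(X \<bullet> Y) \<bullet> Z = X \<bullet> Y \<bullet> Z"
proof (intro set_eqI iffI)
  fix x assume "x \<in> (X \<bullet> Y) \<bullet> Z"
  then obtain p b q d r where 1: "x = (p, b \<or> d, r)" "(p, b, q) \<in> X \<bullet> Y" "(q, d, r) \<in> Z"
    by (rule profile_compE)
  from 1(2) obtain b' q' c where 2: "b = (b' \<or> c)" "(p, b', q') \<in> X" "(q', c, q) \<in> Y"
    by (rule profile_compE) simp
  show "x \<in> X \<bullet> Y \<bullet> Z"
    using profile_compI[OF 2(2) profile_compI[OF 2(3) 1(3)]] 1(1) 2(1) by (simp only: disj_assoc)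
next
  fix x assume "x \<in> X \<bullet> Y \<bullet> Z"
  then obtain p b q d r where 1: "x = (p, b \<or> d, r)" "(p, b, q) \<in> X" "(q, d, r) \<in> Y \<bullet> Z"
    by (rule profile_compE)
  from 1(3) obtain d' q' c where 2: "d = (c \<or> d')" "(q, c, q') \<in> Y" "(q', d', r) \<in> Z"
    by (rule profile_compE) simp
  show "x \<in> (X \<bullet> Y) \<bullet> Z"
    using profile_compI[OF profile_compI[OF 1(2) 2(2)] 2(3)] 1(1) 2(1) by (simp only: disj_assoc)
qed

lemma profile_subset:
  assumes "buchi_automaton A"
  shows "profile A s \<subseteq> ba_states A \<times> UNIV \<times> ba_states A"
  using assms by (induction s) (auto simp: profile_comp_def buchi_automaton_def)

lemma profile_append:
  assumes "buchi_automaton A"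
  shows "profile A (s @ t) = profile A s \<bullet> profile A t"
proof (induction s)
  case Nil
  show ?case
  proof (intro equalityI subsetI)
    fix x assume x: "x \<in> profile A ([] @ t)"
    then obtain p b q where "x = (p, b, q)" "p \<in> ba_states A"
      using profile_subset[OF assms, of t] by auto
    then show "x \<in> profile A [] \<bullet> profile A t"
      using x profile_compI[of p False p "profile A []" b q "profile A t"] by simp
  qed (auto simp: profile_comp_def)
next
  case (Cons a s)
  then show ?case by (simp add: profile_comp_assoc)
qed

definition profiles :: "('q, 'a) buchi \<Rightarrow> ('q \<times> bool \<times> 'q) set set" where
  "profiles A = Pow (ba_states A \<times> UNIV \<times> ba_states A)"

lemma finite_profiles: "buchi_automaton A \<Longrightarrow> finite (profiles A)"
  by (simp add: profiles_def buchi_automaton_def)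

lemma profile_in_profiles: "buchi_automaton A \<Longrightarrow> profile A s \<in> profiles A"
  by (simp add: profiles_def profile_subset)

lemma profile_iff_run:
  assumes "buchi_automaton A"
  shows "(p, b, q) \<in> profile A s \<longleftrightarrow>
    (\<exists>r. r 0 = p \<and> r (length s) = q \<and> p \<in> ba_states A \<and>
      (\<forall>i<length s. (r i, s ! i, r (Suc i)) \<in> ba_trans A) \<and>
      (b \<longleftrightarrow> (\<exists>i. 0 < i \<and> i \<le> length s \<and> r i \<in> ba_accepting A)))"
proof (induction s arbitrary: p b)
  case Nil
  show ?case by (auto intro: exI[of _ "\<lambda>_. p"])
next
  case (Cons a s)
  have st: "(p, a, q) \<in> ba_trans A \<Longrightarrow> p \<in> ba_states A \<and> q \<in> ba_states A" for p q
    using assms by (auto simp: buchi_automaton_def)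
  show ?case
  proof
    assume "(p, b, q) \<in> profile A (a # s)"
    then obtain p' c where p': "(p, a, p') \<in> ba_trans A" "(p', c, q) \<in> profile A s"
      "b \<longleftrightarrow> p' \<in> ba_accepting A \<or> c"
      by (auto simp: profile_comp_def)
    then obtain r where r: "r 0 = p'" "r (length s) = q"
      "\<forall>i<length s. (r i, s ! i, r (Suc i)) \<in> ba_trans A"
      "c \<longleftrightarrow> (\<exists>i. 0 < i \<and> i \<le> length s \<and> r i \<in> ba_accepting A)"
      using Cons.IH by auto
    have "b \<longleftrightarrow> (\<exists>i. 0 < i \<and> i \<le> length (a # s) \<and> (p ## r) i \<in> ba_accepting A)" (is "_ \<longleftrightarrow> ?A")
    proof -
      have "?A \<longleftrightarrow> (\<exists>i\<le>length s. r i \<in> ba_accepting A)"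
        by (metis Suc_le_mono Suc_pred build.simps(2) length_Cons zero_less_Suc)
      also have "\<dots> \<longleftrightarrow> b"
        using p'(3) r(1,4) by (metis le0 not_gr0)
      finally show ?thesis by simp
    qed
    moreover have "\<forall>i<length (a # s). ((p ## r) i, (a # s) ! i, (p ## r) (Suc i)) \<in> ba_trans A"
      using p' r by (auto simp: less_Suc_eq_0_disj)
    ultimately show "\<exists>r. r 0 = p \<and> r (length (a # s)) = q \<and> p \<in> ba_states A \<and>
      (\<forall>i<length (a # s). (r i, (a # s) ! i, r (Suc i)) \<in> ba_trans A) \<and>
      (b \<longleftrightarrow> (\<exists>i. 0 < i \<and> i \<le> length (a # s) \<and> r i \<in> ba_accepting A))"
      using r p' st by (intro exI[of _ "p ## r"]) simp
  next
    assume "\<exists>r. r 0 = p \<and> r (length (a # s)) = q \<and> p \<in> ba_states A \<and>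
      (\<forall>i<length (a # s). (r i, (a # s) ! i, r (Suc i)) \<in> ba_trans A) \<and>
      (b \<longleftrightarrow> (\<exists>i. 0 < i \<and> i \<le> length (a # s) \<and> r i \<in> ba_accepting A))"
    then obtain r where r: "r 0 = p" "r (Suc (length s)) = q"
      "\<forall>i<Suc (length s). (r i, (a # s) ! i, r (Suc i)) \<in> ba_trans A"
      "b \<longleftrightarrow> (\<exists>i. 0 < i \<and> i \<le> Suc (length s) \<and> r i \<in> ba_accepting A)"
      by auto
    let ?c = "\<exists>i. 0 < i \<and> i \<le> length s \<and> r (Suc i) \<in> ba_accepting A"
    have 1: "(p, a, r 1) \<in> ba_trans A" using r(1,3) by fastforce
    have "(r 1, ?c, q) \<in> profile A s"
      unfolding Cons.IH using r 1 st
      by (intro exI[of _ "\<lambda>i. r (Suc i)"]) fastforce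
    moreover have "b \<longleftrightarrow> r 1 \<in> ba_accepting A \<or> ?c"
      unfolding r(4)
      by (metis One_nat_def Suc_le_mono Suc_pred gr0I le0 zero_less_Suc)
    ultimately show "(p, b, q) \<in> profile A (a # s)"
      using 1 by (auto simp: profile_comp_def)
  qed
qed

text \<open>Each piece of an accepting run on \<open>w\<close> is replaced by a run on the
  corresponding block of \<open>w'\<close> with the same ends and the same flag. Corresponding
  blocks may differ in length; only the sequence of profiles matters.\<close>

lemma buchi_language_profile_cong:
  assumes A: "buchi_automaton A"
    and f: "strict_mono f" "f 0 = 0" and g: "strict_mono g" "g 0 = 0"
    and eq: "\<And>i. profile A (subsequence w (f i) (f (Suc i))) = profile A (subsequence w' (g i) (g (Suc i)))"
    and w: "w \<in> buchi_language A"
  shows "w' \<in> buchi_language A"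
proof -
  obtain r where r: "r 0 \<in> ba_initial A" "\<And>i. (r i, w i, r (Suc i)) \<in> ba_trans A"
    "\<exists>\<^sub>\<infinity>i. r i \<in> ba_accepting A"
    using w by (auto simp: buchi_language_def)
  have states: "r i \<in> ba_states A" for i
    using r(2)[of i] A by (auto simp: buchi_automaton_def)
  define acc where "acc i \<longleftrightarrow> (\<exists>n. f i < n \<and> n \<le> f (Suc i) \<and> r n \<in> ba_accepting A)" for i
  have "\<exists>\<rho>. \<rho> 0 = r (f i) \<and> \<rho> (g (Suc i) - g i) = r (f (Suc i)) \<and>
    (\<forall>j<g (Suc i) - g i. (\<rho> j, w' (g i + j), \<rho> (Suc j)) \<in> ba_trans A) \<and>
    (acc i \<longleftrightarrow> (\<exists>j. 0 < j \<and> j \<le> g (Suc i) - g i \<and> \<rho> j \<in> ba_accepting A))" for i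
  proof -
    have fi: "f i < f (Suc i)" using f by (simp add: strict_monoD)
    have "acc i \<longleftrightarrow> (\<exists>j. 0 < j \<and> j \<le> f (Suc i) - f i \<and> r (f i + j) \<in> ba_accepting A)"
      unfolding acc_def
    proof safe
      fix n assume "f i < n" "n \<le> f (Suc i)" "r n \<in> ba_accepting A"
      then show "\<exists>j. 0 < j \<and> j \<le> f (Suc i) - f i \<and> r (f i + j) \<in> ba_accepting A"
        by (intro exI[of _ "n - f i"]) auto
    next
      fix j assume "0 < j" "j \<le> f (Suc i) - f i" "r (f i + j) \<in> ba_accepting A"
      then show "\<exists>n. f i < n \<and> n \<le> f (Suc i) \<and> r n \<in> ba_accepting A"
        using fi by (intro exI[of _ "f i + j"]) auto
    qed
    then have "(r (f i), acc i, r (f (Suc i))) \<in> profile A (subsequence w (f i) (f (Suc i)))"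
      unfolding profile_iff_run[OF A] using fi r(2) states
      by (intro exI[of _ "\<lambda>j. r (f i + j)"]) simp
    then show ?thesis
      unfolding eq[of i] profile_iff_run[OF A] by auto
  qed
  then obtain \<rho> where \<rho>: "\<And>i. \<rho> i 0 = r (f i)" "\<And>i. \<rho> i (g (Suc i) - g i) = r (f (Suc i))"
    "\<And>i j. j < g (Suc i) - g i \<Longrightarrow> (\<rho> i j, w' (g i + j), \<rho> i (Suc j)) \<in> ba_trans A"
    "\<And>i. acc i \<longleftrightarrow> (\<exists>j. 0 < j \<and> j \<le> g (Suc i) - g i \<and> \<rho> i j \<in> ba_accepting A)"
    by metis
  obtain r' where r': "\<And>i j. j \<le> g (Suc i) - g i \<Longrightarrow> r' (g i + j) = \<rho> i j"
    using ex_concatenation[OF g, of \<rho>] \<rho>(1,2) by metis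
  have "r' 0 \<in> ba_initial A"
    using r'[of 0 0] \<rho>(1)[of 0] g f r(1) by simp
  moreover have "(r' n, w' n, r' (Suc n)) \<in> ba_trans A" for n
  proof -
    obtain i where i: "g i \<le> n" "n < g (Suc i)"
      using strict_mono_interval[OF g(1), of n] g(2) by auto
    show ?thesis
      using \<rho>(3)[of "n - g i" i] r'[of "n - g i" i] r'[of "Suc (n - g i)" i] i by simp
  qed
  moreover have "\<exists>\<^sub>\<infinity>n. r' n \<in> ba_accepting A"
  proof -
    have "\<exists>\<^sub>\<infinity>i. acc i"
      unfolding acc_def by (rule iffD1[OF INFM_blocks[OF f(1)] r(3)])
    moreover have "\<exists>n. g i < n \<and> n \<le> g (Suc i) \<and> r' n \<in> ba_accepting A" if acc: "acc i" for i
    proof -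
      obtain j where "0 < j" "j \<le> g (Suc i) - g i" "\<rho> i j \<in> ba_accepting A"
        using acc unfolding \<rho>(4) by blast
      then show ?thesis
        using r'[of j i] strict_monoD[OF g(1), of i "Suc i"] by (intro exI[of _ "g i + j"]) auto
    qed
    ultimately have "\<exists>\<^sub>\<infinity>i. \<exists>n. g i < n \<and> n \<le> g (Suc i) \<and> r' n \<in> ba_accepting A"
      by (rule INFM_mono)
    then show ?thesis
      by (rule iffD2[OF INFM_blocks[OF g(1)]])
  qed
  ultimately show ?thesis
    by (auto simp: buchi_language_def)
qed

lemma buchi_language_profile_iff:
  assumes "buchi_automaton A"
    and "strict_mono f" "f 0 = 0" and "strict_mono g" "g 0 = 0"
    and "\<And>i. profile A (subsequence w (f i) (f (Suc i))) = profile A (subsequence w' (g i) (g (Suc i)))"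
  shows "w \<in> buchi_language A \<longleftrightarrow> w' \<in> buchi_language A"
  using buchi_language_profile_cong[OF assms]
    buchi_language_profile_cong[OF assms(1,4,5,2,3) assms(6)[symmetric]] by blast

section \<open>Periodicity of powers in the profile semigroup\<close>

lemma profile_comp_in_profiles: "X \<in> profiles A \<Longrightarrow> Y \<in> profiles A \<Longrightarrow> X \<bullet> Y \<in> profiles A"
  unfolding profiles_def profile_comp_def by blast

lemma profile_concat_replicate:
  assumes "buchi_automaton A"
  shows "profile A (concat (replicate m s)) = ((\<bullet>) (profile A s) ^^ m) (profile A [])"
  using assms by (induction m) (simp_all add: profile_append)

text \<open>The \<open>m\<close>-th power is a map of the finite set of profiles to itself. Two of
  these maps coincide, so one period serves all words \<open>s\<close> simultaneously.\<close>

lemma ex_profile_period: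
  assumes A: "buchi_automaton A"
  obtains N where "N \<ge> 1"
    "\<And>s m a. N \<le> m \<Longrightarrow>
      profile A (concat (replicate (m + a * N) s)) = profile A (concat (replicate m s))"
proof -
  define F where "F m X = ((\<bullet>) X ^^ m) (profile A [])" for m X
  have F_in: "F m X \<in> profiles A" if "X \<in> profiles A" for m X
    unfolding F_def using that profile_in_profiles[OF A, of "[]"]
    by (induction m) (simp_all del: profile.simps add: profile_comp_in_profiles)
  have "range (\<lambda>m. restrict (F m) (profiles A)) \<subseteq> profiles A \<rightarrow>\<^sub>E profiles A"
    using F_in by auto
  then have "finite (range (\<lambda>m. restrict (F m) (profiles A)))"
    by (rule finite_subset) (simp add: finite_PiE finite_profiles[OF A])
  then have "\<not> inj (\<lambda>m. restrict (F m) (profiles A))"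
    using finite_imageD infinite_UNIV_nat by blast
  then obtain i j where ij: "i < j" and "restrict (F i) (profiles A) = restrict (F j) (profiles A)"
    unfolding inj_on_def by (metis linorder_neqE_nat)
  then have eq: "F i X = F j X" if "X \<in> profiles A" for X
    using that by (metis restrict_apply')
  define p where "p = j - i"
  have step: "F (m + p) X = F m X" if "i \<le> m" "X \<in> profiles A" for m X
  proof -
    have F_add: "F (a + b) X = ((\<bullet>) X ^^ a) (F b X)" for a b
      by (simp add: F_def funpow_add)
    have "F (m + p) X = F ((m - i) + j) X"
      using that(1) ij by (simp add: p_def)
    also have "\<dots> = F ((m - i) + i) X"
      unfolding F_add eq[OF that(2)] ..
    finally show ?thesis using that(1) by simp
  qed
  have steps: "F (m + a * p) X = F m X" if "i \<le> m" "X \<in> profiles A" for m a X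
  proof (induction a)
    case (Suc a)
    then show ?case using step[of "m + a * p" X] that by (simp add: algebra_simps)
  qed simp
  show ?thesis
  proof
    \<comment> \<open>A multiple of the period \<open>p\<close> that exceeds the preperiod
      \<open>i\<close>, so that one constant is both threshold and period.\<close>
    show "(i + 1) * p \<ge> 1" using ij by (simp add: p_def)
    fix s m a assume m: "(i + 1) * p \<le> m"
    have "i \<le> (i + 1) * p" using ij unfolding p_def
      by (metis One_nat_def Suc_leI add_leE le_add1 mult.right_neutral mult_le_mono2 zero_less_diff)
    with m have "i \<le> m" by linarith
    then have "F (m + (a * (i + 1)) * p) (profile A s) = F m (profile A s)"
      by (intro steps profile_in_profiles[OF A])
    then show "profile A (concat (replicate (m + a * ((i + 1) * p)) s)) = profile A (concat (replicate m s))"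
      unfolding profile_concat_replicate[OF A] F_def mult.assoc .
  qed
qed

section \<open>Constructions of regular languages\<close>

lemma omega_regular_buchi_language:
  fixes A :: "('q, 'a) buchi"
  assumes A: "buchi_automaton A"
  shows "omega_regular (buchi_language A)"
proof -
  obtain f :: "'q \<Rightarrow> nat" where f: "inj_on f (ba_states A)"
    using finite_imp_inj_to_nat_seg[of "ba_states A"] A by (auto simp: buchi_automaton_def)
  define B where "B = \<lparr>ba_alphabet = ba_alphabet A, ba_states = f ` ba_states A,
    ba_initial = f ` ba_initial A, ba_trans = (\<lambda>(p, a, q). (f p, a, f q)) ` ba_trans A,
    ba_accepting = f ` ba_accepting A\<rparr>"
  have "buchi_automaton B"
    using A unfolding buchi_automaton_def B_def by fastforce
  moreover have "buchi_language A = buchi_language B"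
  proof (intro equalityI subsetI)
    fix w assume "w \<in> buchi_language A"
    then obtain r where r: "r 0 \<in> ba_initial A" "\<forall>i. (r i, w i, r (Suc i)) \<in> ba_trans A"
      "\<exists>\<^sub>\<infinity>i. r i \<in> ba_accepting A"
      by (auto simp: buchi_language_def)
    have "\<exists>\<^sub>\<infinity>i. f (r i) \<in> f ` ba_accepting A"
      using r(3) by (rule INFM_mono) simp
    then show "w \<in> buchi_language B"
      using r(1,2) by (auto simp: buchi_language_def B_def image_iff intro!: exI[of _ "f \<circ> r"])
        (metis (mono_tags, lifting) case_prod_conv)
  next
    fix w assume "w \<in> buchi_language B"
    then obtain r where r: "r 0 \<in> f ` ba_initial A"
      "\<And>i. \<exists>p q. (p, w i, q) \<in> ba_trans A \<and> r i = f p \<and> r (Suc i) = f q"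
      "\<exists>\<^sub>\<infinity>i. r i \<in> f ` ba_accepting A"
      by (fastforce simp: buchi_language_def B_def)
    let ?g = "inv_into (ba_states A) f"
    have g: "?g (f p) = p" if "p \<in> ba_states A" for p
      using f that by simp
    have "?g (r 0) \<in> ba_initial A"
      using r(1) g A by (auto simp: buchi_automaton_def subset_iff)
    moreover have "(?g (r i), w i, ?g (r (Suc i))) \<in> ba_trans A" for i
    proof -
      obtain p q where "(p, w i, q) \<in> ba_trans A" "r i = f p" "r (Suc i) = f q" using r(2) by blast
      moreover from this have "p \<in> ba_states A" "q \<in> ba_states A"
        using A by (auto simp: buchi_automaton_def)
      ultimately show ?thesis using g by simp
    qed
    moreover have "\<exists>\<^sub>\<infinity>i. ?g (r i) \<in> ba_accepting A"
      using r(3) by (rule INFM_mono) (use g A in \<open>auto simp: buchi_automaton_def subset_iff\<close>)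
    ultimately show "w \<in> buchi_language A"
      by (auto simp: buchi_language_def intro!: exI[of _ "\<lambda>i. ?g (r i)"])
  qed
  ultimately show ?thesis
    by (auto simp: omega_regular_def)
qed

text \<open>The automaton follows \<open>z\<close> in the left copy, may change to \<open>t\<close>
  only in state \<open>Inl s\<close>, and then follows \<open>t\<close> in the right copy. The
  hypotheses on \<open>c\<close> and \<open>d\<close> say that a state determines the next letter
  and the next state; acceptance in the right copy forces the change to happen.\<close>

lemma omega_regular_splice:
  fixes z t :: "'a word" and c d :: "nat \<Rightarrow> nat"
  assumes fin: "finite (range c)" "finite (range d)" "finite (range z)" "finite (range t)"
    and c: "\<And>i j. c i = c j \<Longrightarrow> z i = z j \<and> c (Suc i) = c (Suc j)"
    and d: "\<And>i j. d i = d j \<Longrightarrow> t i = t j \<and> d (Suc i) = d (Suc j)"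
  shows "omega_regular {prefix n z \<frown> t | n. c n = s}"
proof -
  \<comment> \<open>The change already reads \<open>t 0\<close>, hence leads to \<open>d 1\<close>.
    \<open>Inl s\<close> is added to the states because \<open>s\<close> need not be a value of
    \<open>c\<close>.\<close>
  define A where "A = \<lparr>ba_alphabet = range z \<union> range t,
    ba_states = insert (Inl s) (Inl ` range c \<union> Inr ` range d), ba_initial = {Inl (c 0)},
    ba_trans = range (\<lambda>i. (Inl (c i), z i, Inl (c (Suc i)))) \<union> {(Inl s, t 0, Inr (d 1))} \<union>
      range (\<lambda>i. (Inr (d i), t i, Inr (d (Suc i)))),
    ba_accepting = Inr ` range d\<rparr>"
  have A: "buchi_automaton A"
    using fin by (auto simp: buchi_automaton_def A_def)
  have "buchi_language A = {prefix n z \<frown> t | n. c n = s}"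
  proof (intro equalityI subsetI)
    fix w assume "w \<in> buchi_language A"
    then obtain r where r: "r 0 = Inl (c 0)" "\<And>i. (r i, w i, r (Suc i)) \<in> ba_trans A"
      "\<exists>\<^sub>\<infinity>i. r i \<in> Inr ` range d"
      by (auto simp: buchi_language_def A_def)
    define J where "J = (LEAST n. \<not> isl (r n))"
    have "\<exists>n. \<not> isl (r n)" using INFM_EX[OF r(3)] by (metis imageE sum.disc(2))
    then have J: "\<not> isl (r J)" "\<And>i. i < J \<Longrightarrow> isl (r i)"
      unfolding J_def using LeastI_ex[of "\<lambda>n. \<not> isl (r n)"] not_less_Least by blast+
    then have "J \<noteq> 0" using r(1) by (metis sum.disc(1))
    then obtain n where n: "J = Suc n" by (cases J) auto
    have left: "r i = Inl (c i) \<and> (\<forall>j<i. w j = z j)" if "i \<le> n" for i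
      using that
    proof (induction i)
      case (Suc i)
      then have *: "r i = Inl (c i)" "isl (r (Suc i))" using J n by auto
      then obtain i' where "c i' = c i" "w i = z i'" "r (Suc i) = Inl (c (Suc i'))"
        using r(2)[of i] by (auto simp: A_def)
      then show ?case
        using c[of i' i] Suc by (auto simp: less_Suc_eq)
    qed (simp add: r(1))
    have "c n = s" "w n = t 0" "r (Suc n) = Inr (d 1)"
      using left[of n] r(2)[of n] J(1) n by (auto simp: A_def)
    moreover have right: "r (Suc n + j) = Inr (d (Suc j)) \<and> w (n + j) = t j" for j
    proof (induction j)
      case 0
      then show ?case using calculation by simp
    next
      case (Suc j)
      then obtain i' where "d i' = d (Suc j)" "w (Suc n + j) = t i'" "r (Suc (Suc n + j)) = Inr (d (Suc i'))"
        using r(2)[of "Suc n + j"] by (auto simp: A_def)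
      then show ?case
        using d[of i' "Suc j"] by simp
    qed
    moreover have "w = prefix n z \<frown> t"
    proof
      fix p show "w p = (prefix n z \<frown> t) p"
        using left[of n] right[of "p - n"] by (cases "p < n") auto
    qed
    ultimately show "w \<in> {prefix n z \<frown> t | n. c n = s}" by auto
  next
    fix w assume "w \<in> {prefix n z \<frown> t | n. c n = s}"
    then obtain n where n: "c n = s" "w = prefix n z \<frown> t" by auto
    define r where "r i = (if i \<le> n then Inl (c i) else Inr (d (i - n)))" for i
    have "(r i, w i, r (Suc i)) \<in> ba_trans A" for i
    proof (cases i n rule: linorder_cases)
      case greater
      then have "Suc i - n = Suc (i - n)" by simp
      with greater show ?thesis by (auto simp: r_def n A_def)
    qed (use n in \<open>auto simp: r_def A_def\<close>)
    moreover have "\<exists>\<^sub>\<infinity>i. r i \<in> ba_accepting A"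
      unfolding INFM_nat
    proof
      fix m show "\<exists>i>m. r i \<in> ba_accepting A"
        by (rule exI[of _ "Suc (m + n)"]) (simp add: r_def A_def)
    qed
    moreover have "r 0 \<in> ba_initial A" by (simp add: r_def A_def)
    ultimately show "w \<in> buchi_language A"
      unfolding buchi_language_def by blast
  qed
  then show ?thesis
    using omega_regular_buchi_language[OF A] by simp
qed

lemma omega_regular_splice_periodic:
  fixes z t :: "'a word" and P U :: nat
  assumes "P > 0" and fin: "finite (range z)" "finite (range t)"
    and z: "\<And>i. i \<ge> U \<Longrightarrow> z (i + P) = z i" and t: "\<And>i. i \<ge> Q \<Longrightarrow> t (i + P) = t i"
  shows "omega_regular {prefix (U + a * P) z \<frown> t | a. True}"
proof -
  \<comment> \<open>A canonical representative of a position, used as automaton state: the preperiod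
    is kept, and the rest is reduced modulo \<open>P\<close> into the interval from \<open>V\<close>
    to \<open>V + P\<close>.\<close>
  define rep where "rep V i = (if i < V then i else V + (i - V) mod P)" for V i :: nat
  have fin_rep: "finite (range (rep V))" for V
  proof (rule finite_subset)
    show "range (rep V) \<subseteq> {..<V + P}"
      using \<open>P > 0\<close> by (auto simp: rep_def intro: less_le_trans)
  qed simp
  have eq_rep: "x i = x (rep V i)" if x: "\<And>i. i \<ge> V \<Longrightarrow> x (i + P) = x i" for x :: "'a word" and V i
  proof (cases "i < V")
    case False
    have "x (V + b + k * P) = x (V + b)" for b k
    proof (induction k)
      case (Suc k)
      then show ?case using x[of "V + b + k * P"] by (simp add: algebra_simps)
    qed simp
    from this[of "(i - V) mod P" "(i - V) div P"] show ?thesis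
      using False by (simp add: rep_def)
  qed (simp add: rep_def)
  have rep_Suc: "rep V (Suc i) = rep V (Suc j)" if "rep V i = rep V j" for V i j
  proof (cases "i < V \<or> j < V")
    case True
    then have "i = j" using that by (auto simp: rep_def split: if_splits)
    then show ?thesis by simp
  next
    case False
    then have "(i - V) mod P = (j - V) mod P" using that by (simp add: rep_def)
    then have "Suc (i - V) mod P = Suc (j - V) mod P" by (metis mod_Suc_eq)
    then show ?thesis using False by (simp add: rep_def Suc_diff_le)
  qed
  have "omega_regular {prefix n z \<frown> t | n. rep U n = U}"
  proof (rule omega_regular_splice[where d = "rep Q"])
    show "z i = z j \<and> rep U (Suc i) = rep U (Suc j)" if "rep U i = rep U j" for i j
      using eq_rep[of U z i] eq_rep[of U z j] z rep_Suc that by metis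
    show "t i = t j \<and> rep Q (Suc i) = rep Q (Suc j)" if "rep Q i = rep Q j" for i j
      using eq_rep[of Q t i] eq_rep[of Q t j] t rep_Suc that by metis
  qed (use fin fin_rep in auto)
  moreover
  have "rep U n = U \<longleftrightarrow> (\<exists>a. n = U + a * P)" for n
  proof
    assume n: "rep U n = U"
    then have "U \<le> n" "(n - U) mod P = 0" by (auto simp: rep_def split: if_splits)
    then show "\<exists>a. n = U + a * P"
      by (metis add_diff_cancel_left' dvd_def le_add_diff_inverse mod_0_imp_dvd mult.commute)
  qed (auto simp: rep_def)
  then have "{prefix n z \<frown> t | n. rep U n = U} = {prefix (U + a * P) z \<frown> t | a. True}"
    by (auto; metis)
  ultimately show ?thesis by simp
qed

section \<open>Infinite combinatorics\<close>

lemma ex_homogeneous_sequence: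
  fixes col :: "nat \<Rightarrow> nat \<Rightarrow> 'c"
  assumes "finite C" and col: "\<And>i j. i < j \<Longrightarrow> col i j \<in> C"
  obtains s :: "nat \<Rightarrow> nat" and c where "strict_mono s" "\<And>i j. i < j \<Longrightarrow> col (s i) (s j) = c"
proof -
  obtain f :: "'c \<Rightarrow> nat" and n where f: "f ` C = {i. i < n}" "inj_on f C"
    using finite_imp_inj_to_nat_seg[OF assms(1)] by blast
  \<comment> \<open>Ramsey's theorem colours unordered pairs; minimum and maximum restore the order
    of the arguments of \<open>col\<close>.\<close>
  define g where "g X = f (col (Min X) (Max X))" for X
  have g: "g {x, y} = f (col x y)" if "x < y" for x y :: nat
    using that by (simp add: g_def)
  have lt: "f c < n" if "c \<in> C" for c using f(1) that by blast
  have "g {x, y} < n" if "x \<noteq> y" for x y :: nat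
    using that g[of x y] g[of y x] lt col by (cases "x < y") (auto simp: insert_commute)
  then obtain Y :: "nat set" and t where Y: "infinite Y" "\<And>x y. x \<in> Y \<Longrightarrow> y \<in> Y \<Longrightarrow> x \<noteq> y \<Longrightarrow> g {x, y} = t"
    using Ramsey2[of UNIV g n] by auto
  have mono: "strict_mono (enumerate Y)" and mem: "enumerate Y i \<in> Y" for i
    using strict_mono_enumerate[OF Y(1)] enumerate_in_set[OF Y(1)] by auto
  show thesis
  proof (rule that[of "enumerate Y" "col (enumerate Y 0) (enumerate Y 1)"])
    fix i j :: nat assume "i < j"
    then have "enumerate Y i < enumerate Y j" using mono by (simp add: strict_monoD)
    moreover have "enumerate Y 0 < enumerate Y 1" using mono by (simp add: strict_monoD)
    ultimately have "f (col (enumerate Y i) (enumerate Y j)) = f (col (enumerate Y 0) (enumerate Y 1))"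
      using Y(2)[OF mem[of i] mem[of j]] Y(2)[OF mem[of 0] mem[of 1]]
        g[of "enumerate Y i" "enumerate Y j"] g[of "enumerate Y 0" "enumerate Y 1"] by simp
    then show "col (enumerate Y i) (enumerate Y j) = col (enumerate Y 0) (enumerate Y 1)"
      using f(2) col \<open>enumerate Y i < _\<close> \<open>enumerate Y 0 < _\<close> by (meson inj_onD)
  qed (fact mono)
qed

text \<open>Koenig's lemma: over a finite alphabet, a prefix shared by infinitely many words of
  \<open>Y\<close> has a one-letter extension that is again shared by infinitely many.\<close>

lemma ex_limit_word:
  assumes "finite \<Sigma>" "infinite Y" "\<And>y. y \<in> Y \<Longrightarrow> range y \<subseteq> \<Sigma>"
  obtains z where "\<And>n. infinite {y \<in> Y. prefix n y = prefix n z}"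
proof -
  define P where "P n s \<longleftrightarrow> length s = n \<and> infinite {y \<in> Y. prefix n y = s}" for n s
  have "P 0 []" using assms(2) by (simp add: P_def)
  moreover have "\<exists>s'. P (Suc n) s' \<and> (\<exists>a. s' = s @ [a])" if "P n s" for n s
  proof -
    have "{y \<in> Y. prefix n y = s} \<subseteq> (\<Union>a\<in>\<Sigma>. {y \<in> Y. prefix (Suc n) y = s @ [a]})"
      using assms(3) by (auto simp: image_subset_iff)
    then have "\<not> (\<forall>a\<in>\<Sigma>. finite {y \<in> Y. prefix (Suc n) y = s @ [a]})"
      using that finite_subset[of "{y \<in> Y. prefix n y = s}"] assms(1) unfolding P_def by blast
    then obtain a where "infinite {y \<in> Y. prefix (Suc n) y = s @ [a]}" by blast
    then show ?thesis
      using that unfolding P_def by (intro exI[of _ "s @ [a]"]) (simp del: subseq_to_Suc)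
  qed
  ultimately obtain f where f: "\<And>n. P n (f n)" "\<And>n. \<exists>a. f (Suc n) = f n @ [a]"
    using dependent_nat_choice[of P "\<lambda>_ s s'. \<exists>a. s' = s @ [a]"] by metis
  define z where "z n = last (f (Suc n))" for n
  have "prefix n z = f n" for n
  proof (induction n)
    case 0
    then show ?case using f(1)[of 0] by (simp add: P_def)
  next
    case (Suc n)
    then show ?case using f(2)[of n] by (auto simp: z_def)
  qed
  with f(1) show thesis using that[of z] by (simp add: P_def)
qed

section \<open>Equivalence relations with countably many classes\<close>

definition end_equal :: "'a word \<Rightarrow> 'a word \<Rightarrow> bool" where
  "end_equal x y \<longleftrightarrow> (\<exists>n. \<forall>p\<ge>n. x p = y p)"

lemma end_equal_refl: "end_equal x x"
  by (simp add: end_equal_def)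

lemma end_equal_sym: "end_equal x y \<Longrightarrow> end_equal y x"
  by (simp add: end_equal_def) metis

lemma end_equal_trans:
  assumes "end_equal x y" "end_equal y z" shows "end_equal x z"
proof -
  obtain n m where "\<forall>p\<ge>n. x p = y p" "\<forall>p\<ge>m. y p = z p"
    using assms by (auto simp: end_equal_def)
  then show ?thesis
    unfolding end_equal_def by (intro exI[of _ "max n m"]) simp
qed

section \<open>Kernels recognized by automata on pairs\<close>

definition pair :: "'a word \<Rightarrow> 'a word \<Rightarrow> 'a list word" where
  "pair x y = (\<lambda>p. [x p, y p])"

lemma subsequence_pair_cong:
  assumes "\<And>p. i \<le> p \<Longrightarrow> p < j \<Longrightarrow> x p = x' p \<and> y p = y' p"
  shows "subsequence (pair x y) i j = subsequence (pair x' y') i j"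
  using assms by (intro subsequence_cong) (simp add: pair_def)

lemma convolution_inj:
  assumes "convolution xs = convolution ys" "length xs = length ys"
  shows "xs = ys"
proof (rule nth_equalityI)
  fix i assume i: "i < length xs"
  show "xs ! i = ys ! i"
  proof
    fix p
    have "map (\<lambda>x. x p) xs ! i = map (\<lambda>x. x p) ys ! i"
      using fun_cong[OF assms(1), of p] by (simp add: convolution_def)
    then show "(xs ! i) p = (ys ! i) p" using i assms(2) by simp
  qed
qed (fact assms(2))

lemma omega_automatic_buchi:
  assumes "omega_automatic n R"
  obtains A :: "(nat, 'a list) buchi" where "buchi_automaton A"
    "\<And>xs. length xs = n \<Longrightarrow> convolution xs \<in> buchi_language A \<longleftrightarrow> xs \<in> R"
proof -
  obtain A :: "(nat, 'a list) buchi" where A: "buchi_automaton A" "convolution ` R = buchi_language A"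
    using assms by (auto simp: omega_automatic_def omega_regular_def)
  moreover have "convolution xs \<in> buchi_language A \<longleftrightarrow> xs \<in> R" if xs: "length xs = n" for xs
  proof
    assume "convolution xs \<in> buchi_language A"
    then obtain ys where "ys \<in> R" "convolution xs = convolution ys"
      unfolding A(2)[symmetric] by blast
    moreover from this have "length ys = n" using assms by (simp add: omega_automatic_def)
    ultimately show "xs \<in> R" using xs convolution_inj[of xs ys] by simp
  qed (use A(2) in blast)
  ultimately show thesis using that by blast
qed

text \<open>One automaton decides equivalence and, on the diagonal, membership in \<open>L\<close>;
  exchange arguments thus have to preserve only profiles of pairs.\<close>

locale automatic_kernel =
  fixes L :: "'a word set" and h :: "'a word \<Rightarrow> 'v" and A :: "(nat, 'a list) buchi"
  assumes A: "buchi_automaton A"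
    and kernel: "pair x y \<in> buchi_language A \<longleftrightarrow> x \<in> L \<and> y \<in> L \<and> h x = h y"
begin

lemma in_L_iff: "x \<in> L \<longleftrightarrow> pair x x \<in> buchi_language A"
  by (simp add: kernel)

end

section \<open>Exchanging blocks between two words\<close>

definition choose_blocks :: "(nat \<Rightarrow> nat) \<Rightarrow> 'a word \<Rightarrow> 'a word \<Rightarrow> nat set \<Rightarrow> 'a word" where
  "choose_blocks n x y S p = (if \<exists>a\<in>S. n a \<le> p \<and> p < n (Suc a) then y p else x p)"

lemma choose_blocks_block:
  assumes "strict_mono n" "n a \<le> p" "p < n (Suc a)"
  shows "choose_blocks n x y S p = (if a \<in> S then y p else x p)"
  using assms strict_mono_interval_unique[OF assms(1)] by (auto simp: choose_blocks_def)

lemma choose_blocks_before: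
  assumes "strict_mono n" "p < n 0"
  shows "choose_blocks n x y S p = x p"
proof -
  have "n 0 \<le> n a" for a using assms(1) by (simp add: strict_mono_less_eq)
  then have "\<not> n a \<le> p" for a using assms(2) by (meson le_trans not_le)
  then show ?thesis by (simp add: choose_blocks_def)
qed

text \<open>Since \<open>(x, x)\<close> and \<open>(y, y)\<close> share the profile
  \<open>e\<close>, a block on which two composed words agree looks the same whichever word it comes
  from. The profile of \<open>(y, x)\<close> is left open, so \<open>X S\<close> and
  \<open>X T\<close> are compared only for \<open>S \<subseteq> T\<close>.\<close>

locale homogeneous_pair = automatic_kernel L h A
  for L :: "'a word set" and h :: "'a word \<Rightarrow> 'v" and A +
  fixes n :: "nat \<Rightarrow> nat" and x y :: "'a word" and e :: "(nat \<times> bool \<times> nat) set"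
    and d :: "(nat \<times> bool \<times> nat) set"
  assumes n: "strict_mono n" "0 < n 0"
    and xx: "\<And>a b. a < b \<Longrightarrow> profile A (subsequence (pair x x) (n a) (n b)) = e"
    and yy: "\<And>a b. a < b \<Longrightarrow> profile A (subsequence (pair y y) (n a) (n b)) = e"
    and xy: "\<And>a b. a < b \<Longrightarrow> profile A (subsequence (pair x y) (n a) (n b)) = d"
    and x_in_L: "x \<in> L"
begin

abbreviation X :: "nat set \<Rightarrow> 'a word" where "X \<equiv> choose_blocks n x y"

lemma X_block:
  assumes "S \<subseteq> T"
  shows "profile A (subsequence (pair (X S) (X T)) (n a) (n (Suc a))) =
    (if a \<in> T - S then d else e)"
proof -
  have "subsequence (pair (X S) (X T)) (n a) (n (Suc a)) =
    subsequence (pair (if a \<in> S then y else x) (if a \<in> T then y else x)) (n a) (n (Suc a))"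
    by (intro subsequence_pair_cong) (simp add: choose_blocks_block[OF n(1)])
  then show ?thesis
    using assms xx[of a "Suc a"] yy[of a "Suc a"] xy[of a "Suc a"] by auto
qed

lemma e_idem: "e \<bullet> e = e"
proof -
  have less: "n 0 < n 1" "n 1 < n 2" using n(1) by (simp_all add: strict_monoD)
  have "e = profile A (subsequence (pair x x) (n 0) (n 1) @ subsequence (pair x x) (n 1) (n 2))"
    using xx[of 0 2] less by (subst subsequence_split[symmetric]) simp_all
  then show ?thesis
    using xx[of 0 1] xx[of 1 2] by (simp add: profile_append[OF A])
qed

lemma X_blocks_e:
  assumes "S \<subseteq> T" "a < b" "\<And>c. a \<le> c \<Longrightarrow> c < b \<Longrightarrow> c \<notin> T - S"
  shows "profile A (subsequence (pair (X S) (X T)) (n a) (n b)) = e"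
  using assms(2,3)
proof (induction b)
  case (Suc b)
  show ?case
  proof (cases "a = b")
    case True
    then show ?thesis using X_block[OF assms(1), of a] Suc.prems(2)[of a] by auto
  next
    case False
    then have "a < b" using Suc.prems(1) by simp
    then have "n a \<le> n b" "n b \<le> n (Suc b)" using n(1) by (simp_all add: strict_mono_less_eq)
    then have "profile A (subsequence (pair (X S) (X T)) (n a) (n (Suc b))) =
      profile A (subsequence (pair (X S) (X T)) (n a) (n b)) \<bullet>
      profile A (subsequence (pair (X S) (X T)) (n b) (n (Suc b)))"
      by (metis subsequence_split profile_append[OF A])
    also have "\<dots> = e"
      using Suc Suc.prems(2)[of b] \<open>a < b\<close> X_block[OF assms(1), of b] e_idem by auto
    finally show ?thesis .
  qed
qed simp

lemma X_in_L: "X S \<in> L"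
proof -
  define f where "f i = (case i of 0 \<Rightarrow> 0 | Suc i \<Rightarrow> n i)" for i
  have f: "strict_mono f" "f 0 = 0"
    using n by (auto simp: f_def strict_mono_Suc_iff split: nat.splits)
  have "profile A (subsequence (pair (X S) (X S)) (f i) (f (Suc i))) =
      profile A (subsequence (pair x x) (f i) (f (Suc i)))" for i
  proof (cases i)
    case 0
    then show ?thesis
      by (simp add: f_def subsequence_pair_cong[of 0 "n 0" "X S" x "X S" x] choose_blocks_before[OF n(1)])
  next
    case (Suc a)
    then show ?thesis using X_block[of S S a] xx[of a "Suc a"] by (simp add: f_def)
  qed
  then have "pair (X S) (X S) \<in> buchi_language A \<longleftrightarrow> pair x x \<in> buchi_language A"
    by (rule buchi_language_profile_iff[OF A f f])
  then show ?thesis using x_in_L by (simp add: in_L_iff)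
qed

definition sparse :: "nat set \<Rightarrow> bool" where
  "sparse D \<longleftrightarrow> infinite D \<and> 0 \<notin> D \<and> (\<forall>a\<in>D. Suc a \<notin> D)"

text \<open>
  Cutting after each difference makes all blocks have profile \<open>e \<bullet> d\<close>: by sparseness, each
  difference is preceded by a nonempty run of agreements, which contributes \<open>e\<close>.
\<close>

lemma sparse_blocks:
  assumes "S \<subseteq> T" "sparse (T - S)"
  obtains f where "strict_mono f" "f 0 = 0" "f 1 = n 0"
    "\<And>i. profile A (subsequence (pair (X S) (X T)) (f (Suc i)) (f (Suc (Suc i)))) = e \<bullet> d"
proof -
  define D where "D = T - S"
  have inf: "infinite D" using assms(2) by (simp add: sparse_def D_def)
  define s where "s = enumerate D"
  have s: "strict_mono s" "\<And>i. s i \<in> D"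
    using strict_mono_enumerate[OF inf] enumerate_in_set[OF inf] by (auto simp: s_def)
  define m where "m i = (case i of 0 \<Rightarrow> 0 | Suc i \<Rightarrow> Suc (s i))" for i
  have m_less: "m i < s i" for i
  proof (cases i)
    case 0
    then show ?thesis using s(2)[of 0] assms(2) by (auto simp: m_def sparse_def D_def intro: gr0I)
  next
    case (Suc j)
    then have "s j < s i" using s(1) by (simp add: strict_monoD)
    moreover have "Suc (s j) \<noteq> s i"
      using s(2)[of i] s(2)[of j] assms(2) unfolding sparse_def D_def by metis
    ultimately have "Suc (s j) < s i" by simp
    then show ?thesis using Suc by (simp add: m_def)
  qed
  have gap: "c \<notin> D" if "m i \<le> c" "c < s i" for i c
  proof
    assume "c \<in> D"
    then obtain j where j: "c = s j" unfolding s_def by (metis enumerate_Ex inf)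
    then have "j < i" using that(2) s(1) by (simp add: strict_mono_less)
    then obtain i' where "i = Suc i'" "j \<le> i'" by (cases i) auto
    then show False using that(1) j s(1) by (simp add: m_def strict_mono_less_eq Suc_le_eq)
      (meson leD strict_mono_less_eq)
  qed
  define f where "f i = (case i of 0 \<Rightarrow> 0 | Suc i \<Rightarrow> n (m i))" for i
  have "profile A (subsequence (pair (X S) (X T)) (n (m i)) (n (Suc (s i)))) = e \<bullet> d" for i
  proof -
    have "n (m i) \<le> n (s i)" "n (s i) \<le> n (Suc (s i))"
      using m_less[of i] n(1) by (simp_all add: strict_mono_less_eq)
    then have "profile A (subsequence (pair (X S) (X T)) (n (m i)) (n (Suc (s i)))) =
      profile A (subsequence (pair (X S) (X T)) (n (m i)) (n (s i))) \<bullet>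
      profile A (subsequence (pair (X S) (X T)) (n (s i)) (n (Suc (s i))))"
      by (metis subsequence_split profile_append[OF A])
    also have "\<dots> = e \<bullet> d"
      using X_blocks_e[OF assms(1) m_less] gap X_block[OF assms(1), of "s i"] s(2)
      by (simp add: D_def)
    finally show ?thesis .
  qed
  moreover have "strict_mono f"
    unfolding strict_mono_Suc_iff
  proof
    fix i
    have "m i < m (Suc i)" for i using m_less[of i] by (simp add: m_def)
    then show "f i < f (Suc i)"
      using n by (cases i) (auto simp: f_def strict_mono_less m_def)
  qed
  ultimately show thesis
    by (intro that[of f]) (simp_all add: f_def m_def)
qed

text \<open>Both pairs begin with the same word up to \<open>n 0\<close> and continue with
  infinitely many blocks of profile \<open>e \<bullet> d\<close>. A single coincidence therefore
  spreads to all sparse differences.\<close>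

lemma sparse_kernel_iff:
  assumes "S \<subseteq> T" "sparse (T - S)" "S' \<subseteq> T'" "sparse (T' - S')"
  shows "h (X S) = h (X T) \<longleftrightarrow> h (X S') = h (X T')"
proof -
  obtain f where f: "strict_mono f" "f 0 = 0" "f 1 = n 0"
    "\<And>i. profile A (subsequence (pair (X S) (X T)) (f (Suc i)) (f (Suc (Suc i)))) = e \<bullet> d"
    using sparse_blocks[OF assms(1,2)] by blast
  obtain f' where f': "strict_mono f'" "f' 0 = 0" "f' 1 = n 0"
    "\<And>i. profile A (subsequence (pair (X S') (X T')) (f' (Suc i)) (f' (Suc (Suc i)))) = e \<bullet> d"
    using sparse_blocks[OF assms(3,4)] by blast
  have 0: "subsequence (pair (X S) (X T)) 0 (n 0) = subsequence (pair (X S') (X T')) 0 (n 0)"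
    by (intro subsequence_pair_cong) (simp add: choose_blocks_before[OF n(1)])
  have "profile A (subsequence (pair (X S) (X T)) (f i) (f (Suc i))) =
      profile A (subsequence (pair (X S') (X T')) (f' i) (f' (Suc i)))" for i
    using f(2-4) f'(2-4) 0 by (cases i) simp_all
  from buchi_language_profile_iff[OF A f(1,2) f'(1,2) this] show ?thesis
    by (simp add: kernel X_in_L)
qed

lemma X_tail: "end_equal (X {a..}) y"
  unfolding end_equal_def
proof (intro exI allI impI)
  fix p assume "n a \<le> p"
  then obtain b where b: "n b \<le> p" "p < n (Suc b)"
    using strict_mono_interval[OF n(1), of p] n(1)
    by (metis le0 le_trans strict_mono_less_eq)
  then have "a \<le> b"
    using \<open>n a \<le> p\<close> n(1) by (metis le_less_trans less_Suc_eq_le strict_mono_less)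
  then show "X {a..} p = y p"
    using choose_blocks_block[OF n(1) b, of x y "{a..}"] by simp
qed

text \<open>With countably many classes, two members of the chain collide. By
  \<open>sparse_kernel_iff\<close>, every sparse enlargement then preserves the class, and two such
  enlargements lead from \<open>x\<close> to a word that ends like \<open>y\<close>.\<close>

lemma uncountable_if_separated:
  assumes sep: "\<And>y'. y' \<in> L \<Longrightarrow> end_equal y' y \<Longrightarrow> h y' \<noteq> h x"
  shows "\<not> countable (h ` L)"
proof
  assume "countable (h ` L)"
  \<comment> \<open>An enumeration of the rationals: the sets \<open>{a. q a < r}\<close> are
    Dedekind cuts, and cuts at different reals differ in infinitely many indices.\<close>
  define q :: "nat \<Rightarrow> real" where "q a = real_of_rat (nat_to_rat_surj a)" for a
  \<comment> \<open>Only odd indices are used, so that a difference contains neither 0 nor two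
    neighbours.\<close>
  define T where "T r = (\<lambda>a. Suc (2 * a)) ` {a. q a < r}" for r
  have "\<not> inj (\<lambda>r. h (X (T r)))"
  proof
    assume "inj (\<lambda>r. h (X (T r)))"
    moreover have "countable (range (\<lambda>r. h (X (T r))))"
      by (rule countable_subset[OF _ \<open>countable (h ` L)\<close>]) (auto simp: X_in_L)
    ultimately show False
      using uncountable_UNIV_real countable_image_inj_on by blast
  qed
  then obtain r r' where r: "r < r'" "h (X (T r)) = h (X (T r'))"
    unfolding inj_on_def by (metis linorder_neqE)
  have "infinite {a. r \<le> q a \<and> q a < r'}"
  proof
    assume "finite {a. r \<le> q a \<and> q a < r'}"
    then have fin: "finite (insert r (q ` {a. r \<le> q a \<and> q a < r'}))" by simp
    define v where "v = Max (insert r (q ` {a. r \<le> q a \<and> q a < r'}))"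
    have "v < r'" using fin r(1) by (auto simp: v_def)
    then obtain u where u: "v < real_of_rat u" "real_of_rat u < r'"
      using of_rat_dense by blast
    obtain a where "u = nat_to_rat_surj a" using surj_nat_to_rat_surj by (metis surjD)
    then have a: "v < q a" "q a < r'" using u by (simp_all add: q_def)
    moreover have "r \<le> v" unfolding v_def using fin by (intro Max_ge) auto
    ultimately have "q a \<le> v" unfolding v_def using fin by (intro Max_ge) auto
    then show False using a by simp
  qed
  then have "infinite ((\<lambda>a. Suc (2 * a)) ` {a. r \<le> q a \<and> q a < r'})"
    by (subst finite_image_iff) (auto simp: inj_on_def)
  moreover have "T r' - T r = (\<lambda>a. Suc (2 * a)) ` {a. r \<le> q a \<and> q a < r'}"
    by (auto simp: T_def image_iff not_less)
  ultimately have "sparse (T r' - T r)"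
    by (simp add: sparse_def) (auto, presburger)
  moreover have "T r \<subseteq> T r'" using r(1) by (auto simp: T_def)
  ultimately have same: "h (X S) = h (X S')" if "S \<subseteq> S'" "sparse (S' - S)" for S S'
    using sparse_kernel_iff[of "T r" "T r'" S S'] that r(2) by blast
  \<comment> \<open>The difference of \<open>{}\<close> and \<open>{1..}\<close> is not sparse.
    Inserting the odd numbers in between gives two sparse steps: the odd numbers, and the even
    numbers from 2 on.\<close>
  let ?odd = "range (\<lambda>a. Suc (2 * a))"
  have inf: "infinite (range (\<lambda>a. k + 2 * a))" for k :: nat
    by (rule range_inj_infinite) (simp add: inj_on_def)
  have "h (X {}) = h (X ?odd)"
    using inf[of 1] by (intro same) (auto simp: sparse_def, presburger)
  also have "\<dots> = h (X {1..})"
  proof (rule same)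
    have "{1..} - ?odd = range (\<lambda>a. 2 + 2 * a)"
    proof (intro equalityI subsetI)
      fix b assume "b \<in> {1..} - ?odd"
      then have "1 \<le> b" "b \<notin> ?odd" by auto
      moreover have "b = Suc (2 * (b div 2))" if "odd b" using that by presburger
      ultimately have "b = 2 + 2 * (b div 2 - 1)" by (cases "even b") (presburger, blast)
      then show "b \<in> range (\<lambda>a. 2 + 2 * a)" by (rule range_eqI)
    qed (auto, presburger)
    then show "sparse ({1..} - ?odd)"
      using inf[of 2] by (auto simp: sparse_def)
  qed auto
  also have "X {} = x" by (simp add: choose_blocks_def fun_eq_iff)
  finally show False
    using sep[OF X_in_L X_tail, of 1] by simp
qed

text \<open>The words \<open>X {a..}\<close> follow \<open>x\<close> up to \<open>n a\<close> and
  \<open>y\<close> afterwards. If infinitely many indices gave the same word, \<open>x\<close> and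
  \<open>y\<close> would agree from some block on.\<close>

lemma infinite_end_class_if_inj:
  assumes "inj_on h L" "\<not> end_equal x y"
  shows "infinite (h ` {y' \<in> L. end_equal y' y})"
proof -
  have "infinite (range (\<lambda>a. X {a..}))"
  proof
    assume "finite (range (\<lambda>a. X {a..}))"
    then obtain a where a: "infinite {b. X {b..} = X {a..}}"
      using pigeonhole_infinite[of UNIV "\<lambda>a. X {a..}"] by auto
    have "x p = y p" if p: "n a \<le> p" for p
    proof -
      obtain c where c: "n c \<le> p" "p < n (Suc c)"
        using strict_mono_interval[OF n(1), of p] n(1) p
        by (metis le0 le_trans strict_mono_less_eq)
      then have "a \<le> c"
        using p n(1) by (metis le_less_trans less_Suc_eq_le strict_mono_less)
      obtain b where b: "b > c" "X {b..} = X {a..}"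
        using a unfolding infinite_nat_iff_unbounded by blast
      then show ?thesis
        using choose_blocks_block[OF n(1) c, of x y "{a..}"]
          choose_blocks_block[OF n(1) c, of x y "{b..}"] \<open>a \<le> c\<close> by simp
    qed
    then show False using assms(2) by (auto simp: end_equal_def)
  qed
  moreover have "range (\<lambda>a. X {a..}) \<subseteq> {y' \<in> L. end_equal y' y}"
    using X_in_L X_tail by auto
  ultimately have "infinite {y' \<in> L. end_equal y' y}"
    using finite_subset by blast
  moreover have "inj_on h {y' \<in> L. end_equal y' y}"
    using assms(1) by (auto simp: inj_on_def)
  ultimately show ?thesis using finite_imageD by blast
qed

end

text \<open>If finitely many end classes meet all \<open>h\<close>-classes, pigeonhole suffices;
  otherwise words can be chosen greedily. A \<open>homogeneous_pair\<close> among the chosen words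
  excludes countability, and injectivity then yields an infinite end class.\<close>

lemma (in automatic_kernel) ex_infinite_end_class:
  assumes "infinite (h ` L)" and "countable (h ` L) \<or> inj_on h L"
  obtains x where "infinite (h ` {y \<in> L. end_equal y x})"
proof (cases "\<exists>F. finite F \<and> h ` L \<subseteq> (\<Union>x\<in>F. h ` {y \<in> L. end_equal y x})")
  case True
  then obtain F where F: "finite F" "h ` L \<subseteq> (\<Union>x\<in>F. h ` {y \<in> L. end_equal y x})" by blast
  have "infinite (\<Union>x\<in>F. h ` {y \<in> L. end_equal y x})"
    using assms(1) F(2) finite_subset by blast
  then obtain x where "infinite (h ` {y \<in> L. end_equal y x})"
    using F(1) by blast
  then show thesis by (rule that)
next
  case False
  have "\<exists>xs. \<forall>i::nat. xs i \<in> L \<and> (\<forall>j<i. h (xs i) \<notin> h ` {y \<in> L. end_equal y (xs j)})"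
  proof (rule dependent_wf_choice[OF wf_less,
        where P = "\<lambda>xs (i::nat) x. x \<in> L \<and> (\<forall>j<i. h x \<notin> h ` {y \<in> L. end_equal y (xs j)})"])
    fix i :: nat and xs
    have "\<not> h ` L \<subseteq> (\<Union>x\<in>xs ` {..<i}. h ` {y \<in> L. end_equal y x})"
      using False by blast
    then show "\<exists>x. x \<in> L \<and> (\<forall>j<i. h x \<notin> h ` {y \<in> L. end_equal y (xs j)})"
      by blast
  qed simp
  then obtain xs where xs: "\<And>i::nat. xs i \<in> L"
    "\<And>i j. j < i \<Longrightarrow> h (xs i) \<notin> h ` {y \<in> L. end_equal y (xs j)}"
    by blast
  \<comment> \<open>Among \<open>K + 1\<close> words two have the same diagonal profile, as
    \<open>homogeneous_pair\<close> requires of \<open>x\<close> and \<open>y\<close>. All pairs of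
    these words are coloured at once, so that the two can be selected after the cuts.\<close>
  define K where "K = card (profiles A)"
  define js where "js = List.product [0..<Suc K] [0..<Suc K]"
  \<comment> \<open>The shift by \<open>Suc\<close> makes the first cut positive.\<close>
  define col where "col a b = map (\<lambda>(i, j). profile A (subsequence (pair (xs i) (xs j)) (Suc a) (Suc b))) js"
    for a b
  have fin: "finite {c. set c \<subseteq> profiles A \<and> length c = length js}"
    by (rule finite_lists_length_eq[OF finite_profiles[OF A]])
  have col_in: "col a b \<in> {c. set c \<subseteq> profiles A \<and> length c = length js}" for a b
    by (auto simp: col_def profile_in_profiles[OF A])
  obtain s :: "nat \<Rightarrow> nat" and c where s: "strict_mono s" "\<And>a b. a < b \<Longrightarrow> col (s a) (s b) = c"
    using ex_homogeneous_sequence[OF fin, of col, OF col_in] by blast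
  define n where "n a = Suc (s a)" for a
  have n: "strict_mono n" "0 < n 0"
    using s(1) by (simp_all add: n_def strict_mono_def)
  define e where "e i j = profile A (subsequence (pair (xs i) (xs j)) (n 0) (n 1))" for i j
  have e: "profile A (subsequence (pair (xs i) (xs j)) (n a) (n b)) = e i j"
    if "a < b" "i \<le> K" "j \<le> K" for a b i j
  proof -
    have "col (s a) (s b) = col (s 0) (s 1)" using s(2) that(1) by simp
    moreover have "(i, j) \<in> set js" using that by (auto simp: js_def)
    ultimately show ?thesis by (auto simp: col_def e_def n_def)
  qed
  have "\<not> inj_on (\<lambda>i. e i i) {..K}"
  proof
    assume "inj_on (\<lambda>i. e i i) {..K}"
    then have "card {..K} \<le> card (profiles A)"
      by (rule card_inj_on_le) (auto simp: e_def profile_in_profiles[OF A] finite_profiles[OF A])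
    then show False by (simp add: K_def)
  qed
  then obtain i j where ij: "j < i" "i \<le> K" "e i i = e j j"
    unfolding inj_on_def by (metis atMost_iff linorder_neqE_nat)
  interpret homogeneous_pair L h A n "xs i" "xs j" "e i i" "e i j"
    using n e ij xs(1) by unfold_locales auto
  have sep: "h y \<noteq> h (xs i)" if "y \<in> L" "end_equal y (xs j)" for y
    using xs(2)[OF ij(1)] that by (metis (mono_tags, lifting) imageI mem_Collect_eq)
  have "inj_on h L"
    using assms(2) uncountable_if_separated sep by blast
  moreover have "\<not> end_equal (xs i) (xs j)"
    using sep[OF xs(1)] by blast
  ultimately show thesis
    by (intro that[of "xs j"] infinite_end_class_if_inj)
qed

section \<open>Pumping\<close>

text \<open>If \<open>z\<close> is \<open>u v\<^sup>\<omega>\<close> with \<open>u\<close> of length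
  \<open>U\<close> and \<open>v\<close> of length \<open>M\<close>, this is
  \<open>u v\<^sup>m t\<close>.\<close>

definition pumped :: "nat \<Rightarrow> nat \<Rightarrow> 'a word \<Rightarrow> 'a word \<Rightarrow> nat \<Rightarrow> 'a word" where
  "pumped U M z t m = prefix (U + m * M) z \<frown> t"

lemma periodic_add_mult:
  fixes x :: "'a word"
  assumes "\<And>i. i \<ge> V \<Longrightarrow> x (i + P) = x i" "i \<ge> V"
  shows "x (i + k * P) = x i"
proof (induction k)
  case (Suc k)
  then show ?case using assms(1)[of "i + k * P"] assms(2) by (simp add: algebra_simps)
qed simp

text \<open>\<open>t\<close> is one exceptional block of length \<open>M\<close> followed by a tail
  with the same period \<open>M\<close>. Hence each block of \<open>W m\<close> behind
  \<open>U\<close> is a period of \<open>z\<close>, the exceptional block or a period of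
  \<open>t\<close>, and the blocks of several such words are aligned.\<close>

locale pumping =
  fixes U M :: nat and z t :: "'a word"
  assumes M: "0 < M" and z: "\<And>i. i \<ge> U \<Longrightarrow> z (i + M) = z i" and t: "\<And>i. i \<ge> M \<Longrightarrow> t (i + M) = t i"
begin

abbreviation W :: "nat \<Rightarrow> 'a word" where "W \<equiv> pumped U M z t"

lemma W_initial: "p < U \<Longrightarrow> W m p = z p"
  by (simp add: pumped_def)

lemma W_tail:
  assumes "m < b"
  shows "W m (U + b * M + p) = t (M + p)"
proof -
  obtain c where c: "b = Suc (m + c)" using assms less_iff_Suc_add by blast
  then have "U + b * M + p = (U + m * M) + (M + p + c * M)" by (simp add: algebra_simps)
  then have "W m (U + b * M + p) = t (M + p + c * M)"
    by (simp only: pumped_def) simp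
  then show ?thesis
    using periodic_add_mult[of M t M "M + p" c, OF t] by simp
qed

lemma W_block:
  assumes "p < M"
  shows "W m (U + b * M + p) = (if b < m then z (U + p) else if b = m then t p else t (M + p))"
proof -
  consider "b < m" | "b = m" | "m < b" by linarith
  then show ?thesis
  proof cases
    case 1
    then have "Suc b * M \<le> m * M" by (intro mult_le_mono1) simp
    then have "U + b * M + p < U + m * M" using assms by simp
    then show ?thesis
      using 1 periodic_add_mult[of U z M "U + p" b, OF z] by (simp add: pumped_def ac_simps)
  next
    case 2
    then show ?thesis by (simp add: pumped_def)
  next
    case 3
    then show ?thesis using W_tail[OF 3, of p] by simp
  qed
qed

lemma subsequence_concat_replicate:
  assumes "length S = M" "\<And>c p. b \<le> c \<Longrightarrow> c < b + r \<Longrightarrow> p < M \<Longrightarrow> w (U + c * M + p) = S ! p"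
  shows "subsequence w (U + b * M) (U + (b + r) * M) = concat (replicate r S)"
  using assms(2)
proof (induction r)
  case (Suc r)
  have "subsequence w (U + b * M) (U + (b + Suc r) * M) =
      subsequence w (U + b * M) (U + (b + r) * M) @
      subsequence w (U + (b + r) * M) (U + (b + Suc r) * M)"
    by (rule subsequence_split) (simp_all add: algebra_simps)
  also have "subsequence w (U + (b + r) * M) (U + (b + Suc r) * M) = S"
    using Suc.prems[of "b + r"] assms(1) by (intro nth_equalityI) (simp_all add: algebra_simps)
  also have "subsequence w (U + b * M) (U + (b + r) * M) = concat (replicate r S)"
    using Suc by simp
  also have "concat (replicate r S) @ S = concat (replicate (Suc r) S)"
    by (metis append_Nil2 concat.simps(1,2) concat_append replicate_Suc replicate_append_same)
  finally show ?case .
qed simp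

definition admissible :: "nat \<Rightarrow> nat list \<Rightarrow> bool" where
  "admissible N ms \<longleftrightarrow> sorted_wrt (<) ms \<and> (\<forall>m\<in>set ms. 0 < m \<and> N dvd m)"

text \<open>For increasing exponents, the convolution of the \<open>W m\<close> consists of runs of
  identical blocks, separated by single blocks in which the next component passes from
  \<open>z\<close> into \<open>t\<close>. Only the lengths of the runs depend on the exponents, and
  powers of one block with congruent, large enough exponents have the same profile.\<close>

lemma ex_tuple_period:
  fixes A :: "('q, 'a list) buchi"
  assumes A: "buchi_automaton A"
  obtains N where "1 \<le> N"
    "\<And>ms ms'. admissible N ms \<Longrightarrow> admissible N ms' \<Longrightarrow> length ms = length ms' \<Longrightarrow>
      convolution (map W ms) \<in> buchi_language A \<longleftrightarrow> convolution (map W ms') \<in> buchi_language A"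
proof -
  obtain N where N: "N \<ge> 1" "\<And>s m a. N \<le> m \<Longrightarrow>
      profile A (concat (replicate (m + a * N) s)) = profile A (concat (replicate m s))"
    using ex_profile_period[OF A] by blast
  have cong: "profile A (concat (replicate m s)) = profile A (concat (replicate m' s))"
    if "N \<le> m" "N \<le> m'" "m mod N = m' mod N" for m m' s
    using that
  proof (induction m m' rule: linorder_wlog)
    case (le m m')
    then have "N dvd m' - m" by (metis mod_eq_dvd_iff_nat)
    then obtain a where "m' = m + a * N" using le(1)
      by (metis dvd_def le_add_diff_inverse mult.commute)
    then show ?case using N(2)[of m a s] le by simp
  qed simp
  \<comment> \<open>The end of the block in which component \<open>j - 1\<close> enters
    \<open>t\<close>; for \<open>j = 0\<close>, the end of the common initial part.\<close>
  define stop where "stop ms j = U + (case j of 0 \<Rightarrow> 0 | Suc j \<Rightarrow> Suc (ms ! j)) * M" for ms :: "nat list" and j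
  \<comment> \<open>\<open>S k j\<close> is the block repeated while the first \<open>j\<close> of
    \<open>k\<close> components are in the periodic part of \<open>t\<close> and the others still in
    \<open>z\<close>; in \<open>T k j\<close>, component \<open>j\<close> reads its exceptional
    block.\<close>
  define S where "S k j = map (\<lambda>p. map (\<lambda>i. if i < j then t (M + p) else z (U + p)) [0..<k]) [0..<M]" for k j
  define T where "T k j = map (\<lambda>p. map (\<lambda>i. if i < j then t (M + p) else if i = j then t p else z (U + p)) [0..<k]) [0..<M]" for k j
  define gap where "gap ms j = ms ! j - (case j of 0 \<Rightarrow> 0 | Suc j \<Rightarrow> Suc (ms ! j))" for ms :: "nat list" and j
  have conv_block: "convolution (map W ms) (U + b * M + p) =
      map (\<lambda>i. if b < ms ! i then z (U + p) else if b = ms ! i then t p else t (M + p)) [0..<length ms]"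
    if "p < M" for ms b p
    using W_block[OF that] by (intro nth_equalityI) (simp_all add: convolution_def)
  \<comment> \<open>Multiples of \<open>2 * N\<close> are taken because a run after the first one
    loses a block to the preceding transition and must still consist of at least \<open>N\<close>
    blocks. Its length is then \<open>N - 1\<close> modulo \<open>N\<close>; that of the first run
    is 0.\<close>
  have decomp: "prefix (stop ms (Suc j)) (convolution (map W ms)) =
      prefix (stop ms j) (convolution (map W ms)) @ concat (replicate (gap ms j) (S (length ms) j)) @ T (length ms) j"
    and gap: "N \<le> gap ms j" "gap ms j mod N = (case j of 0 \<Rightarrow> 0 | Suc _ \<Rightarrow> N - 1)"
    if ms: "admissible (2 * N) ms" and j: "j < length ms" for ms j
  proof -
    let ?w = "convolution (map W ms)"
    define b where "b = (case j of 0 \<Rightarrow> 0 | Suc j \<Rightarrow> Suc (ms ! j))"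
    have nth_less: "ms ! i < ms ! i'" if "i < i'" "i' < length ms" for i i'
      using ms that by (auto simp: admissible_def sorted_wrt_iff_nth_less)
    have mult: "0 < ms ! i" "2 * N dvd ms ! i" if "i < length ms" for i
      using ms that by (auto simp: admissible_def)
    have "N \<le> gap ms j \<and> gap ms j mod N = (case j of 0 \<Rightarrow> 0 | Suc _ \<Rightarrow> N - 1)"
    proof (cases j)
      case 0
      obtain a where "ms ! 0 = 2 * N * a" using mult(2)[OF j] 0 by (auto simp: dvd_def)
      then show ?thesis using 0 mult(1)[OF j] by (cases a) (auto simp: gap_def)
    next
      case (Suc i)
      obtain a where a: "ms ! j = 2 * N * a" using mult(2)[OF j] by (auto simp: dvd_def)
      obtain c where c: "ms ! i = 2 * N * c" using mult(2)[of i] j Suc by (auto simp: dvd_def)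
      have "2 * N * c < 2 * N * a" using nth_less[of i j] j Suc a c by simp
      then have "c < a" by simp
      then obtain v where v: "a = Suc (c + v)" using less_iff_Suc_add by blast
      have "gap ms j = 2 * N * v + 2 * N - 1"
        using Suc a c v by (simp add: gap_def algebra_simps)
      also have "\<dots> = (N - 1) + (2 * v + 1) * N" using N(1) by (simp add: algebra_simps)
      finally show ?thesis using Suc N(1) by (simp only: mod_mult_self1) simp
    qed
    then show "N \<le> gap ms j" "gap ms j mod N = (case j of 0 \<Rightarrow> 0 | Suc _ \<Rightarrow> N - 1)" by auto
    then have b: "b + gap ms j = ms ! j" using N(1) by (simp add: gap_def b_def)
    have below: "ms ! i < b" if i: "i < j" for i
    proof -
      obtain j' where "j = Suc j'" using i by (cases j) auto
      then show ?thesis using nth_less[of i j'] i j by (cases "i = j'") (auto simp: b_def)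
    qed
    have above: "ms ! j \<le> ms ! i" if "j \<le> i" "i < length ms" for i
      using nth_less[of j i] that by (cases "i = j") auto
    have "subsequence ?w (U + b * M) (U + (b + gap ms j) * M) = concat (replicate (gap ms j) (S (length ms) j))"
    proof (rule subsequence_concat_replicate)
      fix c p assume c: "b \<le> c" "c < b + gap ms j" and p: "p < M"
      have "(if c < ms ! i then z (U + p) else if c = ms ! i then t p else t (M + p)) =
          (if i < j then t (M + p) else z (U + p))" if "i < length ms" for i
        using below[of i] above[of i] that c b by (cases "i < j") auto
      then show "?w (U + c * M + p) = S (length ms) j ! p"
        using p unfolding conv_block[OF p] S_def by simp
    qed (simp add: S_def)
    moreover have "subsequence ?w (U + ms ! j * M) (U + Suc (ms ! j) * M) = T (length ms) j"
    proof (rule nth_equalityI)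
      fix p assume "p < length (subsequence ?w (U + ms ! j * M) (U + Suc (ms ! j) * M))"
      then have p: "p < M" by simp
      have "(if ms ! j < ms ! i then z (U + p) else if ms ! j = ms ! i then t p else t (M + p)) =
          (if i < j then t (M + p) else if i = j then t p else z (U + p))" if "i < length ms" for i
        using nth_less[of i j] nth_less[of j i] that j by (cases i j rule: linorder_cases) auto
      then show "subsequence ?w (U + ms ! j * M) (U + Suc (ms ! j) * M) ! p = T (length ms) j ! p"
        using p conv_block[OF p, of ms "ms ! j"] by (simp add: T_def)
    qed (simp add: T_def)
    moreover have "prefix (stop ms (Suc j)) ?w = prefix (U + b * M) ?w @
      subsequence ?w (U + b * M) (U + ms ! j * M) @ subsequence ?w (U + ms ! j * M) (U + Suc (ms ! j) * M)"
    proof -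
      have le: "U + b * M \<le> U + ms ! j * M" "U + ms ! j * M \<le> stop ms (Suc j)"
        using b by (auto simp: stop_def intro: mult_le_mono1)
      have "prefix (stop ms (Suc j)) ?w = prefix (U + b * M) ?w @ subsequence ?w (U + b * M) (stop ms (Suc j))"
        using le_trans[OF le] by (intro subsequence_split) simp_all
      also have "subsequence ?w (U + b * M) (stop ms (Suc j)) =
          subsequence ?w (U + b * M) (U + ms ! j * M) @ subsequence ?w (U + ms ! j * M) (stop ms (Suc j))"
        using le by (rule subsequence_split)
      finally show ?thesis by (simp add: stop_def)
    qed
    ultimately show "prefix (stop ms (Suc j)) ?w =
        prefix (stop ms j) ?w @ concat (replicate (gap ms j) (S (length ms) j)) @ T (length ms) j"
      using b by (simp add: stop_def b_def)
  qed
  have period: "convolution (map W ms) \<in> buchi_language A \<longleftrightarrow> convolution (map W ms') \<in> buchi_language A"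
    if ms: "admissible (2 * N) ms" "admissible (2 * N) ms'" "length ms = length ms'" for ms ms'
  proof (cases "length ms")
    case 0
    then show ?thesis using ms(3) by simp
  next
    case (Suc k)
    let ?w = "convolution (map W ms)" and ?w' = "convolution (map W ms')"
    have prefixes: "profile A (prefix (stop ms j) ?w) = profile A (prefix (stop ms' j) ?w')"
      if "j \<le> length ms" for j
      using that
    proof (induction j)
      case 0
      have "convolution (map W ms) p = convolution (map W ms') p" if "p < U" for p
        using W_initial[OF that] ms(3) by (intro nth_equalityI) (simp_all add: convolution_def)
      then show ?case by (simp add: stop_def subsequence_cong[of 0 U ?w ?w'])
    next
      case (Suc j)
      then show ?case
        using decomp[OF ms(1), of j] decomp[OF ms(2), of j] ms(3)
          cong[OF gap(1)[OF ms(1), of j] gap(1)[OF ms(2), of j]]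
          gap(2)[OF ms(1), of j] gap(2)[OF ms(2), of j]
        by (simp add: profile_append[OF A])
    qed
    have tails: "convolution (map W ms) (stop ms (length ms) + p) = replicate (length ms) (t (M + p))"
      if "admissible (2 * N) ms" "length ms = Suc k" for ms p
    proof (rule nth_equalityI)
      fix i assume "i < length (convolution (map W ms) (stop ms (length ms) + p))"
      then have i: "i < Suc k" using that(2) by (simp add: convolution_def)
      have "ms ! i < Suc (ms ! k)"
        using that i by (cases "i = k") (auto simp: admissible_def sorted_wrt_iff_nth_less less_Suc_eq)
      from W_tail[OF this, of p] show "convolution (map W ms) (stop ms (length ms) + p) ! i =
          replicate (length ms) (t (M + p)) ! i"
        using i that(2) by (simp add: convolution_def stop_def del: replicate_Suc)
    qed (simp add: convolution_def)
    \<comment> \<open>Behind the last transition all components are in their periodic tails, at the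
      same phase, so the words are compared letter by letter from there on.\<close>
    define f where "f ms i = (case i of 0 \<Rightarrow> 0 | Suc i \<Rightarrow> stop ms (length ms) + i)" for ms :: "nat list" and i
    have pos: "0 < stop ms (length ms)" if "length ms = Suc k" for ms
      using that M by (simp add: stop_def)
    have f: "strict_mono (f ms)" "f ms 0 = 0" if "length ms = Suc k" for ms
      using pos[OF that] by (auto simp: f_def strict_mono_Suc_iff split: nat.splits)
    have k: "length ms = Suc k" "length ms' = Suc k" using Suc ms(3) by simp_all
    have "profile A (subsequence ?w (f ms i) (f ms (Suc i))) =
        profile A (subsequence ?w' (f ms' i) (f ms' (Suc i)))" for i
    proof (cases i)
      case 0
      then show ?thesis using prefixes[of "length ms"] ms(3) by (simp add: f_def)
    next
      case (Suc p)
      then show ?thesis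
        using tails[OF ms(1) k(1), of p] tails[OF ms(2) k(2), of p] ms(3) by (simp add: f_def)
    qed
    from buchi_language_profile_iff[OF A f[OF k(1)] f[OF k(2)] this] show ?thesis .
  qed
  show thesis
    by (rule that[of "2 * N", OF _ period]) (use N(1) in simp_all)
qed

lemma ex_common_tuple_period:
  fixes A :: "'i \<Rightarrow> ('q, 'a list) buchi"
  assumes "finite I" "\<And>i. i \<in> I \<Longrightarrow> buchi_automaton (A i)"
  obtains N where "1 \<le> N"
    "\<And>i ms ms'. i \<in> I \<Longrightarrow> admissible N ms \<Longrightarrow> admissible N ms' \<Longrightarrow> length ms = length ms' \<Longrightarrow>
      convolution (map W ms) \<in> buchi_language (A i) \<longleftrightarrow> convolution (map W ms') \<in> buchi_language (A i)"
proof -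
  have "\<forall>i\<in>I. \<exists>N\<ge>1. \<forall>ms ms'. admissible N ms \<longrightarrow> admissible N ms' \<longrightarrow> length ms = length ms' \<longrightarrow>
      (convolution (map W ms) \<in> buchi_language (A i) \<longleftrightarrow> convolution (map W ms') \<in> buchi_language (A i))"
    using ex_tuple_period assms(2) by metis
  then obtain N where N: "\<And>i. i \<in> I \<Longrightarrow> N i \<ge> 1" "\<And>i ms ms'. i \<in> I \<Longrightarrow> admissible (N i) ms \<Longrightarrow>
      admissible (N i) ms' \<Longrightarrow> length ms = length ms' \<Longrightarrow>
      convolution (map W ms) \<in> buchi_language (A i) \<longleftrightarrow> convolution (map W ms') \<in> buchi_language (A i)"
    by metis
  have "admissible (N i) ms" if "admissible (prod N I) ms" "i \<in> I" for i ms
    using that dvd_prodI[OF assms(1) that(2), of N] by (auto simp: admissible_def intro: dvd_trans)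
  moreover have "1 \<le> prod N I" using N(1) by (intro prod_ge_1) auto
  ultimately show thesis
    using N(2) by (intro that[of "prod N I"]) meson+
qed

end

text \<open>\<open>Y\<close> consists of infinitely many pairwise inequivalent words that end like
  \<open>x\<close>, and \<open>z0\<close> is a limit of them. The chosen \<open>y a\<close> agree
  with \<open>z0\<close> up to \<open>n a\<close> and with \<open>x\<close> from
  \<open>n (Suc a)\<close> on, and Ramsey's theorem gives all blocks the profiles of the first one.
  Replacing each block by its counterpart in the first one turns \<open>y m\<close> into an
  eventually periodic word and preserves membership in \<open>L\<close> and inequivalence.\<close>

lemma (in automatic_kernel) ex_pumping:
  assumes "infinite (h ` {y \<in> L. end_equal y x})"
    and \<Sigma>: "finite \<Sigma>" "\<And>y. y \<in> L \<Longrightarrow> range y \<subseteq> \<Sigma>"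
  obtains U M z t where "pumping U M z t" "\<And>m. pumped U M z t m \<in> L" "inj (\<lambda>m. h (pumped U M z t m))"
proof -
  obtain Y where Y: "Y \<subseteq> {y \<in> L. end_equal y x}" "inj_on h Y" "h ` {y \<in> L. end_equal y x} = h ` Y"
    using subset_image_inj[of "h ` {y \<in> L. end_equal y x}" h "{y \<in> L. end_equal y x}"]
    by (elim iffE) (metis (no_types, lifting) order_refl)
  have "infinite Y"
    using assms(1) finite_imageI[of Y h] unfolding Y(3) by blast
  moreover have "range y \<subseteq> \<Sigma>" if "y \<in> Y" for y
    using \<Sigma>(2)[of y] that Y(1) by blast
  ultimately obtain z0 where z0: "\<And>n. infinite {y \<in> Y. prefix n y = prefix n z0}"
    using ex_limit_word[OF \<Sigma>(1)] by meson
  \<comment> \<open>The bound also covers a position where \<open>y\<close> leaves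
    \<open>z0\<close>. A later choice agrees with \<open>z0\<close> there, which makes the chosen
    words distinct.\<close>
  have "\<exists>b. (\<forall>p\<ge>b. y p = x p) \<and> (\<exists>p<b. y p \<noteq> z0 p)" if y: "y \<in> Y - {z0}" for y
  proof -
    have "end_equal y x" using y Y(1) by blast
    then obtain b where "\<forall>p\<ge>b. y p = x p" unfolding end_equal_def by blast
    moreover obtain p where "y p \<noteq> z0 p" using y by auto
    ultimately show ?thesis by (intro exI[of _ "max b (Suc p)"]) (auto intro!: exI[of _ p])
  qed
  then obtain B where B: "\<And>y p. y \<in> Y - {z0} \<Longrightarrow> B y \<le> p \<Longrightarrow> y p = x p"
    "\<And>y. y \<in> Y - {z0} \<Longrightarrow> \<exists>p<B y. y p \<noteq> z0 p"
    by metis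
  define P where "P ny \<longleftrightarrow> snd ny \<in> Y - {z0} \<and> 0 < fst ny \<and> prefix (fst ny) (snd ny) = prefix (fst ny) z0"
    for ny :: "nat \<times> 'a word"
  have ex: "\<exists>y. P (n, y)" if "0 < n" for n
  proof -
    have "infinite ({y \<in> Y. prefix n y = prefix n z0} - {z0})"
      by (rule Diff_infinite_finite[OF _ z0]) simp
    from infinite_imp_nonempty[OF this]
    obtain y where "y \<in> Y" "y \<noteq> z0" "prefix n y = prefix n z0" by blast
    then show ?thesis using \<open>0 < n\<close> by (intro exI[of _ y]) (simp add: P_def)
  qed
  have "\<exists>f. \<forall>i. P (f i) \<and> fst (f i) < fst (f (Suc i)) \<and> B (snd (f i)) \<le> fst (f (Suc i))"
  proof (rule dependent_nat_choice)
    show "\<exists>ny. P ny" using ex[of 1] by auto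
    fix ny assume "P ny"
    show "\<exists>ny'. P ny' \<and> fst ny < fst ny' \<and> B (snd ny) \<le> fst ny'"
    proof -
      let ?n = "Suc (max (fst ny) (B (snd ny)))"
      obtain y where "P (?n, y)" using ex[of ?n] by auto
      then show ?thesis by (intro exI[of _ "(?n, y)"]) auto
    qed
  qed
  then obtain f where f: "\<And>i. P (f i)" "\<And>i. fst (f i) < fst (f (Suc i))"
    "\<And>i. B (snd (f i)) \<le> fst (f (Suc i))" by blast
  define ns ys where "ns i = fst (f i)" and "ys i = snd (f i)" for i
  have ns: "strict_mono ns" using f(2) by (simp add: ns_def strict_mono_Suc_iff)
  \<comment> \<open>For \<open>m \<le> m'\<close>, the components of \<open>(y m, y m')\<close> show
    \<open>z0\<close> before their index, their own word at it and \<open>x\<close> behind it. These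
    are the six combinations that can occur in a block, the last one being for
    \<open>m = m'\<close>.\<close>
  define words where "words i = [(z0, z0), (ys i, z0), (x, z0), (x, ys i), (x, x), (ys i, ys i)]" for i
  define col where "col i j = map (\<lambda>(u, v). profile A (subsequence (pair u v) (ns i) (ns j))) (words i)" for i j
  have fin: "finite {c. set c \<subseteq> profiles A \<and> length c = 6}"
    by (rule finite_lists_length_eq[OF finite_profiles[OF A]])
  have col_in: "col a b \<in> {c. set c \<subseteq> profiles A \<and> length c = 6}" for a b
    by (auto simp: col_def words_def profile_in_profiles[OF A])
  obtain s :: "nat \<Rightarrow> nat" and c where s: "strict_mono s" "\<And>a b. a < b \<Longrightarrow> col (s a) (s b) = c"
    using ex_homogeneous_sequence[OF fin, of col, OF col_in] by blast
  define n y where "n a = ns (s a)" and "y a = ys (s a)" for a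
  have n: "strict_mono n" "0 < n 0"
    using s(1) ns f(1)[of "s 0"] by (simp_all add: n_def strict_mono_def ns_def P_def)
  have colour: "profile A (subsequence (pair u v) (n a) (n (Suc a))) = profile A (subsequence (pair u' v') (n 0) (n 1))"
    if "((u, v), (u', v')) \<in> set (zip (words (s a)) (words (s 0)))" for u v u' v' a
    using s(2)[of a "Suc a"] s(2)[of 0 1] that by (auto simp: col_def words_def n_def)
  have y_z0: "y a p = z0 p" if "p < n a" for a p
    using f(1)[of "s a"] that subsequence_eq_nth[of "y a" 0 "n a" z0 p]
    by (simp add: P_def n_def y_def ns_def ys_def)
  have B_n: "B (y a) \<le> n b" if "a < b" for a b
  proof -
    have "s a < s b" using s(1) that by (simp add: strict_monoD)
    then have "ns (Suc (s a)) \<le> ns (s b)" using ns by (simp add: strict_mono_less_eq)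
    then show ?thesis using f(3)[of "s a"] by (simp add: n_def y_def ns_def ys_def)
  qed
  have y_Y: "y a \<in> Y - {z0}" for a using f(1) by (simp add: y_def ys_def P_def)
  have y_x: "y a p = x p" if "a < b" "n b \<le> p" for a b p
    using B(1)[OF y_Y] B_n[OF that(1)] that(2) by (meson le_trans)
  have y_distinct: "y a \<noteq> y b" if "a < b" for a b
    using B(2)[OF y_Y[of a]] B_n[OF that] y_z0[of _ b] by (metis less_le_trans)
  define U M where "U = n 0" and "M = n 1 - n 0"
  have M_pos: "0 < M" "n 1 = U + M" using strict_monoD[OF n(1), of 0 1] by (simp_all add: U_def M_def)
  \<comment> \<open>The block from \<open>n 0\<close> to \<open>n 1\<close> is the pattern:
    \<open>z\<close> repeats that of \<open>z0\<close>, while \<open>t\<close> begins with that of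
    \<open>y 0\<close> and then repeats that of \<open>x\<close>.\<close>
  define z where "z p = (if p < U then z0 p else z0 (U + (p - U) mod M))" for p
  define t where "t p = (if p < M then y 0 (U + p) else x (U + p mod M))" for p
  have "(i + M - U) mod M = (i - U) mod M" if "U \<le> i" for i
    using that by (metis Nat.add_diff_assoc2 mod_add_self2)
  then interpret pumping U M z t
    using M_pos(1) by unfold_locales (auto simp: z_def t_def)
  define blk where "blk w m b = (if b < m then z0 else if b = m then w else x)" for w :: "'a word" and m b :: nat
  have W_blk: "W m (U + b * M + p) = blk (y 0) m b (U + p)" if "p < M" for m b p
    using W_block[OF that, of m b] that by (simp add: blk_def z_def t_def)
  have y_blk: "y m p = blk (y b) m b p" if "n b \<le> p" "p < n (Suc b)" for m b p
  proof -
    have "y m p = z0 p" if "b < m"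
    proof (rule y_z0)
      have "n (Suc b) \<le> n m" using that n(1) by (simp add: strict_mono_less_eq)
      with \<open>p < n (Suc b)\<close> show "p < n m" by simp
    qed
    then show ?thesis using y_x[of m b p] that(1) by (auto simp: blk_def)
  qed
  define F where "F i = (case i of 0 \<Rightarrow> 0 | Suc i \<Rightarrow> U + i * M)" for i
  define G where "G i = (case i of 0 \<Rightarrow> 0 | Suc i \<Rightarrow> n i)" for i
  have F: "strict_mono F" "F 0 = 0" and G: "strict_mono G" "G 0 = 0"
    using n M by (auto simp: F_def G_def U_def strict_mono_Suc_iff split: nat.splits)
  have kernel_iff: "pair (W m) (W m') \<in> buchi_language A \<longleftrightarrow> pair (y m) (y m') \<in> buchi_language A"
    if "m \<le> m'" for m m'
  proof (rule buchi_language_profile_iff[OF A F G])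
    fix i
    show "profile A (subsequence (pair (W m) (W m')) (F i) (F (Suc i))) =
      profile A (subsequence (pair (y m) (y m')) (G i) (G (Suc i)))"
    proof (cases i)
      case 0
      have "y m p = z0 p \<and> W m p = z0 p" if "p < U" for p m
        using that y_z0[of p m] W_initial[OF that, of m] strict_mono_less_eq[OF n(1), of 0 m]
        by (simp add: z_def U_def)
      then show ?thesis
        using 0 by (simp add: F_def G_def U_def[symmetric]
          subsequence_pair_cong[of 0 U "W m" "y m" "W m'" "y m'"])
    next
      case (Suc b)
      have "subsequence (pair (W m) (W m')) (U + b * M) (U + b * M + M) =
          subsequence (pair (blk (y 0) m b) (blk (y 0) m' b)) U (U + M)"
        by (rule subsequence_shift_cong) (simp add: pair_def W_blk)
      moreover have "subsequence (pair (y m) (y m')) (n b) (n (Suc b)) =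
          subsequence (pair (blk (y b) m b) (blk (y b) m' b)) (n b) (n (Suc b))"
        by (rule subsequence_pair_cong) (simp add: y_blk)
      moreover have "profile A (subsequence (pair (blk (y b) m b) (blk (y b) m' b)) (n b) (n (Suc b))) =
          profile A (subsequence (pair (blk (y 0) m b) (blk (y 0) m' b)) (n 0) (n 1))"
        using that by (intro colour) (auto simp: blk_def words_def y_def)
      ultimately show ?thesis
        using Suc M_pos(2) by (simp add: F_def G_def U_def add_ac)
    qed
  qed
  show thesis
  proof (rule that)
    show "W m \<in> L" for m
      using kernel_iff[of m m] y_Y[of m] Y(1) by (auto simp: in_L_iff)
    then have "h (W m) \<noteq> h (W m')" if "m < m'" for m m'
      using kernel_iff[of m m'] that kernel[of "y m" "y m'"] kernel[of "W m" "W m'"]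
        y_distinct[OF that] y_Y[of m] y_Y[of m'] Y(1,2) by (auto dest: inj_onD)
    then show "inj (\<lambda>m. h (W m))"
      unfolding inj_on_def by (metis linorder_neqE_nat)
  qed unfold_locales
qed

section \<open>Presentations of countable partitions and injective presentations\<close>

lemma infinite_countable_eqpoll_nat:
  assumes "countable X" "infinite X"
  shows "X \<approx> (UNIV :: nat set)"
  using assms by (meson countable_def infinite_le_lepoll lepoll_antisym lepoll_def subset_UNIV)

text \<open>Each class is recognized by an automaton on \<open>k\<close>-tuples, and with a common
  period all of these are constant on admissible tuples of exponents. The class of a single
  \<open>k\<close>-subset is therefore the class of all.\<close>

lemma ex_regular_homogeneous:
  fixes L :: "'a word set" and h :: "'a word \<Rightarrow> 'v"
  assumes part: "kl_partition k l V E" and pres: "omega_automatic_presentation k l V E L h"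
    and inf: "infinite V" and "countable V \<or> inj_on h L"
  shows "\<exists>H\<subseteq>L. omega_regular H \<and> homogeneous k l V E (h ` H) \<and> h ` H \<approx> (UNIV :: nat set)"
proof -
  have L: "omega_regular L" "h ` L = V"
    and E: "\<And>i. i \<in> {1..l} \<Longrightarrow> omega_automatic k {xs. length xs = k \<and> set xs \<subseteq> L \<and> h ` set xs \<in> E i}"
    and eq: "omega_automatic 2 {[x, y] | x y. x \<in> L \<and> y \<in> L \<and> h x = h y}"
    using pres by (auto simp: omega_automatic_presentation_def)
  obtain A :: "(nat, 'a list) buchi" where A: "buchi_automaton A" "\<And>xs. length xs = 2 \<Longrightarrow>
      convolution xs \<in> buchi_language A \<longleftrightarrow> xs \<in> {[x, y] | x y. x \<in> L \<and> y \<in> L \<and> h x = h y}"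
    using omega_automatic_buchi[OF eq] by blast
  have "convolution [x, y] = pair x y" for x y :: "'a word"
    by (simp add: convolution_def pair_def)
  with A(2)[of "[_, _]"] interpret automatic_kernel L h A
    by unfold_locales (auto simp: A(1))
  obtain \<Sigma> where \<Sigma>: "finite \<Sigma>" "\<And>y. y \<in> L \<Longrightarrow> range y \<subseteq> \<Sigma>"
  proof -
    obtain B :: "(nat, 'a) buchi" where "buchi_automaton B" "L = buchi_language B"
      using L(1) by (auto simp: omega_regular_def)
    then have "finite (ba_alphabet B)" "\<And>y. y \<in> L \<Longrightarrow> range y \<subseteq> ba_alphabet B"
      by (fastforce simp: buchi_automaton_def buchi_language_def)+
    then show thesis by (rule that)
  qed
  obtain x where x: "infinite (h ` {y \<in> L. end_equal y x})"
    using ex_infinite_end_class assms(4) inf L(2) by blast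
  obtain U M z t where pump: "pumping U M z t" and W_L: "\<And>m. pumped U M z t m \<in> L"
    and W_inj: "inj (\<lambda>m. h (pumped U M z t m))"
    using ex_pumping[OF x \<Sigma>] by metis
  interpret pumping U M z t by (fact pump)
  have "\<forall>i\<in>{1..l}. \<exists>B :: (nat, 'a list) buchi. buchi_automaton B \<and> (\<forall>xs. length xs = k \<longrightarrow>
      (convolution xs \<in> buchi_language B \<longleftrightarrow> set xs \<subseteq> L \<and> h ` set xs \<in> E i))"
  proof
    fix i assume "i \<in> {1..l}"
    from omega_automatic_buchi[OF E[OF this]]
    obtain B :: "(nat, 'a list) buchi" where "buchi_automaton B" "\<And>xs. length xs = k \<Longrightarrow>
        convolution xs \<in> buchi_language B \<longleftrightarrow> xs \<in> {xs. length xs = k \<and> set xs \<subseteq> L \<and> h ` set xs \<in> E i}"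
      by blast
    then show "\<exists>B :: (nat, 'a list) buchi. buchi_automaton B \<and> (\<forall>xs. length xs = k \<longrightarrow>
      (convolution xs \<in> buchi_language B \<longleftrightarrow> set xs \<subseteq> L \<and> h ` set xs \<in> E i))"
      by (intro exI[of _ B]) simp
  qed
  then obtain B :: "nat \<Rightarrow> (nat, 'a list) buchi" where B: "\<And>i. i \<in> {1..l} \<Longrightarrow> buchi_automaton (B i)"
    "\<And>i xs. i \<in> {1..l} \<Longrightarrow> length xs = k \<Longrightarrow>
      convolution xs \<in> buchi_language (B i) \<longleftrightarrow> set xs \<subseteq> L \<and> h ` set xs \<in> E i"
    by metis
  obtain N where N: "1 \<le> N" "\<And>i ms ms'. i \<in> {1..l} \<Longrightarrow> admissible N ms \<Longrightarrow> admissible N ms' \<Longrightarrow>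
      length ms = length ms' \<Longrightarrow>
      convolution (map W ms) \<in> buchi_language (B i) \<longleftrightarrow> convolution (map W ms') \<in> buchi_language (B i)"
    using ex_common_tuple_period[of "{1..l}" B] B(1) by (metis finite_atLeastAtMost)
  define I where "I = range (\<lambda>a. Suc a * N)"
  define H where "H = W ` I"
  have "infinite I"
    unfolding I_def using N(1) by (intro range_inj_infinite) (simp add: inj_on_def)
  have inj_I: "inj_on (h \<circ> W) J" for J
    using W_inj by (auto simp: inj_on_def)
  have H: "h ` H = (h \<circ> W) ` I" "infinite (h ` H)" "H \<subseteq> L"
    using finite_imageD[OF _ inj_I, of I] \<open>infinite I\<close> W_L by (auto simp: H_def image_comp)
  have "omega_regular H"
  proof -
    \<comment> \<open>\<open>N * M\<close> is a common period of \<open>z\<close> and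
      \<open>t\<close>. The least exponent in \<open>I\<close> is \<open>N\<close>, hence the offset
      \<open>U + N * M\<close>.\<close>
    have "omega_regular {prefix ((U + N * M) + a * (N * M)) z \<frown> t | a. True}"
    proof (rule omega_regular_splice_periodic)
      have "z p \<in> \<Sigma>" for p
      proof -
        have "Suc p * 1 \<le> Suc p * M" using M by (intro mult_le_mono2) simp
        then have "W (Suc p) p = z p" by (simp add: pumped_def)
        then show ?thesis using \<Sigma>(2)[OF W_L[of "Suc p"]] by (metis rangeI subsetD)
      qed
      then show "finite (range z)" using \<Sigma>(1) by (meson finite_subset image_subsetI)
      have "t p \<in> \<Sigma>" for p
      proof -
        have "W 0 (U + p) = t p" by (simp add: pumped_def)
        then show ?thesis using \<Sigma>(2)[OF W_L[of 0]] by (metis rangeI subsetD)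
      qed
      then show "finite (range t)" using \<Sigma>(1) by (meson finite_subset image_subsetI)
      show "z (i + N * M) = z i" if "U + N * M \<le> i" for i
        using periodic_add_mult[of U z M i N, OF z] that by simp
      show "t (i + N * M) = t i" if "M \<le> i" for i
        using periodic_add_mult[of M t M i N, OF t] that by simp
      show "0 < N * M" using N(1) M by simp
    qed
    also have "{prefix ((U + N * M) + a * (N * M)) z \<frown> t | a. True} = H"
      unfolding H_def I_def pumped_def by (auto simp: image_iff algebra_simps)
    finally show ?thesis .
  qed
  moreover have "homogeneous k l V E (h ` H)"
  proof -
    have tuple: "\<exists>ms. admissible N ms \<and> length ms = k \<and> X = h ` set (map W ms)"
      if "X \<in> [h ` H]\<^bsup>k\<^esup>" for X
    proof -
      have X: "X \<subseteq> (h \<circ> W) ` I" "finite X" "card X = k"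
        using that H(1) by (auto simp: nsets_def)
      then obtain S where S: "S \<subseteq> I" "X = (h \<circ> W) ` S"
        by (meson subset_imageE)
      have "finite S" "card S = k"
        using X(2,3) finite_imageD[OF _ inj_I, of S] card_image[OF inj_I, of S] unfolding S(2) by simp_all
      moreover have "admissible N (sorted_list_of_set S)"
        using S(1) N(1) \<open>finite S\<close> by (auto simp: admissible_def I_def)
      ultimately show ?thesis
        using S(2) by (intro exI[of _ "sorted_list_of_set S"]) (simp add: image_comp)
    qed
    obtain X0 where X0: "X0 \<in> [h ` H]\<^bsup>k\<^esup>"
      using H(2) by (metis ex_in_conv nsets_eq_empty_iff)
    obtain ms0 where ms0: "admissible N ms0" "length ms0 = k" "X0 = h ` set (map W ms0)"
      using tuple[OF X0] by blast
    have "h ` H \<subseteq> V" using H(3) L(2) by blast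
    then have "X0 \<in> [V]\<^bsup>k\<^esup>" using X0 nsets_mono by blast
    then obtain i where i: "i \<in> {1..l}" "X0 \<in> E i"
      using part unfolding kl_partition_def by blast
    have "X \<in> E i" if X: "X \<in> [h ` H]\<^bsup>k\<^esup>" for X
    proof -
      obtain ms where ms: "admissible N ms" "length ms = k" "X = h ` set (map W ms)"
        using tuple[OF X] by blast
      have "set (map W ms') \<subseteq> L" for ms' using W_L by auto
      then have "h ` set (map W ms') \<in> E i \<longleftrightarrow> convolution (map W ms') \<in> buchi_language (B i)"
        if "length ms' = k" for ms'
        using B(2)[OF i(1), of "map W ms'"] that by simp
      then show ?thesis
        using N(2)[OF i(1) ms0(1) ms(1)] ms0(2,3) ms(2,3) i(2) by metis
    qed
    then show ?thesis
      using i(1) \<open>h ` H \<subseteq> V\<close> unfolding homogeneous_def by blast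
  qed
  moreover have "h ` H \<approx> (UNIV :: nat set)"
    using H by (intro infinite_countable_eqpoll_nat) (simp_all add: I_def)
  ultimately show ?thesis using H(3) by blast
qed

section \<open>Automata for the counterexample\<close>

text \<open>Finitely many Buchi conditions are merged by a counter: in state \<open>c\<close> the
  automaton waits for \<open>P c\<close>, and state \<open>m\<close> accepts and resets. For
  \<open>m = 0\<close> this yields all words over \<open>\<Sigma>\<close>.\<close>

lemma omega_regular_infinitely_often:
  fixes P :: "nat \<Rightarrow> 'a \<Rightarrow> bool"
  assumes "finite \<Sigma>"
  shows "omega_regular {w. range w \<subseteq> \<Sigma> \<and> (\<forall>c<m. \<exists>\<^sub>\<infinity>i. P c (w i))}"
proof -
  define \<delta> where "\<delta> c a = (if c = m then 0 else if P c a then Suc c else c)" for c a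
  define A where "A = \<lparr>ba_alphabet = \<Sigma>, ba_states = {..m}, ba_initial = {0},
    ba_trans = {(c, a, \<delta> c a) | c a. c \<le> m \<and> a \<in> \<Sigma>}, ba_accepting = {m}\<rparr>"
  have "ba_trans A = (\<lambda>(c, a). (c, a, \<delta> c a)) ` ({..m} \<times> \<Sigma>)"
    by (auto simp: A_def)
  then have A: "buchi_automaton A"
    using assms by (auto simp: buchi_automaton_def A_def \<delta>_def)
  have "buchi_language A = {w. range w \<subseteq> \<Sigma> \<and> (\<forall>c<m. \<exists>\<^sub>\<infinity>i. P c (w i))}" (is "_ = ?R")
  proof (intro equalityI subsetI)
    fix w assume "w \<in> buchi_language A"
    then obtain r where r: "r 0 = 0" "\<And>i. r i \<le> m \<and> w i \<in> \<Sigma> \<and> r (Suc i) = \<delta> (r i) (w i)"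
      "\<exists>\<^sub>\<infinity>i. r i = m"
      unfolding buchi_language_def A_def by auto
    have "\<exists>\<^sub>\<infinity>i. P c (w i)" if c: "c < m" for c
      unfolding INFM_nat
    proof
      fix n
      obtain i where i: "i > n" "r i = m" using r(3) unfolding INFM_nat by blast
      obtain j where j: "j > Suc i" "r j = m" using r(3) unfolding INFM_nat by blast
      have r0: "r (Suc i) = 0" using r(2)[of i] i(2) by (simp add: \<delta>_def)
      \<comment> \<open>The first time after the reset at which the counter exceeds
        \<open>c\<close>; the letter just before it must satisfy \<open>P c\<close>.\<close>
      define e where "e = (LEAST e. e > Suc i \<and> c < r e)"
      have ex: "\<exists>e. e > Suc i \<and> c < r e" using j c by auto
      have e: "e > Suc i" "c < r e" using LeastI_ex[OF ex] by (auto simp: e_def)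
      have "\<not> (e - 1 > Suc i \<and> c < r (e - 1))"
        using e(1) not_less_Least[of "e - 1" "\<lambda>e. e > Suc i \<and> c < r e"] by (auto simp: e_def)
      then have le: "r (e - 1) \<le> c" using r0 e(1) by (cases "e - 1 = Suc i") auto
      have "r e = \<delta> (r (e - 1)) (w (e - 1))" using r(2)[of "e - 1"] e(1) by simp
      then have "P c (w (e - 1))"
        using le e(2) c by (auto simp: \<delta>_def split: if_splits) (metis le_antisym less_Suc_eq_le)
      then show "\<exists>i>n. P c (w i)" using e(1) i(1) by (intro exI[of _ "e - 1"]) simp
    qed
    then show "w \<in> ?R"
      using r(2) by auto
  next
    fix w assume "w \<in> ?R"
    then have w: "\<And>i. w i \<in> \<Sigma>" "\<And>c. c < m \<Longrightarrow> \<exists>\<^sub>\<infinity>i. P c (w i)" by auto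
    define r where "r = rec_nat 0 (\<lambda>i c. \<delta> c (w i))"
    have r: "r 0 = 0" "r (Suc i) = \<delta> (r i) (w i)" for i by (simp_all add: r_def)
    have le: "r i \<le> m" for i by (induction i) (auto simp: r \<delta>_def)
    have up: "\<exists>j\<ge>i. r j = m" for i
    proof (induction "m - r i" arbitrary: i rule: less_induct)
      case less
      show ?case
      proof (cases "r i = m")
        case False
        then have "r i < m" using le[of i] by simp
        then obtain j0 where j0: "j0 > i" "P (r i) (w j0)" using w(2) unfolding INFM_nat by blast
        define j where "j = (LEAST j. i \<le> j \<and> P (r i) (w j))"
        have ex: "\<exists>j. i \<le> j \<and> P (r i) (w j)" using j0 by (intro exI[of _ j0]) simp
        have j: "i \<le> j" "P (r i) (w j)" using LeastI_ex[OF ex] by (auto simp: j_def)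
        have before: "\<not> P (r i) (w j')" if "i \<le> j'" "j' < j" for j'
          using not_less_Least[of j' "\<lambda>j. i \<le> j \<and> P (r i) (w j)"] that by (auto simp: j_def)
        have stay: "i + d \<le> j \<Longrightarrow> r (i + d) = r i" for d
        proof (induction d)
          case (Suc d)
          then show ?case using before[of "i + d"] \<open>r i < m\<close> by (simp add: r \<delta>_def)
        qed simp
        have "r j = r i" using stay[of "j - i"] j(1) by simp
        then have "r (Suc j) = Suc (r i)" using j(2) \<open>r i < m\<close> by (simp add: r \<delta>_def)
        then have "m - r (Suc j) < m - r i" using \<open>r i < m\<close> by simp
        then obtain j' where "j' \<ge> Suc j" "r j' = m"
          using less by blast
        then show ?thesis using j(1) by (intro exI[of _ j']) simp
      qed auto
    qed
    have "\<exists>\<^sub>\<infinity>i. r i \<in> ba_accepting A"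
      unfolding INFM_nat_le using up by (auto simp: A_def)
    then show "w \<in> buchi_language A"
      unfolding buchi_language_def using w(1) le
      by (auto simp: A_def r intro!: exI[of _ r])
  qed
  then show ?thesis using omega_regular_buchi_language[OF A] by simp
qed

lemma omega_regular_eventually:
  assumes "finite \<Sigma>"
  shows "omega_regular {w. range w \<subseteq> \<Sigma> \<and> (\<exists>n. \<forall>i\<ge>n. P (w i))}"
proof -
  define A where "A = \<lparr>ba_alphabet = \<Sigma>, ba_states = UNIV, ba_initial = {False},
    ba_trans = {(b, a, c). a \<in> \<Sigma> \<and> (b \<longrightarrow> c \<and> P a)}, ba_accepting = {True}\<rparr>"
  have A: "buchi_automaton A"
    using assms by (auto simp: buchi_automaton_def A_def)
  have "buchi_language A = {w. range w \<subseteq> \<Sigma> \<and> (\<exists>n. \<forall>i\<ge>n. P (w i))}" (is "_ = ?R")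
  proof (intro equalityI subsetI)
    fix w assume "w \<in> buchi_language A"
    then obtain r where r: "\<And>i. w i \<in> \<Sigma> \<and> (r i \<longrightarrow> r (Suc i) \<and> P (w i))" "\<exists>\<^sub>\<infinity>i. r i"
      by (auto simp: buchi_language_def A_def)
    obtain n where n: "r n" using INFM_EX[OF r(2)] by blast
    have "r (n + d)" for d by (induction d) (use n r(1) in auto)
    then have "P (w i)" if "n \<le> i" for i using r(1)[of i] that by (metis le_add_diff_inverse)
    then show "w \<in> ?R" using r(1) by auto
  next
    fix w assume "w \<in> ?R"
    then obtain n where n: "range w \<subseteq> \<Sigma>" "\<And>i. n \<le> i \<Longrightarrow> P (w i)" by blast
    have "\<exists>\<^sub>\<infinity>i. n < i"
      unfolding INFM_nat by (metis less_add_Suc1 less_add_Suc2)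
    then show "w \<in> buchi_language A"
      using n by (auto simp: buchi_language_def A_def intro!: exI[of _ "\<lambda>i. n < i"])
  qed
  then show ?thesis using omega_regular_buchi_language[OF A] by simp
qed

section \<open>Languages in LANG-star\<close>

text \<open>While \<open>c\<close> is at least as long as \<open>a\<close>, it starts with
  \<open>a\<close> and the rest still commutes with \<open>a\<close>; what finally remains is a
  prefix of \<open>a\<close>.\<close>

lemma commuting_nth:
  assumes "c @ a = a @ c" "a \<noteq> []" "p < length c"
  shows "c ! p = a\<^sup>\<omega> p"
  using assms(1,3)
proof (induction c arbitrary: p rule: length_induct)
  case (1 c)
  show ?case
  proof (cases "length c < length a")
    case True
    then have "c = take (length c) a"
      using 1(2) by (metis append_eq_append_conv_if less_imp_le_nat)
    then show ?thesis using True 1(3) assms(2) by (metis iter_nth length_greater_0_conv mod_less nth_take order.strict_trans)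
  next
    case False
    then obtain c' where c': "c = a @ c'"
      using 1(2) by (metis append_eq_append_conv_if append_take_drop_id not_less)
    show ?thesis
    proof (cases "p < length a")
      case True
      then show ?thesis using c' assms(2) by (simp add: nth_append)
    next
      case False
      have "c' ! (p - length a) = a\<^sup>\<omega> (p - length a)"
        using 1 c' assms(2) False by (intro 1(1)[rule_format]) auto
      then show ?thesis
        using c' False assms(2) by (simp add: nth_append le_mod_geq not_less)
    qed
  qed
qed

text \<open>Every finite product of the factors commutes with \<open>a\<close>, hence is a prefix of
  \<open>a\<^sup>\<omega>\<close>, and the products become arbitrarily long.\<close>

lemma omega_power_commuting:
  assumes V: "[] \<notin> V" "a \<in> V" "\<And>v. v \<in> V \<Longrightarrow> v @ a = a @ v" and w: "w \<in> omega_power V"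
  shows "w = a\<^sup>\<omega>"
proof
  fix p
  obtain v where v: "\<And>i. v i \<in> V"
    "\<And>n. prefix (length (concat (map v [0..<n]))) w = concat (map v [0..<n])"
    using w by (auto simp: omega_power_def)
  let ?c = "\<lambda>n. concat (map v [0..<n])"
  have "?c n @ a = a @ ?c n" for n
  proof (induction n)
    case (Suc n)
    have "?c n @ v n @ a = a @ ?c n @ v n"
      using Suc V(3)[OF v(1), of n] by (metis append_assoc)
    then show ?case by simp
  qed simp
  moreover have "n \<le> length (?c n)" for n
  proof (induction n)
    case (Suc n)
    have "v n \<noteq> []" using v(1) V(1) by metis
    then have "0 < length (v n)" by simp
    moreover have "length (?c (Suc n)) = length (?c n) + length (v n)" by simp
    ultimately show ?case using Suc by linarith
  qed simp
  then have "p < length (?c (Suc p))" by (metis Suc_le_eq)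
  moreover have "w p = ?c (Suc p) ! p"
    using v(2)[of "Suc p"] calculation(2) by (metis diff_zero add_0 subsequence_nth)
  ultimately show "w p = a\<^sup>\<omega> p"
    using commuting_nth V(1,2) by metis
qed

text \<open>Only \<open>length u\<close> modulo \<open>length a\<close> matters, so for fixed
  \<open>a\<close> the words \<open>u a\<^sup>\<omega>\<close> fall into at most
  \<open>length a\<close> end classes. The offset is written as
  \<open>length a - length u mod length a\<close> to stay within the natural numbers.\<close>

lemma end_equal_conc_iter:
  assumes "a \<noteq> []"
  shows "end_equal (u \<frown> a\<^sup>\<omega>) (\<lambda>p. a ! ((p + (length a - length u mod length a)) mod length a))"
  unfolding end_equal_def
proof (intro exI allI impI)
  fix p assume p: "length u \<le> p"
  let ?m = "length a"
  have m: "0 < ?m" using assms by simp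
  have "p + (?m - length u mod ?m) = (p - length u) + (length u div ?m + 1) * ?m"
  proof -
    have "length u div ?m * ?m + length u mod ?m = length u" by simp
    moreover have "length u mod ?m < ?m" using m by simp
    moreover have "(length u div ?m + 1) * ?m = length u div ?m * ?m + ?m" by simp
    ultimately show ?thesis using p by linarith
  qed
  then have "(p + (?m - length u mod ?m)) mod ?m = (p - length u) mod ?m"
    by (simp only: mod_mult_self1)
  then show "(u \<frown> a\<^sup>\<omega>) p = a ! ((p + (?m - length u mod ?m)) mod ?m)"
    using p assms by simp
qed

text \<open>Both \<open>a @ b\<close> and \<open>b @ a\<close> have length \<open>m\<close>, so the
  choice in each block can be varied independently at fixed positions.\<close>

lemma omega_power_two:
  assumes a: "a \<in> V" and b: "b \<in> V"
  defines "m \<equiv> length a + length b"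
  assumes m: "0 < m"
  shows "(\<lambda>p. (if p div m \<in> S then a @ b else b @ a) ! (p mod m)) \<in> omega_power V"
proof -
  define blk where "blk j = (if j \<in> S then a @ b else b @ a)" for j
  define w where "w p = blk (p div m) ! (p mod m)" for p
  \<comment> \<open>Block \<open>i div 2\<close> owns two factors: the parity of \<open>i\<close>
    selects the first or the second, and membership in \<open>S\<close> determines their
    order.\<close>
  define v where "v i = (if (i div 2 \<in> S) = even i then a else b)" for i
  let ?c = "\<lambda>n. concat (map v [0..<n])"
  have len: "length (blk j) = m" for j by (simp add: blk_def m_def)
  have v_blk: "v (2 * j) @ v (Suc (2 * j)) = blk j" for j
    by (simp add: v_def blk_def)
  have c2: "?c (2 * n) = concat (map blk [0..<n])" for n
  proof (induction n)
    case (Suc n)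
    have "?c (2 * Suc n) = ?c (2 * n) @ v (2 * n) @ v (Suc (2 * n))" by simp
    then show ?case using Suc v_blk by simp
  qed simp
  have blocks: "prefix (n * m) w = concat (map blk [0..<n])" for n
  proof (induction n)
    case (Suc n)
    have "prefix (Suc n * m) w = prefix (n * m) w @ subsequence w (n * m) (Suc n * m)"
      by (rule subsequence_split) simp_all
    moreover have "subsequence w (n * m) (Suc n * m) = blk n"
      by (rule nth_equalityI) (use m in \<open>simp_all add: len w_def\<close>)
    ultimately show ?case using Suc by simp
  qed simp
  have len_c2: "length (?c (2 * n)) = n * m" for n
    using arg_cong[OF blocks[of n], of length] by (simp add: c2)
  have "prefix (length (?c n)) w = ?c n" for n
  proof -
    have split: "?c (2 * n) = ?c n @ concat (map v [n..<2 * n])"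
      by (simp flip: concat_append map_append upt_add_eq_append[of 0 n n] add: mult_2)
    have "prefix (length (?c n)) w = take (length (?c n)) (prefix (n * m) w)"
      using len_c2[of n] arg_cong[OF split, of length] by (simp add: min_def)
    then show ?thesis unfolding blocks c2[symmetric] split by simp
  qed
  then have "w \<in> omega_power V"
    using a b unfolding omega_power_def by (auto simp: v_def intro!: exI[of _ v])
  then show ?thesis by (simp add: w_def[abs_def] blk_def)
qed

lemma uncountable_nat_sets: "\<not> countable (UNIV :: nat set set)"
proof
  assume "countable (UNIV :: nat set set)"
  then have "range (from_nat_into (UNIV :: nat set set)) = Pow UNIV"
    by (simp add: range_from_nat_into)
  then show False using Cantors_theorem by blast
qed

definition spread :: "nat set \<Rightarrow> nat set" where
  "spread S = {prod_encode (a, b) | a b. a \<in> S}"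

lemma spread_mem: "prod_encode (a, b) \<in> spread S \<longleftrightarrow> a \<in> S"
  by (auto simp: spread_def)

text \<open>Every element is spread to infinitely many places, so it is visible in every tail.\<close>

lemma inj_spread_end_equal:
  assumes len: "length (blk True) = m" "length (blk False) = m" and diff: "blk True \<noteq> blk False"
    and eq: "end_equal (u \<frown> (\<lambda>p. blk (p div m \<in> spread S) ! (p mod m)))
      (u \<frown> (\<lambda>p. blk (p div m \<in> spread T) ! (p mod m)))"
  shows "S = T"
proof -
  obtain n where n: "\<And>p. n \<le> p \<Longrightarrow> (u \<frown> (\<lambda>p. blk (p div m \<in> spread S) ! (p mod m))) p =
      (u \<frown> (\<lambda>p. blk (p div m \<in> spread T) ! (p mod m))) p"
    using eq by (auto simp: end_equal_def)
  obtain q where q: "q < m" "blk True ! q \<noteq> blk False ! q"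
    using len diff by (metis nth_equalityI)
  have "a \<in> S \<longleftrightarrow> a \<in> T" for a
  proof -
    let ?j = "prod_encode (a, n)"
    have "n \<le> ?j" by (rule le_prod_encode_2)
    also have "?j * 1 \<le> ?j * m" using q(1) by (intro mult_le_mono2) simp
    finally have "n \<le> length u + (?j * m + q)" by simp
    from n[OF this] have "blk (?j \<in> spread S) ! q = blk (?j \<in> spread T) ! q"
      using q(1) by simp
    then show ?thesis using q(2) unfolding spread_mem by (metis (full_types))
  qed
  then show ?thesis by blast
qed

text \<open>One of the finitely many terms of the union meets infinitely many classes. If all its
  factors commuted with one fixed \<open>a\<close>, a residue modulo \<open>length a\<close> would
  determine the end class. So some \<open>b\<close> gives distinct blocks \<open>a @ b\<close> and
  \<open>b @ a\<close> of equal length, which encode any set of numbers in the tail.\<close>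

lemma LANG_star_end_classes:
  assumes H: "LANG_star H" and h: "\<And>x y. h x = h y \<longleftrightarrow> end_equal x y" and inf: "infinite (h ` H)"
  shows "\<not> countable (h ` H)"
proof -
  obtain \<Sigma> n U V where H_eq: "H = (\<Union>i\<in>{1..n::nat}. {u \<frown> w | u w. u \<in> U i \<and> w \<in> omega_power (V i)})"
    and V: "\<And>i. i \<in> {1..n} \<Longrightarrow> V i \<subseteq> lists \<Sigma> - {[]}"
    using H unfolding LANG_star_def by blast
  have "\<exists>i\<in>{1..n}. infinite (h ` {u \<frown> w | u w. u \<in> U i \<and> w \<in> omega_power (V i)})"
  proof (rule ccontr)
    assume "\<not> ?thesis"
    then have "finite (h ` H)" unfolding H_eq image_UN by (intro finite_UN_I) auto
    with inf show False ..
  qed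
  then obtain i where i: "i \<in> {1..n}" "infinite (h ` {u \<frown> w | u w. u \<in> U i \<and> w \<in> omega_power (V i)})"
    by (elim bexE)
  have nonempty: "[] \<notin> V i" using V[OF i(1)] by blast
  obtain u w where u: "u \<in> U i" and "w \<in> omega_power (V i)"
    using infinite_imp_nonempty[OF i(2)] by blast
  then obtain a where a: "a \<in> V i" by (auto simp: omega_power_def)
  then have "a \<noteq> []" using nonempty by blast
  have "\<exists>b\<in>V i. b @ a \<noteq> a @ b"
  proof (rule ccontr)
    assume "\<not> ?thesis"
    then have *: "w = a\<^sup>\<omega>" if "w \<in> omega_power (V i)" for w
      using omega_power_commuting[OF nonempty a _ that] by blast
    let ?f = "\<lambda>r p. a ! ((p + (length a - r)) mod length a)"
    have "h ` {u \<frown> w | u w. u \<in> U i \<and> w \<in> omega_power (V i)} \<subseteq> (\<lambda>r. h (?f r)) ` {..<length a}"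
    proof
      fix y assume "y \<in> h ` {u \<frown> w | u w. u \<in> U i \<and> w \<in> omega_power (V i)}"
      then obtain u where "y = h (u \<frown> a\<^sup>\<omega>)" using * by auto
      also have "\<dots> = h (?f (length u mod length a))"
        unfolding h by (rule end_equal_conc_iter[OF \<open>a \<noteq> []\<close>])
      finally show "y \<in> (\<lambda>r. h (?f r)) ` {..<length a}"
        using \<open>a \<noteq> []\<close> by (intro image_eqI[of _ _ "length u mod length a"]) auto
    qed
    then show False using i(2) finite_subset by blast
  qed
  then obtain b where b: "b \<in> V i" "b @ a \<noteq> a @ b" by blast
  define m where "m = length a + length b"
  define blk where "blk c = (if c then a @ b else b @ a)" for c
  define W where "W S = u \<frown> (\<lambda>p. blk (p div m \<in> spread S) ! (p mod m))" for S
  have "W S \<in> H" for S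
  proof -
    have "(\<lambda>p. blk (p div m \<in> spread S) ! (p mod m)) \<in> omega_power (V i)"
      using omega_power_two[OF a b(1), of "spread S"] \<open>a \<noteq> []\<close> by (simp add: m_def blk_def)
    then show ?thesis using i(1) u unfolding H_eq W_def by blast
  qed
  then have "range (\<lambda>S. h (W S)) \<subseteq> h ` H" by blast
  moreover have "inj (\<lambda>S. h (W S))"
  proof (rule injI)
    fix S T assume "h (W S) = h (W T)"
    then show "S = T"
      unfolding h W_def by (rule inj_spread_end_equal[rotated 3]) (use b(2) in \<open>auto simp: blk_def m_def\<close>)
  qed
  ultimately show ?thesis
    using uncountable_nat_sets by (metis countable_image_inj_on countable_subset)
qed

section \<open>Cutting accepting runs into LANG-star form\<close>

text \<open>Cut positions replace explicit factors. The indices \<open>\<kappa>\<close> will be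
  accepting states, or pairs of a state and a stack symbol. Empty words and foreign letters cannot
  arise from such cuts and are removed from \<open>U\<close> and \<open>V\<close> inside the
  proof.\<close>

lemma LANG_star_I:
  assumes "finite \<Sigma>" "finite K"
    and H: "H = {w. range w \<subseteq> \<Sigma> \<and> (\<exists>\<kappa>\<in>K. \<exists>f. strict_mono f \<and> 0 < f 0 \<and>
      prefix (f 0) w \<in> U \<kappa> \<and> (\<forall>i. subsequence w (f i) (f (Suc i)) \<in> V \<kappa>))}"
  shows "LANG_star H"
proof -
  obtain g where g: "bij_betw g {1..card K} K"
    using ex_bij_betw_nat_finite_1[OF \<open>finite K\<close>] by blast
  define U' V' where "U' i = (U (g i) - {[]}) \<inter> lists \<Sigma>" and "V' i = (V (g i) - {[]}) \<inter> lists \<Sigma>" for i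
  have "H = (\<Union>i\<in>{1..card K}. {u \<frown> w | u w. u \<in> U' i \<and> w \<in> omega_power (V' i)})"
  proof (intro equalityI subsetI)
    fix w assume "w \<in> H"
    then obtain \<kappa> f where w: "range w \<subseteq> \<Sigma>" "\<kappa> \<in> K" "strict_mono f" "0 < f 0"
      "prefix (f 0) w \<in> U \<kappa>" "\<And>i. subsequence w (f i) (f (Suc i)) \<in> V \<kappa>"
      unfolding H by blast
    obtain i where i: "i \<in> {1..card K}" "g i = \<kappa>"
      using g w(2) by (metis bij_betw_imp_surj_on imageE)
    have lists: "subsequence w j j' \<in> lists \<Sigma>" for j j' using w(1) by (auto simp: image_subset_iff)
    let ?v = "\<lambda>i. subsequence w (f i) (f (Suc i))"
    have less: "f i < f (Suc i)" for i using w(3) by (simp add: strict_monoD)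
    have "?v j \<in> V' i" for j
      using w(6) lists less[of j] i by (simp add: V'_def del: in_lists_conv_set)
    moreover have "concat (map ?v [0..<n]) = subsequence w (f 0) (f n)" for n
    proof (induction n)
      case (Suc n)
      have "f 0 \<le> f n" using w(3) by (simp add: strict_mono_less_eq)
      then show ?case using Suc subsequence_split[of "f 0" "f n" "f (Suc n)" w] less[of n] by simp
    qed simp
    then have "prefix (length (concat (map ?v [0..<n]))) (suffix (f 0) w) = concat (map ?v [0..<n])" for n
      using w(3) by (simp add: strict_mono_less_eq)
    ultimately have "suffix (f 0) w \<in> omega_power (V' i)"
      unfolding omega_power_def by (intro CollectI exI[of _ ?v]) blast
    moreover have "prefix (f 0) w \<in> U' i"
      using w(4,5) lists i by (simp add: U'_def del: in_lists_conv_set)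
    ultimately show "w \<in> (\<Union>i\<in>{1..card K}. {u \<frown> w | u w. u \<in> U' i \<and> w \<in> omega_power (V' i)})"
      using i(1) prefix_suffix[of w "f 0"] by blast
  next
    fix w assume "w \<in> (\<Union>i\<in>{1..card K}. {u \<frown> w | u w. u \<in> U' i \<and> w \<in> omega_power (V' i)})"
    then obtain i u x where i: "i \<in> {1..card K}" "w = u \<frown> x" "u \<in> U' i" "x \<in> omega_power (V' i)"
      by blast
    obtain v where v: "\<And>j. v j \<in> V' i"
      "\<And>n. prefix (length (concat (map v [0..<n]))) x = concat (map v [0..<n])"
      using i(4) by (auto simp: omega_power_def)
    define c where "c n = concat (map v [0..<n])" for n
    define f where "f n = length u + length (c n)" for n
    have c_Suc: "c (Suc n) = c n @ v n" for n by (simp add: c_def)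
    have "v j \<noteq> []" for j using v(1)[of j] by (auto simp: V'_def)
    then have f: "strict_mono f" by (simp add: strict_mono_Suc_iff f_def c_Suc)
    have f0: "f 0 = length u" "0 < f 0"
      using i(3) by (auto simp: f_def c_def U'_def)
    have pre: "prefix (f n) w = u @ c n" for n
      using v(2)[of n] i(2) by (simp add: f_def c_def)
    have sub: "subsequence w (f n) (f (Suc n)) = v n" for n
    proof -
      have "u @ c (Suc n) = (u @ c n) @ subsequence w (f n) (f (Suc n))"
        using subsequence_split[of 0 "f n" "f (Suc n)" w] strict_monoD[OF f, of n "Suc n"] pre by simp
      then show ?thesis by (simp add: c_Suc)
    qed
    have "w p \<in> \<Sigma>" for p
    proof -
      have "p < f (Suc p)" using strict_mono_imp_increasing[OF f, of "Suc p"] by simp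
      then have "w p \<in> set (prefix (f (Suc p)) w)" by simp
      also have "\<dots> \<subseteq> \<Sigma>"
        unfolding pre using i(3) v(1) by (auto simp: U'_def V'_def c_def)
      finally show ?thesis .
    qed
    moreover have "prefix (f 0) w \<in> U (g i)"
      using pre[of 0] i(3) by (simp add: c_def U'_def)
    moreover have "subsequence w (f n) (f (Suc n)) \<in> V (g i)" for n
      unfolding sub using v(1) by (simp add: V'_def)
    moreover have "g i \<in> K" using g i(1) by (rule bij_betwE[rule_format])
    ultimately show "w \<in> H"
      unfolding H using f f0(2) by blast
  qed
  then show ?thesis
    unfolding LANG_star_def using assms(1)
    by (intro exI[of _ \<Sigma>] exI[of _ "card K"] exI[of _ U'] exI[of _ V']) (auto simp: U'_def V'_def)
qed

lemma ex_recurring: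
  fixes f :: "nat \<Rightarrow> 'c"
  assumes "finite C" "\<exists>\<^sub>\<infinity>i. f i \<in> C"
  obtains q where "q \<in> C" "infinite {i. f i = q}"
proof -
  have "infinite {i. f i \<in> C}" using assms(2) by (simp add: frequently_cofinite)
  then obtain i where i: "f i \<in> C" "infinite {j \<in> {i. f i \<in> C}. f j = f i}"
    using pigeonhole_infinite[of "{i. f i \<in> C}" f] assms(1) by (auto simp: finite_subset[of _ C] image_subset_iff)
  then show thesis
    using that[of "f i"] infinite_super[of "{j \<in> {i. f i \<in> C}. f j = f i}" "{j. f j = f i}"] by auto
qed

text \<open>An accepting run meets some accepting state \<open>q\<close> infinitely often; cut
  there, it consists of a path to \<open>q\<close> and loops at \<open>q\<close>. Conversely, such a
  path and such loops glue to a run that meets \<open>q\<close> at every cut.\<close>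

lemma omega_regular_LANG_star:
  assumes "omega_regular H"
  shows "LANG_star H"
proof -
  obtain A :: "(nat, 'a) buchi" where A: "buchi_automaton A" and H: "H = buchi_language A"
    using assms by (auto simp: omega_regular_def)
  have fin: "finite (ba_alphabet A)" "finite (ba_accepting A)"
    and states: "ba_accepting A \<subseteq> ba_states A" "ba_initial A \<subseteq> ba_states A"
    using A by (auto simp: buchi_automaton_def dest: finite_subset)
  have trans: "(p, a, q) \<in> ba_trans A \<Longrightarrow> a \<in> ba_alphabet A \<and> p \<in> ba_states A" for p a q
    using A by (auto simp: buchi_automaton_def)
  define U where "U q = {u. \<exists>p\<in>ba_initial A. \<exists>b. (p, b, q) \<in> profile A u}" for q
  define V where "V q = {v. \<exists>b. (q, b, q) \<in> profile A v}" for q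
  have run: "\<exists>b. (r i, b, r j) \<in> profile A (subsequence w i j)"
    if "\<And>i. (r i, w i, r (Suc i)) \<in> ba_trans A" "i \<le> j" for r w i j
    unfolding profile_iff_run[OF A]
    using that trans[OF that(1)[of i]] by (intro exI[of _ "\<lambda>j. r (i + j)"] exI) auto
  show ?thesis
  proof (rule LANG_star_I[OF fin])
    show "H = {w. range w \<subseteq> ba_alphabet A \<and> (\<exists>q\<in>ba_accepting A. \<exists>f. strict_mono f \<and> 0 < f 0 \<and>
      prefix (f 0) w \<in> U q \<and> (\<forall>i. subsequence w (f i) (f (Suc i)) \<in> V q))}" (is "_ = ?R")
    proof (intro equalityI subsetI)
      fix w assume "w \<in> H"
      then obtain r where r: "r 0 \<in> ba_initial A" "\<And>i. (r i, w i, r (Suc i)) \<in> ba_trans A"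
        "\<exists>\<^sub>\<infinity>i. r i \<in> ba_accepting A"
        by (auto simp: H buchi_language_def)
      obtain q where q: "q \<in> ba_accepting A" "infinite {i. r i = q}"
        using ex_recurring[OF fin(2) r(3)] by blast
      have inf: "infinite ({i. r i = q} - {0})" using q(2) by simp
      define f where "f = enumerate ({i. r i = q} - {0})"
      have f: "strict_mono f" "r (f i) = q" "0 < f i" for i
        using strict_mono_enumerate[OF inf] enumerate_in_set[OF inf, of i] by (auto simp: f_def)
      have "prefix (f 0) w \<in> U q"
        using run[of r w 0 "f 0"] r(2) r(1) f(2)[of 0] by (auto simp: U_def)
      moreover have "subsequence w (f i) (f (Suc i)) \<in> V q" for i
        using run[of r w "f i" "f (Suc i)"] r(2) f(2) strict_mono_less_eq[OF f(1), of i "Suc i"]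
        by (simp add: V_def)
      moreover have "range w \<subseteq> ba_alphabet A" using r(2) trans by blast
      ultimately show "w \<in> ?R" using q(1) f(1,3) by blast
    next
      fix w assume "w \<in> ?R"
      then obtain q f where q: "q \<in> ba_accepting A" and f: "strict_mono f" "0 < f 0"
        and u: "prefix (f 0) w \<in> U q" and v: "\<And>i. subsequence w (f i) (f (Suc i)) \<in> V q"
        by blast
      define g where "g i = (case i of 0 \<Rightarrow> 0 | Suc i \<Rightarrow> f i)" for i
      have g: "strict_mono g" "g 0 = 0"
        using f by (auto simp: g_def strict_mono_Suc_iff split: nat.splits)
      have g_less: "g i < g (Suc i)" for i using g(1) by (simp add: strict_monoD)
      obtain q0 where q0: "q0 \<in> ba_initial A" "\<exists>b. (q0, b, q) \<in> profile A (prefix (f 0) w)"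
        using u by (auto simp: U_def)
      define st where "st i = (case i of 0 \<Rightarrow> q0 | Suc i \<Rightarrow> q)" for i :: nat
      have "\<exists>b. (st i, b, st (Suc i)) \<in> profile A (subsequence w (g i) (g (Suc i)))" for i
        using q0(2) v by (cases i) (auto simp: st_def g_def V_def)
      then have "\<exists>\<rho>. \<rho> 0 = st i \<and> \<rho> (g (Suc i) - g i) = st (Suc i) \<and>
        (\<forall>j<g (Suc i) - g i. (\<rho> j, w (g i + j), \<rho> (Suc j)) \<in> ba_trans A)" for i
        unfolding profile_iff_run[OF A] by (metis subsequence_length subsequence_nth)
      then obtain \<rho> where \<rho>: "\<And>i. \<rho> i 0 = st i" "\<And>i. \<rho> i (g (Suc i) - g i) = st (Suc i)"
        "\<And>i j. j < g (Suc i) - g i \<Longrightarrow> (\<rho> i j, w (g i + j), \<rho> i (Suc j)) \<in> ba_trans A"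
        by metis
      obtain r where r: "\<And>i j. j \<le> g (Suc i) - g i \<Longrightarrow> r (g i + j) = \<rho> i j"
        using ex_concatenation[OF g, of \<rho>] \<rho>(1,2) by metis
      have r_g: "r (g i) = st i" for i using r[of 0 i] \<rho>(1) by simp
      have "(r n, w n, r (Suc n)) \<in> ba_trans A" for n
      proof -
        obtain i where i: "g i \<le> n" "n < g (Suc i)"
          using strict_mono_interval[OF g(1), of n] g(2) by auto
        show ?thesis
          using \<rho>(3)[of "n - g i" i] r[of "n - g i" i] r[of "Suc (n - g i)" i] i by simp
      qed
      moreover have "r 0 \<in> ba_initial A" using r_g[of 0] g(2) q0(1) by (simp add: st_def)
      moreover have "\<exists>\<^sub>\<infinity>i. r i \<in> ba_accepting A"
        unfolding INFM_nat
      proof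
        fix m
        have "m < g (Suc m)" using strict_mono_imp_increasing[OF g(1), of "Suc m"] by simp
        then show "\<exists>n>m. r n \<in> ba_accepting A"
          using r_g[of "Suc m"] q by (auto simp: st_def)
      qed
      ultimately show "w \<in> H" by (auto simp: H buchi_language_def)
    qed
  qed
qed

section \<open>Pushdown runs above an untouched part of the stack\<close>

lemma pda_step_shift:
  assumes "pda_step P w (q, i, \<gamma>) (q', j, \<gamma>')" "i < j \<Longrightarrow> w' (d + i) = w i"
  shows "pda_step P w' (q, d + i, \<gamma> @ \<delta>) (q', d + j, \<gamma>' @ \<delta>)"
  using assms(1)
proof cases
  case (silent X \<eta> \<beta>)
  then show ?thesis using pda_step.silent[of q X q' \<eta> P w' "d + i" "\<beta> @ \<delta>"] by simp
next
  case (read X \<eta> \<beta>)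
  then show ?thesis using pda_step.read[of q w' "d + i" X q' \<eta> P "\<beta> @ \<delta>"] assms(2) by simp
qed

text \<open>As \<open>\<gamma>\<close> is nonempty, the step rewrites its first symbol and leaves
  \<open>\<delta>\<close> alone.\<close>

lemma pda_step_unshift:
  assumes "pda_step P w (q, d + i, \<gamma> @ \<delta>) (q', j, \<eta>)" "\<gamma> \<noteq> []"
  obtains \<gamma>' j' where "\<eta> = \<gamma>' @ \<delta>" "j = d + j'" "pda_step P (suffix d w) (q, i, \<gamma>) (q', j', \<gamma>')"
  using assms(1)
proof cases
  case (silent X \<zeta> \<beta>)
  then obtain \<beta>' where "\<gamma> = X # \<beta>'" "\<beta> = \<beta>' @ \<delta>" using assms(2) by (cases \<gamma>) auto
  then show thesis
    using silent that[of "\<zeta> @ \<beta>'" i] pda_step.silent[of q X q' \<zeta> P "suffix d w" i \<beta>'] by simp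
next
  case (read X \<zeta> \<beta>)
  then obtain \<beta>' where "\<gamma> = X # \<beta>'" "\<beta> = \<beta>' @ \<delta>" using assms(2) by (cases \<gamma>) auto
  then show thesis
    using read that[of "\<zeta> @ \<beta>'" "Suc i"] pda_step.read[of q "suffix d w" i X q' \<zeta> P \<beta>'] by simp
qed

lemma pda_step_position:
  assumes "pda_step P w c c'"
  shows "fst (snd c') = fst (snd c) \<or> fst (snd c') = Suc (fst (snd c))"
  using assms by cases auto

lemma pda_step_nonempty: "pda_step P w c c' \<Longrightarrow> snd (snd c) \<noteq> []"
  by (cases rule: pda_step.cases) auto

definition pda_run :: "('q, 'a, 's) pda \<Rightarrow> 'a word \<Rightarrow> (nat \<Rightarrow> 'q \<times> nat \<times> 's list) \<Rightarrow> nat \<Rightarrow> bool" where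
  "pda_run P w c m \<longleftrightarrow> (\<forall>n<m. pda_step P w (c n) (c (Suc n)))"

lemma pda_run_position_mono:
  assumes "pda_run P w c m" "n \<le> n'" "n' \<le> m"
  shows "fst (snd (c n)) \<le> fst (snd (c n'))"
  using assms(2,3)
proof (induction n' rule: dec_induct)
  case (step n')
  then have "pda_step P w (c n') (c (Suc n'))" using assms(1) by (simp add: pda_run_def)
  from pda_step_position[OF this] step show ?case by auto
qed simp

definition pda_shift :: "nat \<Rightarrow> 's list \<Rightarrow> 'q \<times> nat \<times> 's list \<Rightarrow> 'q \<times> nat \<times> 's list" where
  "pda_shift d \<delta> c = (fst c, d + fst (snd c), snd (snd c) @ \<delta>)"

lemma pda_run_shift:
  assumes "pda_run P w c m" "\<And>p. p < fst (snd (c m)) \<Longrightarrow> w' (d + p) = w p"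
  shows "pda_run P w' (\<lambda>n. pda_shift d \<delta> (c n)) m"
  unfolding pda_run_def pda_shift_def
proof (intro allI impI)
  fix n assume n: "n < m"
  then have "pda_step P w (fst (c n), fst (snd (c n)), snd (snd (c n)))
      (fst (c (Suc n)), fst (snd (c (Suc n))), snd (snd (c (Suc n))))"
    using assms(1) by (simp add: pda_run_def)
  then show "pda_step P w' (fst (c n), d + fst (snd (c n)), snd (snd (c n)) @ \<delta>)
      (fst (c (Suc n)), d + fst (snd (c (Suc n))), snd (snd (c (Suc n))) @ \<delta>)"
  proof (rule pda_step_shift)
    assume "fst (snd (c n)) < fst (snd (c (Suc n)))"
    also have "\<dots> \<le> fst (snd (c m))" using pda_run_position_mono[OF assms(1), of "Suc n" m] n by simp
    finally show "w' (d + fst (snd (c n))) = w (fst (snd (c n)))" by (rule assms(2))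
  qed
qed

text \<open>A run that never goes below the height of \<open>\<delta>\<close> does not depend on \<open>\<delta>\<close>.\<close>

lemma pda_run_unshift:
  assumes c: "pda_run P w c m" "c 0 = (q, d, \<gamma> @ \<delta>)" "\<gamma> \<noteq> []"
    and height: "\<And>n. n \<le> m \<Longrightarrow> length \<delta> < length (snd (snd (c n)))"
  obtains c' where "pda_run P (suffix d w) c' m" "\<And>n. n \<le> m \<Longrightarrow> c n = pda_shift d \<delta> (c' n)"
proof -
  have *: "\<exists>p j \<eta>. c n = (p, d + j, \<eta> @ \<delta>)" if "n \<le> m" for n
    using that
  proof (induction n)
    case 0
    then show ?case using c(2) by (intro exI[of _ q] exI[of _ 0] exI[of _ \<gamma>]) simp
  next
    case (Suc n)
    then obtain p j \<eta> where n: "c n = (p, d + j, \<eta> @ \<delta>)" by auto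
    then have "\<eta> \<noteq> []" using height[of n] Suc.prems by auto
    obtain p' k \<zeta> where Suc_n: "c (Suc n) = (p', k, \<zeta>)" by (rule prod_cases3)
    have "pda_step P w (p, d + j, \<eta> @ \<delta>) (p', k, \<zeta>)"
      using c(1) Suc.prems n Suc_n by (metis Suc_le_eq pda_run_def)
    then obtain \<zeta>' j' where "\<zeta> = \<zeta>' @ \<delta>" "k = d + j'"
      using \<open>\<eta> \<noteq> []\<close> by (rule pda_step_unshift)
    then show ?case using Suc_n by simp
  qed
  define c' where "c' n = (fst (c n), fst (snd (c n)) - d,
    take (length (snd (snd (c n))) - length \<delta>) (snd (snd (c n))))" for n
  have c': "c n = pda_shift d \<delta> (c' n)" if "n \<le> m" for n
    using *[OF that] by (auto simp: c'_def pda_shift_def)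
  have "pda_step P (suffix d w) (c' n) (c' (Suc n))" if n: "n < m" for n
  proof -
    have "pda_step P w (c n) (c (Suc n))" using c(1) n by (simp add: pda_run_def)
    then have step: "pda_step P w (fst (c' n), d + fst (snd (c' n)), snd (snd (c' n)) @ \<delta>)
        (fst (c' (Suc n)), d + fst (snd (c' (Suc n))), snd (snd (c' (Suc n))) @ \<delta>)"
      using c'[of n] c'[of "Suc n"] n by (simp add: pda_shift_def)
    have "snd (snd (c' n)) \<noteq> []"
      using height[of n] c'[of n] n by (auto simp: pda_shift_def)
    from pda_step_unshift[OF step this] show ?thesis by (metis add_left_cancel append_same_eq prod.collapse)
  qed
  then show thesis using that[of c'] c' by (simp add: pda_run_def)
qed

lemma omega_context_free_LANG_star:
  assumes "omega_context_free H"
  shows "LANG_star H"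
proof -
  obtain P :: "(nat, 'a, nat) pda" where P: "pushdown_automaton P" and H: "H = pda_language P"
    using assms by (auto simp: omega_context_free_def)
  let ?F = "pda_accepting P" and ?pos = "\<lambda>c :: nat \<times> nat \<times> nat list. fst (snd c)"
    and ?ht = "\<lambda>c :: nat \<times> nat \<times> nat list. length (snd (snd c))"
  let ?K = "pda_states P \<times> pda_stack P"
  have fin: "finite (pda_alphabet P)" "finite ?K"
    using P by (auto simp: pushdown_automaton_def)
  \<comment> \<open>Configurations refer to an infinite input, so some \<open>w\<close> extending
    \<open>u\<close> is quantified; a run that stops at position \<open>length u\<close> depends on
    no more of it.\<close>
  define U where "U = (\<lambda>(q, X). {u. \<exists>w c m \<beta>. pda_run P w c m \<and> prefix (length u) w = u \<and>
    c 0 = (pda_initial P, 0, [pda_bottom P]) \<and> c m = (q, length u, X # \<beta>)})"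
  define V where "V = (\<lambda>(q, X). {v. \<exists>w c m \<beta>. pda_run P w c m \<and> prefix (length v) w = v \<and>
    c 0 = (q, 0, [X]) \<and> c m = (q, length v, X # \<beta>) \<and> (\<exists>n. 0 < n \<and> n \<le> m \<and> fst (c n) \<in> ?F)})"
  show ?thesis
  proof (rule LANG_star_I[OF fin])
    show "H = {w. range w \<subseteq> pda_alphabet P \<and> (\<exists>\<kappa>\<in>?K. \<exists>f. strict_mono f \<and> 0 < f 0 \<and>
      prefix (f 0) w \<in> U \<kappa> \<and> (\<forall>i. subsequence w (f i) (f (Suc i)) \<in> V \<kappa>))}" (is "_ = ?R")
    proof (intro equalityI subsetI)
      fix w assume "w \<in> H"
      then obtain c where c: "c 0 = (pda_initial P, 0, [pda_bottom P])"
        "\<And>n. pda_step P w (c n) (c (Suc n))" "\<And>i. \<exists>n. i \<le> ?pos (c n)" "\<exists>\<^sub>\<infinity>n. fst (c n) \<in> ?F"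
        unfolding H pda_language_def by blast
      have run: "pda_run P w (\<lambda>j. c (n + j)) m" for n m
        using c(2) by (simp add: pda_run_def)
      have pos_mono: "?pos (c n) \<le> ?pos (c n')" if "n \<le> n'" for n n'
        using pda_run_position_mono[OF run[of 0 n'], of n n'] that by simp
      have "w p \<in> pda_alphabet P" for p
      proof -
        obtain n where n: "Suc p \<le> ?pos (c n)" "\<And>n'. n' < n \<Longrightarrow> \<not> Suc p \<le> ?pos (c n')"
          using c(3)[of "Suc p"] exists_least_iff[of "\<lambda>n. Suc p \<le> ?pos (c n)"] by blast
        then obtain n' where n': "n = Suc n'" using c(1) by (cases n) auto
        from c(2)[of n'] show ?thesis
        proof cases
          case (silent q X q' \<gamma> i \<beta>)
          then show ?thesis using n(1) n(2)[of n'] n' by simp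
        next
          case (read q i X q' \<gamma> \<beta>)
          then have "i = p" using n(1) n(2)[of n'] n' by simp
          then show ?thesis using read(3) P by (auto simp: pushdown_automaton_def)
        qed
      qed
      then have range: "range w \<subseteq> pda_alphabet P" by blast
      have mem: "fst (c n) \<in> pda_states P \<and> set (snd (snd (c n))) \<subseteq> pda_stack P" for n
      proof (induction n)
        case 0
        then show ?case using c(1) P by (simp add: pushdown_automaton_def)
      next
        case (Suc n)
        from c(2)[of n] show ?case
          by cases (use Suc P in \<open>force simp: pushdown_automaton_def\<close>)+
      qed
      have ne: "snd (snd (c n)) \<noteq> []" for n using pda_step_nonempty[OF c(2)] .
      define stair where "stair n \<longleftrightarrow> (\<forall>m\<ge>n. ?ht (c n) \<le> ?ht (c m))" for n
      define \<kappa>s where "\<kappa>s n = (fst (c n), hd (snd (snd (c n))))" for n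
      \<comment> \<open>A time of least height among those from \<open>N\<close> on is a
        stair.\<close>
      have "\<exists>n\<ge>N. stair n" for N
      proof -
        obtain n where "N \<le> n" "\<And>m. N \<le> m \<Longrightarrow> ?ht (c n) \<le> ?ht (c m)"
          using ex_has_least_nat[of "\<lambda>n. N \<le> n" N "\<lambda>n. ?ht (c n)"] by auto
        then show ?thesis by (auto simp: stair_def)
      qed
      then have "infinite {n. stair n}" by (auto simp: infinite_nat_iff_unbounded_le)
      moreover have "\<kappa>s ` {n. stair n} \<subseteq> ?K"
        using mem ne hd_in_set by (fastforce simp: \<kappa>s_def)
      ultimately obtain n0 where "infinite {n \<in> {n. stair n}. \<kappa>s n = \<kappa>s n0}"
        using pigeonhole_infinite[of "{n. stair n}" \<kappa>s] finite_subset[OF _ fin(2)] by blast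
      moreover obtain q X where qX: "\<kappa>s n0 = (q, X)" by fastforce
      ultimately have T: "infinite {n. stair n \<and> \<kappa>s n = (q, X)}" by simp
      have \<kappa>: "(q, X) \<in> ?K" using mem[of n0] ne[of n0] hd_in_set qX by (force simp: \<kappa>s_def)
      \<comment> \<open>Successive stairs may be joined by silent moves alone, so the next cut is
        delayed until a letter has been read and an accepting state visited.\<close>
      have bound: "\<exists>m>n. stair m \<and> \<kappa>s m = (q, X) \<and> ?pos (c n) < ?pos (c m) \<and>
        (\<exists>j. n < j \<and> j \<le> m \<and> fst (c j) \<in> ?F)" for n
      proof -
        obtain j where j: "n < j" "fst (c j) \<in> ?F" using c(4) unfolding INFM_nat by blast
        obtain n' where n': "Suc (?pos (c n)) \<le> ?pos (c n')" using c(3) by blast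
        obtain m where m: "max j n' < m" "stair m" "\<kappa>s m = (q, X)"
          using T unfolding infinite_nat_iff_unbounded by blast
        then show ?thesis using j n' pos_mono[of n' m] by (intro exI[of _ m]) auto
      qed
      have "\<exists>s. \<forall>i. (stair (s i) \<and> \<kappa>s (s i) = (q, X) \<and> 0 < ?pos (c (s i))) \<and>
        (s i < s (Suc i) \<and> ?pos (c (s i)) < ?pos (c (s (Suc i))) \<and>
        (\<exists>j. s i < j \<and> j \<le> s (Suc i) \<and> fst (c j) \<in> ?F))"
      proof (rule dependent_nat_choice)
        show "\<exists>m. stair m \<and> \<kappa>s m = (q, X) \<and> 0 < ?pos (c m)"
          using bound[of 0] by auto
        fix n :: nat and i :: nat
        show "\<exists>m. (stair m \<and> \<kappa>s m = (q, X) \<and> 0 < ?pos (c m)) \<and>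
          (n < m \<and> ?pos (c n) < ?pos (c m) \<and> (\<exists>j. n < j \<and> j \<le> m \<and> fst (c j) \<in> ?F))"
          using bound[of n] by auto
      qed
      then obtain s where s: "\<And>i. stair (s i)" "\<And>i. \<kappa>s (s i) = (q, X)" "\<And>i. 0 < ?pos (c (s i))"
        "\<And>i. s i < s (Suc i)" "\<And>i. ?pos (c (s i)) < ?pos (c (s (Suc i)))"
        "\<And>i. \<exists>j. s i < j \<and> j \<le> s (Suc i) \<and> fst (c j) \<in> ?F"
        by blast
      define f where "f i = ?pos (c (s i))" for i
      have f: "strict_mono f" "0 < f 0" using s(3,5) by (simp_all add: f_def strict_mono_Suc_iff)
      have c_s: "\<exists>\<beta>. c (s i) = (q, f i, X # \<beta>)" for i
        using s(2)[of i] ne[of "s i"] by (cases "c (s i)") (auto simp: \<kappa>s_def f_def neq_Nil_conv)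
      have "prefix (f 0) w \<in> U (q, X)"
        using run[of 0 "s 0"] c_s[of 0] c(1) by (auto simp: U_def)
      moreover have "subsequence w (f i) (f (Suc i)) \<in> V (q, X)" for i
      proof -
        obtain \<beta> where \<beta>: "c (s i) = (q, f i, [X] @ \<beta>)" using c_s[of i] by auto
        define m where "m = s (Suc i) - s i"
        have m: "s i + m = s (Suc i)" using s(4)[of i] by (simp add: m_def)
        have height: "length \<beta> < length (snd (snd (c (s i + n))))" for n
        proof -
          have "?ht (c (s i)) \<le> ?ht (c (s i + n))" using s(1)[of i] by (simp add: stair_def)
          then show ?thesis using \<beta> by simp
        qed
        obtain c' where c': "pda_run P (suffix (f i) w) c' m"
          "\<And>n. n \<le> m \<Longrightarrow> c (s i + n) = pda_shift (f i) \<beta> (c' n)"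
          using pda_run_unshift[OF run[of "s i" m], of q "f i" "[X]" \<beta>] \<beta> height by auto
        have c'0: "c' 0 = (q, 0, [X])"
          using c'(2)[of 0] \<beta> by (cases "c' 0") (simp add: pda_shift_def)
        obtain \<beta>' where \<beta>': "c (s (Suc i)) = (q, f (Suc i), X # \<beta>')" using c_s[of "Suc i"] by auto
        have "snd (snd (c' m)) \<noteq> []"
          using height[of m] c'(2)[of m] by (auto simp: pda_shift_def)
        then obtain \<beta>2 where \<beta>2: "c' m = (q, f (Suc i) - f i, X # \<beta>2)"
          using c'(2)[of m] \<beta>' m by (cases "c' m") (auto simp: pda_shift_def neq_Nil_conv)
        obtain j where j: "s i < j" "j \<le> s (Suc i)" "fst (c j) \<in> ?F" using s(6) by blast
        then have "fst (c' (j - s i)) \<in> ?F"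
          using c'(2)[of "j - s i"] by (simp add: pda_shift_def m_def)
        then have "\<exists>n. 0 < n \<and> n \<le> m \<and> fst (c' n) \<in> ?F"
          using j by (intro exI[of _ "j - s i"]) (simp add: m_def)
        then have "\<exists>w' c m \<beta>. pda_run P w' c m \<and>
            prefix (f (Suc i) - f i) w' = subsequence w (f i) (f (Suc i)) \<and> c 0 = (q, 0, [X]) \<and>
            c m = (q, f (Suc i) - f i, X # \<beta>) \<and> (\<exists>n. 0 < n \<and> n \<le> m \<and> fst (c n) \<in> ?F)"
          using c'(1) c'0 \<beta>2 strict_monoD[OF f(1), of i "Suc i"]
          by (intro exI[of _ "suffix (f i) w"] exI[of _ c'] exI[of _ m] exI[of _ \<beta>2]) simp
        then show ?thesis by (simp add: V_def)
      qed
      ultimately show "w \<in> ?R" using range \<kappa> f by blast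
    next
      fix w assume "w \<in> ?R"
      then obtain q X f where f: "strict_mono f" "0 < f 0"
        and u: "prefix (f 0) w \<in> U (q, X)" and v: "\<And>i. subsequence w (f i) (f (Suc i)) \<in> V (q, X)"
        by blast
      obtain w0 c0 m0 \<beta>0 where c0: "pda_run P w0 c0 m0" "prefix (f 0) w0 = prefix (f 0) w"
        "c0 0 = (pda_initial P, 0, [pda_bottom P])" "c0 m0 = (q, f 0, X # \<beta>0)"
        using u by (auto simp: U_def)
      have "\<forall>i. \<exists>w' c m \<beta>. pda_run P w' c m \<and>
        prefix (f (Suc i) - f i) w' = subsequence w (f i) (f (Suc i)) \<and>
        c 0 = (q, 0, [X]) \<and> c m = (q, f (Suc i) - f i, X # \<beta>) \<and> (\<exists>n. 0 < n \<and> n \<le> m \<and> fst (c n) \<in> ?F)"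
        using v unfolding V_def by simp
      then obtain ws cs ms \<beta>s where cs: "\<And>i. pda_run P (ws i) (cs i) (ms i)"
        "\<And>i. prefix (f (Suc i) - f i) (ws i) = subsequence w (f i) (f (Suc i))"
        "\<And>i. cs i 0 = (q, 0, [X])" "\<And>i. cs i (ms i) = (q, f (Suc i) - f i, X # \<beta>s i)"
        "\<And>i. \<exists>n. 0 < n \<and> n \<le> ms i \<and> fst (cs i n) \<in> ?F"
        by metis
      have f_less: "f i < f (Suc i)" for i using f(1) by (simp add: strict_monoD)
      \<comment> \<open>The stack below the recurring symbol \<open>X\<close> at the
        \<open>i\<close>-th joint: the remainders of all segments so far.\<close>
      define \<delta> where "\<delta> = rec_nat \<beta>0 (\<lambda>i d. \<beta>s i @ d)"
      have \<delta>: "\<delta> 0 = \<beta>0" "\<delta> (Suc i) = \<beta>s i @ \<delta> i" for i by (simp_all add: \<delta>_def)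
      define m where "m i = (case i of 0 \<Rightarrow> m0 | Suc i \<Rightarrow> ms i)" for i
      define \<rho> where "\<rho> i j = (case i of 0 \<Rightarrow> c0 j | Suc i \<Rightarrow> pda_shift (f i) (\<delta> i) (cs i j))" for i j
      define g where "g i = sum m {..<i}" for i
      have "0 < m i" for i
      proof (cases i)
        case 0
        have "m0 \<noteq> 0" using c0(3,4) f(2) by (intro notI) simp
        then show ?thesis using 0 by (simp add: m_def)
      next
        case (Suc i')
        then show ?thesis using cs(5)[of i'] by (auto simp: m_def)
      qed
      then have g: "strict_mono g" "g 0 = 0" "g (Suc i) - g i = m i" for i
        by (simp_all add: g_def strict_mono_Suc_iff)
      have joint: "\<rho> i (m i) = (q, f i, X # \<delta> i)" "\<rho> (Suc i) 0 = (q, f i, X # \<delta> i)" for i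
        using c0(4) cs(3,4) f_less by (auto simp: \<rho>_def m_def pda_shift_def \<delta> less_imp_le split: nat.split)
      have steps: "pda_run P w (\<rho> i) (m i)" for i
      proof (cases i)
        case 0
        have "pda_run P w (\<lambda>n. pda_shift 0 [] (c0 n)) m0"
          using c0(1)
        proof (rule pda_run_shift)
          fix p assume "p < fst (snd (c0 m0))"
          then show "w (0 + p) = w0 p"
            using c0(4) subsequence_eq_nth[OF c0(2), of p] by simp
        qed
        moreover have "\<rho> 0 = c0" by (simp add: \<rho>_def fun_eq_iff)
        ultimately show ?thesis using 0 by (simp add: m_def pda_shift_def)
      next
        case (Suc i')
        have "pda_run P w (\<lambda>n. pda_shift (f i') (\<delta> i') (cs i' n)) (ms i')"
          using cs(1)
        proof (rule pda_run_shift)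
          fix p assume "p < fst (snd (cs i' (ms i')))"
          then have p: "p < f (Suc i') - f i'" using cs(4) by simp
          then have "ws i' p = prefix (f (Suc i') - f i') (ws i') ! p" by simp
          also have "\<dots> = w (f i' + p)" unfolding cs(2) using p by simp
          finally show "w (f i' + p) = ws i' p" by simp
        qed
        moreover have "\<rho> (Suc i') = (\<lambda>n. pda_shift (f i') (\<delta> i') (cs i' n))"
          by (simp add: \<rho>_def fun_eq_iff)
        ultimately show ?thesis using Suc by (simp add: m_def)
      qed
      have "\<rho> i (g (Suc i) - g i) = \<rho> (Suc i) 0" for i
        by (simp only: g(3) joint)
      then obtain r where r: "\<And>i j. j \<le> m i \<Longrightarrow> r (g i + j) = \<rho> i j"
        using ex_concatenation[OF g(1,2), of \<rho>] unfolding g(3) by metis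
      have g_Suc: "g (Suc i) = g i + m i" for i by (simp add: g_def)
      have "pda_step P w (r n) (r (Suc n))" for n
      proof -
        obtain i where i: "g i \<le> n" "n < g (Suc i)"
          using strict_mono_interval[OF g(1), of n] g(2) by auto
        then have "pda_step P w (\<rho> i (n - g i)) (\<rho> i (Suc (n - g i)))"
          using steps[of i] by (simp add: pda_run_def g_Suc)
        then show ?thesis
          using r[of "n - g i" i] r[of "Suc (n - g i)" i] i by (simp add: g_Suc)
      qed
      moreover have "r 0 = (pda_initial P, 0, [pda_bottom P])"
        using r[of 0 0] g(2) c0(3) by (simp add: \<rho>_def)
      moreover have "\<exists>n. i \<le> ?pos (r n)" for i
      proof -
        have "r (g i + m i) = (q, f i, X # \<delta> i)" using r[of "m i" i] joint(1) by simp
        moreover have "i \<le> f i" using f(1) by (rule strict_mono_imp_increasing)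
        ultimately show ?thesis by (intro exI[of _ "g i + m i"]) simp
      qed
      moreover have "\<exists>\<^sub>\<infinity>n. fst (r n) \<in> ?F"
        unfolding INFM_nat
      proof
        fix N
        obtain n where n: "0 < n" "n \<le> ms N" "fst (cs N n) \<in> ?F" using cs(5) by blast
        then have "fst (r (g (Suc N) + n)) \<in> ?F"
          using r[of n "Suc N"] by (simp add: m_def \<rho>_def pda_shift_def)
        moreover have "N < g (Suc N) + n"
          using strict_mono_imp_increasing[OF g(1), of "Suc N"] by simp
        ultimately show "\<exists>n>N. fst (r n) \<in> ?F" by blast
      qed
      ultimately show "w \<in> H" unfolding H pda_language_def by blast
    qed
  qed
qed

section \<open>The counterexample\<close>

text \<open>A representative instead of the class keeps \<open>V\<close> a set of words. The choice
  depends on \<open>x\<close> only through the predicate \<open>end_equal x\<close>, so end-equal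
  words get the same one.\<close>

definition end_class :: "'a word \<Rightarrow> 'a word" where
  "end_class x = (SOME y. end_equal x y)"

lemma end_class_eq_iff: "end_class x = end_class y \<longleftrightarrow> end_equal x y"
proof
  have "end_equal x (end_class x)" for x :: "'a word"
    unfolding end_class_def by (rule someI[of _ x]) (rule end_equal_refl)
  then show "end_class x = end_class y \<Longrightarrow> end_equal x y"
    by (metis end_equal_sym end_equal_trans)
  assume "end_equal x y"
  then have "end_equal x z = end_equal y z" for z
    using end_equal_trans[of x y z] end_equal_trans[of y x z] end_equal_sym[of x y] by blast
  then show "end_class x = end_class y" by (simp add: end_class_def)
qed

lemma not_end_equal_iff: "\<not> end_equal x y \<longleftrightarrow> (\<exists>\<^sub>\<infinity>i. x i \<noteq> y i)"
  unfolding end_equal_def INFM_nat_le by blast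

lemma omega_automatic_end_equal:
  assumes "finite \<Sigma>"
  shows "omega_automatic 2 {[x, y] | x y. range x \<subseteq> \<Sigma> \<and> range y \<subseteq> \<Sigma> \<and> end_equal x y}" (is "omega_automatic 2 ?R")
proof -
  let ?\<Sigma> = "(\<lambda>(a, b). [a, b]) ` (\<Sigma> \<times> \<Sigma>)"
  have "convolution ` ?R = {w. range w \<subseteq> ?\<Sigma> \<and> (\<exists>n. \<forall>i\<ge>n. w i ! 0 = w i ! 1)}" (is "_ = ?S")
  proof (intro equalityI subsetI)
    fix w assume "w \<in> convolution ` ?R"
    then obtain x y where "w = convolution [x, y]" "range x \<subseteq> \<Sigma>" "range y \<subseteq> \<Sigma>" "end_equal x y"
      by blast
    moreover from this have "[x i, y i] \<in> ?\<Sigma>" for i by (intro image_eqI[of _ _ "(x i, y i)"]) auto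
    ultimately show "w \<in> ?S" by (auto simp: convolution_def end_equal_def)
  next
    fix w assume w: "w \<in> ?S"
    define x y where "x i = w i ! 0" and "y i = w i ! 1" for i
    have *: "w i = [x i, y i] \<and> x i \<in> \<Sigma> \<and> y i \<in> \<Sigma>" for i
    proof -
      have "w i \<in> ?\<Sigma>" using w by blast
      then show ?thesis by (auto simp: x_def y_def)
    qed
    then have "w = convolution [x, y]" by (simp add: convolution_def fun_eq_iff)
    moreover have "end_equal x y" using w by (auto simp: end_equal_def x_def y_def)
    moreover have "range x \<subseteq> \<Sigma>" "range y \<subseteq> \<Sigma>" using * by auto
    ultimately show "w \<in> convolution ` ?R" by blast
  qed
  then show ?thesis
    using omega_regular_eventually[of ?\<Sigma> "\<lambda>a. a ! 0 = a ! 1"] assms by (auto simp: omega_automatic_def)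
qed

text \<open>Not being end-equal means differing infinitely often, which is one Buchi condition for
  each pair of components.\<close>

lemma omega_automatic_distinct:
  assumes "finite \<Sigma>"
  shows "omega_automatic k {xs. length xs = k \<and> set xs \<subseteq> {x. range x \<subseteq> \<Sigma>} \<and> distinct (map end_class xs)}"
    (is "omega_automatic k ?R")
proof -
  let ?\<Sigma> = "{s. set s \<subseteq> \<Sigma> \<and> length s = k}"
  \<comment> \<open>The pair \<open>(i, j)\<close> is coded by \<open>c = i * k + j\<close>; codes
    without \<open>i < j\<close> carry a condition that always holds.\<close>
  define P where "P c a \<longleftrightarrow> (c div k < c mod k \<longrightarrow> a ! (c div k) \<noteq> a ! (c mod k))" for c and a :: "'a list"
  have distinct_iff: "distinct (map end_class xs) \<longleftrightarrow> (\<forall>c<k * k. \<exists>\<^sub>\<infinity>i. P c (convolution xs i))"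
    if "length xs = k" for xs :: "'a word list"
  proof -
    have "distinct (map end_class xs) \<longleftrightarrow>
        (\<forall>i<k. \<forall>j<k. i < j \<longrightarrow> \<not> end_equal (xs ! i) (xs ! j))"
    proof -
      have "(\<forall>i<k. \<forall>j<k. i \<noteq> j \<longrightarrow> \<not> end_equal (xs ! i) (xs ! j)) \<longleftrightarrow>
          (\<forall>i<k. \<forall>j<k. i < j \<longrightarrow> \<not> end_equal (xs ! i) (xs ! j))"
      proof (intro iffI allI impI)
        fix i j assume "\<forall>i<k. \<forall>j<k. i < j \<longrightarrow> \<not> end_equal (xs ! i) (xs ! j)" "i < k" "j < k" "i \<noteq> j"
        then show "\<not> end_equal (xs ! i) (xs ! j)"
          using end_equal_sym by (cases i j rule: linorder_cases) blast+
      qed simp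
      then show ?thesis using that by (simp add: distinct_conv_nth end_class_eq_iff)
    qed
    also have "\<dots> \<longleftrightarrow> (\<forall>c<k * k. c div k < c mod k \<longrightarrow> \<not> end_equal (xs ! (c div k)) (xs ! (c mod k)))"
    proof (intro iffI allI impI)
      fix c assume *: "\<forall>i<k. \<forall>j<k. i < j \<longrightarrow> \<not> end_equal (xs ! i) (xs ! j)" "c < k * k" "c div k < c mod k"
      then have "c mod k < k" by (metis mod_less_divisor mult_0_right not_gr0 not_less0)
      with * show "\<not> end_equal (xs ! (c div k)) (xs ! (c mod k))" by simp
    next
      fix i j assume *: "\<forall>c<k * k. c div k < c mod k \<longrightarrow> \<not> end_equal (xs ! (c div k)) (xs ! (c mod k))"
        "i < k" "j < k" "i < j"
      have "i * k + j < Suc i * k" using *(3) by simp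
      also have "\<dots> \<le> k * k" using *(2) by (intro mult_le_mono1) simp
      finally show "\<not> end_equal (xs ! i) (xs ! j)"
        using *(1)[rule_format, of "i * k + j"] *(3,4) by simp
    qed
    also have "\<dots> \<longleftrightarrow> (\<forall>c<k * k. \<exists>\<^sub>\<infinity>i. P c (convolution xs i))"
    proof -
      have "(c div k < c mod k \<longrightarrow> \<not> end_equal (xs ! (c div k)) (xs ! (c mod k))) \<longleftrightarrow>
          (\<exists>\<^sub>\<infinity>i. P c (convolution xs i))" if "c < k * k" for c
      proof -
        have "c mod k < k" using that by (metis mod_less_divisor mult_0_right not_gr0 not_less0)
        then show ?thesis
          using \<open>length xs = k\<close> by (cases "c div k < c mod k") (simp_all add: P_def not_end_equal_iff convolution_def)
      qed
      then show ?thesis by blast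
    qed
    finally show ?thesis .
  qed
  have "convolution ` ?R = {w. range w \<subseteq> ?\<Sigma> \<and> (\<forall>c<k * k. \<exists>\<^sub>\<infinity>i. P c (w i))}" (is "_ = ?S")
  proof (intro equalityI subsetI)
    fix w assume "w \<in> convolution ` ?R"
    then obtain xs where xs: "w = convolution xs" "length xs = k" "set xs \<subseteq> {x. range x \<subseteq> \<Sigma>}"
      "distinct (map end_class xs)"
      by blast
    have "x i \<in> \<Sigma>" if "x \<in> set xs" for x i
      using subsetD[OF xs(3) that] by auto
    then have "range w \<subseteq> ?\<Sigma>"
      using xs(2) unfolding xs(1) by (auto simp: convolution_def)
    then show "w \<in> ?S" using distinct_iff[OF xs(2)] xs(1,4) by blast
  next
    fix w assume w: "w \<in> ?S"
    define xs where "xs = map (\<lambda>j i. w i ! j) [0..<k]"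
    have len: "length (w i) = k" "set (w i) \<subseteq> \<Sigma>" for i using w by auto
    have xs: "length xs = k" "w = convolution xs"
      using len(1) by (auto simp: xs_def convolution_def fun_eq_iff intro!: nth_equalityI)
    moreover have "set xs \<subseteq> {x. range x \<subseteq> \<Sigma>}"
      using len by (auto simp: xs_def subset_iff) (metis nth_mem)
    moreover have "distinct (map end_class xs)"
      using distinct_iff[OF xs(1)] w xs(2) by blast
    ultimately show "w \<in> convolution ` ?R" by blast
  qed
  moreover have "omega_regular ?S"
    using assms by (intro omega_regular_infinitely_often finite_lists_length_eq)
  ultimately show ?thesis by (auto simp: omega_automatic_def)
qed

text \<open>For the upper bound, a word is coded by its graph, a set of numbers; for the lower
  bound, spread sets are encoded by blocks of length 1.\<close>

lemma end_class_binary_eqpoll: "end_class ` {x :: nat word. range x \<subseteq> {0, 1}} \<approx> (UNIV :: nat set set)"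
proof (rule lepoll_antisym)
  have "inj (\<lambda>x :: nat word. {prod_encode (i, x i) | i. True})"
  proof (rule injI, rule ext)
    fix x y :: "nat word" and i
    assume eq: "{prod_encode (i, x i) | i. True} = {prod_encode (i, y i) | i. True}"
    have "prod_encode (i, x i) \<in> {prod_encode (i, y i) | i. True}"
      unfolding eq[symmetric] by blast
    then show "x i = y i" by auto
  qed
  then show "end_class ` {x :: nat word. range x \<subseteq> {0, 1}} \<lesssim> (UNIV :: nat set set)"
    unfolding lepoll_def by (meson inj_on_subset subset_UNIV)
next
  define blk :: "bool \<Rightarrow> nat list" where "blk b = (if b then [1] else [0])" for b
  define W where "W S = [] \<frown> (\<lambda>p. blk (p div 1 \<in> spread S) ! (p mod 1))" for S
  have "inj (\<lambda>S. end_class (W S))"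
  proof (rule injI)
    fix S T assume "end_class (W S) = end_class (W T)"
    then show "S = T"
      unfolding end_class_eq_iff W_def
      by (rule inj_spread_end_equal[rotated 3]) (auto simp: blk_def)
  qed
  moreover have "range (W S) \<subseteq> {0, 1}" for S
    by (auto simp: W_def blk_def split: if_splits)
  ultimately show "(UNIV :: nat set set) \<lesssim> end_class ` {x :: nat word. range x \<subseteq> {0, 1}}"
    unfolding lepoll_def by (intro exI[of _ "\<lambda>S. end_class (W S)"]) auto
qed

text \<open>With all \<open>k\<close>-sets in one class, every subset of \<open>V\<close> is
  homogeneous, so only the number of end classes met by a candidate can rule it out. A
  \<open>k\<close>-tuple presents a \<open>k\<close>-set iff its end classes are distinct.\<close>

lemma counterexample_presentation:
  assumes "k \<ge> 1" "l \<ge> 1" "finite \<Sigma>"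
  defines "L \<equiv> {x :: 'a word. range x \<subseteq> \<Sigma>}"
  defines "V \<equiv> end_class ` L"
  defines "E \<equiv> (\<lambda>i :: nat. if i = 1 then [V]\<^bsup>k\<^esup> else {})"
  shows "kl_partition k l V E" "omega_automatic_presentation k l V E L end_class"
proof -
  show "kl_partition k l V E"
    using assms(2) by (auto simp: kl_partition_def E_def disjoint_family_on_def split: if_splits)
  have L: "omega_regular L"
    using omega_regular_infinitely_often[OF assms(3), of 0] by (simp add: L_def)
  have "{xs. length xs = k \<and> set xs \<subseteq> L \<and> end_class ` set xs \<in> E 1} =
      {xs. length xs = k \<and> set xs \<subseteq> {x. range x \<subseteq> \<Sigma>} \<and> distinct (map end_class xs)}"
  proof -
    have "end_class ` set xs \<in> E 1 \<longleftrightarrow> distinct (map end_class xs)"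
      if "length xs = k" "set xs \<subseteq> L" for xs
    proof -
      have "end_class ` set xs \<subseteq> V" using that(2) by (auto simp: V_def)
      then have "end_class ` set xs \<in> E 1 \<longleftrightarrow> card (set (map end_class xs)) = length (map end_class xs)"
        using that(1) by (simp add: E_def nsets_def)
      then show ?thesis using card_distinct distinct_card by metis
    qed
    then show ?thesis by (auto simp: L_def)
  qed
  then have E1: "omega_automatic k {xs. length xs = k \<and> set xs \<subseteq> L \<and> end_class ` set xs \<in> E 1}"
    using omega_automatic_distinct[OF assms(3), of k] by simp
  have "omega_regular {}"
    using omega_regular_infinitely_often[of "{}" 0] by simp
  then have "omega_automatic k {xs. length xs = k \<and> set xs \<subseteq> L \<and> end_class ` set xs \<in> E i}" for i
    using E1 by (cases "i = 1") (simp_all add: E_def omega_automatic_def)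
  then have "\<forall>i\<in>{1..l}. omega_automatic k {xs. length xs = k \<and> set xs \<subseteq> L \<and> end_class ` set xs \<in> E i}"
    by blast
  moreover have "omega_automatic 2 {[x, y] | x y. x \<in> L \<and> y \<in> L \<and> end_class x = end_class y}"
    using omega_automatic_end_equal[OF assms(3)] by (simp add: L_def end_class_eq_iff)
  ultimately show "omega_automatic_presentation k l V E L end_class"
    using L by (simp add: omega_automatic_presentation_def V_def)
qed

lemma eqpoll_natD:
  assumes "X \<approx> (UNIV :: nat set)"
  shows "countable X" "infinite X"
  using countable_eqpoll[OF _ assms] eqpoll_finite_iff[OF assms] by simp_all

lemma LANG_star_not_countably_infinite:
  assumes "LANG_star H"
  shows "\<not> end_class ` H \<approx> (UNIV :: nat set)"
proof
  assume "end_class ` H \<approx> (UNIV :: nat set)"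
  then have "countable (end_class ` H)" "infinite (end_class ` H)"
    using eqpoll_natD by auto
  then show False using LANG_star_end_classes[OF assms end_class_eq_iff] by blast
qed

theorem theorem2p1:
  fixes k l :: nat
  assumes "k \<ge> 2" and "l \<ge> 2"
  shows
    "(\<forall>(V :: 'v set) E (L :: 'a word set) h.
        kl_partition k l V E \<and> V \<approx> (UNIV :: nat set) \<and>
        omega_automatic_presentation k l V E L h \<longrightarrow>
        (\<exists>H\<subseteq>L. omega_regular H \<and>
           homogeneous k l V E (h ` H) \<and> h ` H \<approx> (UNIV :: nat set))) \<and>
     (\<forall>(V :: 'w set) E (L :: 'b word set) h.
        kl_partition k l V E \<and> V \<approx> (UNIV :: nat set set) \<and>
        injective_omega_automatic_presentation k l V E L h \<longrightarrow>
        (\<exists>H\<subseteq>L. omega_regular H \<and>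
           homogeneous k l V E (h ` H) \<and> h ` H \<approx> (UNIV :: nat set))) \<and>
     (\<exists>(V :: nat word set) E (L :: nat word set) h.
        kl_partition k l V E \<and> V \<approx> (UNIV :: nat set set) \<and>
        omega_automatic_presentation k l V E L h \<and>
        (\<nexists>H. H \<subseteq> L \<and> LANG_star H \<and>
           homogeneous k l V E (h ` H) \<and> h ` H \<approx> (UNIV :: nat set)) \<and>
        (\<nexists>H. H \<subseteq> L \<and> omega_context_free H \<and>
           homogeneous k l V E (h ` H) \<and> h ` H \<approx> (UNIV :: nat set)) \<and>
        (\<nexists>H. H \<subseteq> L \<and> omega_regular H \<and>
           homogeneous k l V E (h ` H) \<and> h ` H \<approx> (UNIV :: nat set)))"
proof (intro conjI allI impI)
  fix V :: "'v set" and E and L :: "'a word set" and h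
  assume *: "kl_partition k l V E \<and> V \<approx> (UNIV :: nat set) \<and> omega_automatic_presentation k l V E L h"
  then have "infinite V" "countable V"
    using eqpoll_natD by auto
  with * show "\<exists>H\<subseteq>L. omega_regular H \<and> homogeneous k l V E (h ` H) \<and> h ` H \<approx> (UNIV :: nat set)"
    by (intro ex_regular_homogeneous) auto
next
  fix V :: "'w set" and E and L :: "'b word set" and h
  assume *: "kl_partition k l V E \<and> V \<approx> (UNIV :: nat set set) \<and>
    injective_omega_automatic_presentation k l V E L h"
  have "infinite (UNIV :: nat set set)" by (simp add: Finite_Set.finite_set)
  then have "infinite V" using * eqpoll_finite_iff by blast
  with * show "\<exists>H\<subseteq>L. omega_regular H \<and> homogeneous k l V E (h ` H) \<and> h ` H \<approx> (UNIV :: nat set)"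
    by (intro ex_regular_homogeneous)
      (auto simp: injective_omega_automatic_presentation_def bij_betw_def)
next
  let ?L = "{x :: nat word. range x \<subseteq> {0, 1}}"
  let ?V = "end_class ` ?L"
  let ?E = "\<lambda>i :: nat. if i = 1 then [?V]\<^bsup>k\<^esup> else {}"
  have "kl_partition k l ?V ?E" "omega_automatic_presentation k l ?V ?E ?L end_class"
    using counterexample_presentation[of k l "{0, 1 :: nat}"] assms by simp_all
  then show "\<exists>(V :: nat word set) E (L :: nat word set) h.
        kl_partition k l V E \<and> V \<approx> (UNIV :: nat set set) \<and>
        omega_automatic_presentation k l V E L h \<and>
        (\<nexists>H. H \<subseteq> L \<and> LANG_star H \<and>
           homogeneous k l V E (h ` H) \<and> h ` H \<approx> (UNIV :: nat set)) \<and>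
        (\<nexists>H. H \<subseteq> L \<and> omega_context_free H \<and>
           homogeneous k l V E (h ` H) \<and> h ` H \<approx> (UNIV :: nat set)) \<and>
        (\<nexists>H. H \<subseteq> L \<and> omega_regular H \<and>
           homogeneous k l V E (h ` H) \<and> h ` H \<approx> (UNIV :: nat set))"
    using end_class_binary_eqpoll LANG_star_not_countably_infinite
      omega_context_free_LANG_star omega_regular_LANG_star
    by (intro exI[of _ ?V] exI[of _ ?E] exI[of _ ?L] exI[of _ end_class]) blast
qed

end
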